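(* Let $\Omega\subset\mathbb{R}^d$ ($d=2,3$) be a bounded polyhedral domain, $\psi\in H^1_0(\Omega)\cap H^2(\Omega)$, $y_0,f\in L^2(\Omega)$, $\alpha>0$. Suppose that $(u,y,p,\xi,\mu)\in L^2(\Omega)\times H^1_0(\Omega)\times H^1_0(\Omega)\times H^{-1}(\Omega)\times H^{-1}(\Omega)$ satisfies, for some $\eta\le0$, $$\int_\Omega\nabla y\cdot\nabla\phi\,dx=\int_\Omega(f+u)\phi\,dx+\langle\xi,\phi\rangle\quad\forall\phi\in H^1_0(\Omega),$$ $$y\ge\psi\text{ a.e. in }\Omega,\quad\xi\ge0,\quad\langle\xi,y-\psi\rangle=0,$$ $$\int_\Omega\nabla p\cdot\nabla\phi\,dx=\int_\Omega(y-y_0)\phi\,dx-\langle\mu,\phi\rangle\quad\forall\phi\in H^1_0(\Omega),$$ $$\langle\xi,p\rangle=0,\quad\langle\mu,y-\psi\rangle=0,$$ $$\alpha u+p=0\quad\text{a.e. in }\Omega,$$ $$p\ge\eta(y-\psi)\text{ a.e. in }\Omega,\quad\mu\ge\eta\,\xi.$$ Then: a) $(u,y,\xi)$ is strongly stationary. b) If $$|\eta|\le\alpha\lambda_1+\sqrt{\alpha^2\lambda_1^2+\alpha},$$ then $u$ is a global minimum of problem $(\mathbb P)$. If this inequality is strict, then $u$ is the unique global minimum of $(\mathbb P)$.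
   Context: $\langle\cdot,\cdot\rangle$ is the duality pairing between $H^{-1}(\Omega)$ and $H^1_0(\Omega)$; for $\lambda\in H^{-1}(\Omega)$, $\lambda\ge0$ means $\langle\lambda,\phi\rangle\ge0$ for all $\phi\in H^1_0(\Omega)$ with $\phi\ge0$ a.e., and $\mu\ge\eta\xi$ means $\mu-\eta\xi\ge0$. Problem $(\mathbb P)$: minimise over $u\in L^2(\Omega)$ the functional $J(u)=\frac12\|y-y_0\|_{L^2(\Omega)}^2+\frac\alpha2\|u\|_{L^2(\Omega)}^2$, where $y$ is the unique solution of the obstacle problem $$y\in K,\quad\int_\Omega\nabla y\cdot\nabla(\phi-y)\,dx\ge\int_\Omega(f+u)(\phi-y)\,dx\quad\forall\phi\in K,$$ with $K=\{\phi\in H^1_0(\Omega):\phi(x)\ge\psi(x)\text{ a.e. in }\Omega\}$. A global minimum is a $u\in L^2(\Omega)$ with $J(u)\le J(v)$ for all $v\in L^2(\Omega)$. $\lambda_1=\inf_{\phi\in H^1_0(\Omega)\setminus\{0\}}\frac{\int_\Omega|\nabla\phi|^2dx}{\int_\Omega\phi^2dx}$ is the smallest eigenvalue of $-\Delta$ in $\Omega$ with homogeneous Dirichlet boundary conditions. Strong stationarity: a point $(u,y,\xi)\in L^2(\Omega)\times H^1_0(\Omega)\times H^{-1}(\Omega)$ is called strongly stationary if there exists $p\in H^1_0(\Omega)$ such that (1) $\int_\Omega\nabla y\cdot\nabla\phi\,dx=\int_\Omega(f+u)\phi\,dx+\langle\xi,\phi\rangle$ for all $\phi\in H^1_0(\Omega)$;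 (2) $y\ge\psi$ a.e. in $\Omega$, $\xi\ge0$, $\langle\xi,y-\psi\rangle=0$; (3) $p\in S_y$ and $\int_\Omega\nabla p\cdot\nabla\phi\,dx\le\int_\Omega(y-y_0)\phi\,dx$ for all $\phi\in S_y$; (4) $\alpha u+p=0$ a.e. in $\Omega$. Here $S_y=\{\phi\in H^1_0(\Omega):\phi\ge0\text{ q.e. on }Z_y,\ \langle\xi,\phi\rangle=0\}$ and $Z_y=\{x\in\Omega:y(x)=\psi(x)\}$ (defined up to sets of zero capacity); q.e. (quasi-everywhere) means outside a set of zero $H^1$-capacity, and quasi-continuous representatives of $H^1_0(\Omega)$ functions are used in these pointwise statements. *)

theory Defs
  imports "HOL-Analysis.Analysis"
begin

text \<open>
  Elements of Lebesgue and Sobolev spaces on \<open>\<Omega>\<close> are represented by functions on the whole space;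
  only their values almost everywhere in \<open>\<Omega>\<close> matter, and equality in these spaces is equality
  almost everywhere with respect to \<open>lebesgue_on \<Omega>\<close>.
\<close>

text \<open>
  A bounded polyhedral domain: a bounded, open, connected, nonempty set whose boundary consists of
  finitely many flat faces of codimension one. The faces are given as convex polytopes;
  nonconvex faces are covered by subdividing them. Convexity or the Lipschitz property of the
  domain is not required.
\<close>

definition polyhedral_domain :: "'a::euclidean_space set \<Rightarrow> bool" where
  "polyhedral_domain \<Omega> \<longleftrightarrow> open \<Omega> \<and> connected \<Omega> \<and> \<Omega> \<noteq> {} \<and> bounded \<Omega> \<and>
     (\<exists>\<F>. finite \<F> \<and> (\<forall>F\<in>\<F>. polytope F \<and> aff_dim F = int (DIM('a)) - 1) \<and> frontier \<Omega> = \<Union>\<F>)"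

primrec C_k :: "nat \<Rightarrow> ('a::euclidean_space \<Rightarrow> real) \<Rightarrow> bool" where
  "C_k 0 \<phi> \<longleftrightarrow> continuous_on UNIV \<phi>"
| "C_k (Suc k) \<phi> \<longleftrightarrow> \<phi> differentiable_on UNIV \<and>
     (\<forall>i\<in>Basis. C_k k (\<lambda>x. frechet_derivative \<phi> (at x) i))"

definition test_functions :: "'a::euclidean_space set \<Rightarrow> ('a \<Rightarrow> real) set" where
  "test_functions \<Omega> = {\<phi>. (\<forall>k. C_k k \<phi>) \<and> compact (closure {x. \<phi> x \<noteq> 0}) \<and>
     closure {x. \<phi> x \<noteq> 0} \<subseteq> \<Omega>}"

definition L2 :: "'a::euclidean_space set \<Rightarrow> ('a \<Rightarrow> 'b::euclidean_space) set" where
  "L2 \<Omega> = {f \<in> borel_measurable (lebesgue_on \<Omega>). integrable (lebesgue_on \<Omega>) (\<lambda>x. (norm (f x))\<^sup>2)}"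

definition L2_norm :: "'a::euclidean_space set \<Rightarrow> ('a \<Rightarrow> 'b::euclidean_space) \<Rightarrow> real" where
  "L2_norm \<Omega> f = sqrt (\<integral>x. (norm (f x))\<^sup>2 \<partial>lebesgue_on \<Omega>)"

definition weak_gradient :: "'a::euclidean_space set \<Rightarrow> ('a \<Rightarrow> real) \<Rightarrow> ('a \<Rightarrow> 'a) \<Rightarrow> bool" where
  "weak_gradient \<Omega> v g \<longleftrightarrow> g \<in> L2 \<Omega> \<and>
     (\<forall>\<phi>\<in>test_functions \<Omega>. \<forall>i\<in>Basis.
        (\<integral>x. v x * frechet_derivative \<phi> (at x) i \<partial>lebesgue_on \<Omega>) =
        - (\<integral>x. (g x \<bullet> i) * \<phi> x \<partial>lebesgue_on \<Omega>))"

definition H1 :: "'a::euclidean_space set \<Rightarrow> ('a \<Rightarrow> real) set" where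
  "H1 \<Omega> = {v \<in> L2 \<Omega>. \<exists>g. weak_gradient \<Omega> v g}"

text \<open>The weak gradient is unique only almost everywhere, hence the choice of a representative.\<close>

definition wgrad :: "'a::euclidean_space set \<Rightarrow> ('a \<Rightarrow> real) \<Rightarrow> 'a \<Rightarrow> 'a" where
  "wgrad \<Omega> v = (SOME g. weak_gradient \<Omega> v g)"

definition H1_norm :: "'a::euclidean_space set \<Rightarrow> ('a \<Rightarrow> real) \<Rightarrow> real" where
  "H1_norm \<Omega> v = sqrt ((L2_norm \<Omega> v)\<^sup>2 + (L2_norm \<Omega> (wgrad \<Omega> v))\<^sup>2)"

definition H2 :: "'a::euclidean_space set \<Rightarrow> ('a \<Rightarrow> real) set" where
  "H2 \<Omega> = {v \<in> H1 \<Omega>. \<forall>i\<in>Basis. (\<lambda>x. wgrad \<Omega> v x \<bullet> i) \<in> H1 \<Omega>}"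

text \<open>The closure of the test functions in \<open>H1 \<Omega>\<close>.\<close>

definition H1_0 :: "'a::euclidean_space set \<Rightarrow> ('a \<Rightarrow> real) set" where
  "H1_0 \<Omega> = {v \<in> H1 \<Omega>. \<exists>\<phi>::nat \<Rightarrow> 'a \<Rightarrow> real. (\<forall>n. \<phi> n \<in> test_functions \<Omega>) \<and>
     (\<lambda>n. H1_norm \<Omega> (\<lambda>x. \<phi> n x - v x)) \<longlonglongrightarrow> 0}"

definition dirichlet_form :: "'a::euclidean_space set \<Rightarrow> ('a \<Rightarrow> real) \<Rightarrow> ('a \<Rightarrow> real) \<Rightarrow> real" where
  "dirichlet_form \<Omega> v w = (\<integral>x. wgrad \<Omega> v x \<bullet> wgrad \<Omega> w x \<partial>lebesgue_on \<Omega>)"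

text \<open>
  The bounded linear functionals on \<open>H1_0 \<Omega>\<close>; the duality pairing of \<open>\<xi>\<close> and \<open>\<phi>\<close> is the value
  \<open>\<xi> \<phi>\<close>. Values outside \<open>H1_0 \<Omega>\<close> are irrelevant, and boundedness forces \<open>\<xi>\<close> to respect equality
  almost everywhere.
\<close>

definition H_minus1 :: "'a::euclidean_space set \<Rightarrow> (('a \<Rightarrow> real) \<Rightarrow> real) set" where
  "H_minus1 \<Omega> = {\<xi>.
     (\<forall>\<phi>\<in>H1_0 \<Omega>. \<forall>\<theta>\<in>H1_0 \<Omega>. \<xi> (\<lambda>x. \<phi> x + \<theta> x) = \<xi> \<phi> + \<xi> \<theta>) \<and>
     (\<forall>c. \<forall>\<phi>\<in>H1_0 \<Omega>. \<xi> (\<lambda>x. c * \<phi> x) = c * \<xi> \<phi>) \<and>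
     (\<exists>C. \<forall>\<phi>\<in>H1_0 \<Omega>. \<bar>\<xi> \<phi>\<bar> \<le> C * H1_norm \<Omega> \<phi>)}"

definition nonneg_functional :: "'a::euclidean_space set \<Rightarrow> (('a \<Rightarrow> real) \<Rightarrow> real) \<Rightarrow> bool" where
  "nonneg_functional \<Omega> \<xi> \<longleftrightarrow>
     (\<forall>\<phi>\<in>H1_0 \<Omega>. (AE x in lebesgue_on \<Omega>. \<phi> x \<ge> 0) \<longrightarrow> \<xi> \<phi> \<ge> 0)"

definition lambda1 :: "'a::euclidean_space set \<Rightarrow> real" where
  "lambda1 \<Omega> = Inf {dirichlet_form \<Omega> \<phi> \<phi> / (\<integral>x. (\<phi> x)\<^sup>2 \<partial>lebesgue_on \<Omega>) |\<phi>.
     \<phi> \<in> H1_0 \<Omega> \<and> \<not> (AE x in lebesgue_on \<Omega>. \<phi> x = 0)}"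

text \<open>
  The \<open>H1\<close>-capacity of a subset \<open>A\<close> of \<open>\<Omega>\<close>, taken relative to \<open>\<Omega>\<close> as is usual for obstacle
  problems. The infimum over the empty set is \<open>\<infinity>\<close>.
\<close>

definition capacity :: "'a::euclidean_space set \<Rightarrow> 'a set \<Rightarrow> ennreal" where
  "capacity \<Omega> A = Inf {ennreal ((H1_norm \<Omega> v)\<^sup>2) |v.
     v \<in> H1_0 \<Omega> \<and> (\<exists>U. open U \<and> A \<subseteq> U \<and> (AE x in lebesgue_on \<Omega>. x \<in> U \<longrightarrow> v x \<ge> 1))}"

definition quasi_everywhere :: "'a::euclidean_space set \<Rightarrow> ('a \<Rightarrow> bool) \<Rightarrow> bool" where
  "quasi_everywhere \<Omega> P \<longleftrightarrow> capacity \<Omega> {x\<in>\<Omega>. \<not> P x} = 0"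

definition quasi_continuous :: "'a::euclidean_space set \<Rightarrow> ('a \<Rightarrow> real) \<Rightarrow> bool" where
  "quasi_continuous \<Omega> v \<longleftrightarrow>
     (\<forall>\<epsilon>>0. \<exists>G. open G \<and> G \<subseteq> \<Omega> \<and> capacity \<Omega> G < ennreal \<epsilon> \<and> continuous_on (\<Omega> - G) v)"

text \<open>
  The quasi-continuous representative; it exists for functions in \<open>H1_0 \<Omega>\<close> and is unique up to sets
  of zero capacity.
\<close>

definition qc_rep :: "'a::euclidean_space set \<Rightarrow> ('a \<Rightarrow> real) \<Rightarrow> 'a \<Rightarrow> real" where
  "qc_rep \<Omega> v = (SOME w. quasi_continuous \<Omega> w \<and> (AE x in lebesgue_on \<Omega>. w x = v x))"

definition contact_set :: "'a::euclidean_space set \<Rightarrow> ('a \<Rightarrow> real) \<Rightarrow> ('a \<Rightarrow> real) \<Rightarrow> 'a set" where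
  "contact_set \<Omega> \<psi> y = {x\<in>\<Omega>. qc_rep \<Omega> y x = qc_rep \<Omega> \<psi> x}"

definition critical_cone :: "'a::euclidean_space set \<Rightarrow> ('a \<Rightarrow> real) \<Rightarrow> ('a \<Rightarrow> real) \<Rightarrow>
    (('a \<Rightarrow> real) \<Rightarrow> real) \<Rightarrow> ('a \<Rightarrow> real) set" where
  "critical_cone \<Omega> \<psi> y \<xi> = {\<phi> \<in> H1_0 \<Omega>.
     quasi_everywhere \<Omega> (\<lambda>x. x \<in> contact_set \<Omega> \<psi> y \<longrightarrow> qc_rep \<Omega> \<phi> x \<ge> 0) \<and> \<xi> \<phi> = 0}"

definition state_equation :: "'a::euclidean_space set \<Rightarrow> ('a \<Rightarrow> real) \<Rightarrow> ('a \<Rightarrow> real) \<Rightarrow>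
    ('a \<Rightarrow> real) \<Rightarrow> (('a \<Rightarrow> real) \<Rightarrow> real) \<Rightarrow> bool" where
  "state_equation \<Omega> f u y \<xi> \<longleftrightarrow> (\<forall>\<phi>\<in>H1_0 \<Omega>.
     dirichlet_form \<Omega> y \<phi> = (\<integral>x. (f x + u x) * \<phi> x \<partial>lebesgue_on \<Omega>) + \<xi> \<phi>)"

definition complementarity :: "'a::euclidean_space set \<Rightarrow> ('a \<Rightarrow> real) \<Rightarrow> ('a \<Rightarrow> real) \<Rightarrow>
    (('a \<Rightarrow> real) \<Rightarrow> real) \<Rightarrow> bool" where
  "complementarity \<Omega> \<psi> y \<xi> \<longleftrightarrow> (AE x in lebesgue_on \<Omega>. y x \<ge> \<psi> x) \<and>
     nonneg_functional \<Omega> \<xi> \<and> \<xi> (\<lambda>x. y x - \<psi> x) = 0"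

definition strongly_stationary :: "'a::euclidean_space set \<Rightarrow> ('a \<Rightarrow> real) \<Rightarrow> ('a \<Rightarrow> real) \<Rightarrow>
    ('a \<Rightarrow> real) \<Rightarrow> real \<Rightarrow> ('a \<Rightarrow> real) \<Rightarrow> ('a \<Rightarrow> real) \<Rightarrow> (('a \<Rightarrow> real) \<Rightarrow> real) \<Rightarrow> bool" where
  "strongly_stationary \<Omega> \<psi> y\<^sub>0 f \<alpha> u y \<xi> \<longleftrightarrow>
     u \<in> L2 \<Omega> \<and> y \<in> H1_0 \<Omega> \<and> \<xi> \<in> H_minus1 \<Omega> \<and>
     (\<exists>p\<in>H1_0 \<Omega>.
        state_equation \<Omega> f u y \<xi> \<and>
        complementarity \<Omega> \<psi> y \<xi> \<and>
        p \<in> critical_cone \<Omega> \<psi> y \<xi> \<and>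
        (\<forall>\<phi>\<in>critical_cone \<Omega> \<psi> y \<xi>.
           dirichlet_form \<Omega> p \<phi> \<le> (\<integral>x. (y x - y\<^sub>0 x) * \<phi> x \<partial>lebesgue_on \<Omega>)) \<and>
        (AE x in lebesgue_on \<Omega>. \<alpha> * u x + p x = 0))"

definition admissible :: "'a::euclidean_space set \<Rightarrow> ('a \<Rightarrow> real) \<Rightarrow> ('a \<Rightarrow> real) set" where
  "admissible \<Omega> \<psi> = {\<phi> \<in> H1_0 \<Omega>. AE x in lebesgue_on \<Omega>. \<phi> x \<ge> \<psi> x}"

definition obstacle_solution :: "'a::euclidean_space set \<Rightarrow> ('a \<Rightarrow> real) \<Rightarrow> ('a \<Rightarrow> real) \<Rightarrow>
    ('a \<Rightarrow> real) \<Rightarrow> ('a \<Rightarrow> real) \<Rightarrow> bool" where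
  "obstacle_solution \<Omega> \<psi> f u y \<longleftrightarrow> y \<in> admissible \<Omega> \<psi> \<and>
     (\<forall>\<phi>\<in>admissible \<Omega> \<psi>. dirichlet_form \<Omega> y (\<lambda>x. \<phi> x - y x) \<ge>
        (\<integral>x. (f x + u x) * (\<phi> x - y x) \<partial>lebesgue_on \<Omega>))"

text \<open>
  The solution of the obstacle problem is unique as an element of \<open>H1_0 \<Omega>\<close>, i.e. up to equality
  almost everywhere, hence \<open>SOME\<close> instead of \<open>THE\<close>.
\<close>

definition obstacle_state :: "'a::euclidean_space set \<Rightarrow> ('a \<Rightarrow> real) \<Rightarrow> ('a \<Rightarrow> real) \<Rightarrow>
    ('a \<Rightarrow> real) \<Rightarrow> 'a \<Rightarrow> real" where
  "obstacle_state \<Omega> \<psi> f u = (SOME y. obstacle_solution \<Omega> \<psi> f u y)"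

definition cost :: "'a::euclidean_space set \<Rightarrow> ('a \<Rightarrow> real) \<Rightarrow> ('a \<Rightarrow> real) \<Rightarrow> ('a \<Rightarrow> real) \<Rightarrow>
    real \<Rightarrow> ('a \<Rightarrow> real) \<Rightarrow> real" where
  "cost \<Omega> \<psi> y\<^sub>0 f \<alpha> u =
     1 / 2 * (L2_norm \<Omega> (\<lambda>x. obstacle_state \<Omega> \<psi> f u x - y\<^sub>0 x))\<^sup>2 + \<alpha> / 2 * (L2_norm \<Omega> u)\<^sup>2"

definition global_minimum :: "'a::euclidean_space set \<Rightarrow> ('a \<Rightarrow> real) \<Rightarrow> ('a \<Rightarrow> real) \<Rightarrow>
    ('a \<Rightarrow> real) \<Rightarrow> real \<Rightarrow> ('a \<Rightarrow> real) \<Rightarrow> bool" where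
  "global_minimum \<Omega> \<psi> y\<^sub>0 f \<alpha> u \<longleftrightarrow>
     u \<in> L2 \<Omega> \<and> (\<forall>v\<in>L2 \<Omega>. cost \<Omega> \<psi> y\<^sub>0 f \<alpha> u \<le> cost \<Omega> \<psi> y\<^sub>0 f \<alpha> v)"

definition unique_global_minimum :: "'a::euclidean_space set \<Rightarrow> ('a \<Rightarrow> real) \<Rightarrow> ('a \<Rightarrow> real) \<Rightarrow>
    ('a \<Rightarrow> real) \<Rightarrow> real \<Rightarrow> ('a \<Rightarrow> real) \<Rightarrow> bool" where
  "unique_global_minimum \<Omega> \<psi> y\<^sub>0 f \<alpha> u \<longleftrightarrow> global_minimum \<Omega> \<psi> y\<^sub>0 f \<alpha> u \<and>
     (\<forall>v. global_minimum \<Omega> \<psi> y\<^sub>0 f \<alpha> v \<longrightarrow> (AE x in lebesgue_on \<Omega>. v x = u x))"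

end

theory Submission
  imports Defs
begin

text \<open>
  The multiplier of an arbitrary competitor \<open>v\<close> with state \<open>z\<close> is \<open>\<zeta> = - \<Delta> z - f - v \<ge> 0\<close>. Testing the
  adjoint equation with \<open>z - y\<close> gives
  \<open>J v - J u = 1/2 \<parallel>z - y\<parallel>\<^sup>2 + \<alpha>/2 \<parallel>v - u\<parallel>\<^sup>2 + \<langle>\<zeta>, p\<rangle> + \<langle>\<mu>, z - \<psi>\<rangle>\<close>, and the sign conditions on \<open>p\<close> and \<open>\<mu>\<close>
  bound the last two terms from below by \<open>\<eta> \<langle>\<xi> - \<zeta>, z - y\<rangle> = \<bar>\<eta>\<bar> (\<integral> \<bar>\<nabla>(z - y)\<bar>\<^sup>2 - \<integral> (v - u) (z - y))\<close>.
  With the definition of \<open>\<lambda>\<^sub>1\<close> this is a quadratic form in \<open>\<parallel>z - y\<parallel>\<close> and \<open>\<parallel>v - u\<parallel>\<close>, nonnegative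
  exactly under the bound on \<open>\<bar>\<eta>\<bar>\<close>. For strong stationarity, \<open>\<nu> = \<mu> - \<eta> \<xi>\<close> is a nonnegative functional
  with \<open>\<nu> (y - \<psi>) = 0\<close>, hence it is nonnegative on functions which are nonnegative
  quasi-everywhere on the contact set.
\<close>

subsection \<open>The space of square integrable functions\<close>

text \<open>The terms \<open>wgrad\<close>, \<open>qc_rep\<close> and \<open>obstacle_state\<close>
  are arbitrary choices, so each says something only once existence is known. This shapes the
  development. Weak gradients are unique by the fundamental lemma of the calculus of variations;
  quasi-continuous representatives arise as uniform limits of test functions off sets of small
  capacity; states arise as minimisers of the energy over the admissible set, without weak
  compactness, because minimising sequences are Cauchy by convexity. To keep the choice in
  \<open>wgrad\<close> out of limit arguments, a function and its gradient are carried together by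
  the relation \<open>sobolev_graph\<close>, the closure of the pairs (\<phi>, grad \<phi>) in L2.

  In the cost identity the terms linear in \<open>v - u\<close> disappear because
  \<open>\<alpha> u + p = 0\<close> cancels the pairing of \<open>v - u\<close> with
  \<open>p\<close> that remains when the two states are subtracted. The bound on \<bar>\<eta>\<bar>
  is the positive root of \<open>t^2 - 2 \<alpha> \<lambda> t - \<alpha>\<close> with \<lambda> the
  first eigenvalue: up to a factor, this polynomial is the discriminant of the quadratic form in the
  two norms.\<close>

lemma L2_measurable: "f \<in> L2 \<Omega> \<Longrightarrow> f \<in> borel_measurable (lebesgue_on \<Omega>)"
  by (simp add: L2_def)

lemma L2_integrable_sq: "f \<in> L2 \<Omega> \<Longrightarrow> integrable (lebesgue_on \<Omega>) (\<lambda>x. (norm (f x))\<^sup>2)"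
  by (simp add: L2_def)

lemma L2_norm_nonneg [simp]: "L2_norm \<Omega> f \<ge> 0"
  by (simp add: L2_norm_def)

lemma L2_norm_sq: "(L2_norm \<Omega> f)\<^sup>2 = (\<integral>x. (norm (f x))\<^sup>2 \<partial>lebesgue_on \<Omega>)"
  by (simp add: L2_norm_def)

lemma L2_norm_sq_real:
  fixes f :: "'a::euclidean_space \<Rightarrow> real"
  shows "(L2_norm \<Omega> f)\<^sup>2 = (\<integral>x. (f x)\<^sup>2 \<partial>lebesgue_on \<Omega>)"
  by (simp add: L2_norm_sq)

text \<open>The target spaces of \<open>f\<close> and \<open>g\<close> may differ, so a vector field
  can be dominated by a scalar function and conversely. One domination argument yields both
  membership and the norm estimate.\<close>

lemma L2_bound:
  fixes f :: "'a::euclidean_space \<Rightarrow> 'b::euclidean_space" and g :: "'a \<Rightarrow> 'c::euclidean_space"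
  assumes "f \<in> borel_measurable (lebesgue_on \<Omega>)" "g \<in> L2 \<Omega>"
    and "AE x in lebesgue_on \<Omega>. norm (f x) \<le> C * norm (g x)" "C \<ge> 0"
  shows "f \<in> L2 \<Omega>" "L2_norm \<Omega> f \<le> C * L2_norm \<Omega> g"
proof -
  have le: "AE x in lebesgue_on \<Omega>. (norm (f x))\<^sup>2 \<le> C\<^sup>2 * (norm (g x))\<^sup>2"
    using assms(3) by eventually_elim (metis norm_ge_zero power_mono power_mult_distrib)
  have int: "integrable (lebesgue_on \<Omega>) (\<lambda>x. C\<^sup>2 * (norm (g x))\<^sup>2)"
    using L2_integrable_sq[OF assms(2)] by simp
  have "integrable (lebesgue_on \<Omega>) (\<lambda>x. (norm (f x))\<^sup>2)"
  proof (rule Bochner_Integration.integrable_bound[OF int])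
    show "(\<lambda>x. (norm (f x))\<^sup>2) \<in> borel_measurable (lebesgue_on \<Omega>)"
      using assms(1) by measurable
    show "AE x in lebesgue_on \<Omega>. norm ((norm (f x))\<^sup>2) \<le> norm (C\<^sup>2 * (norm (g x))\<^sup>2)"
      using le by eventually_elim simp
  qed
  then show fL: "f \<in> L2 \<Omega>" using assms(1) by (simp add: L2_def)
  have "(L2_norm \<Omega> f)\<^sup>2 \<le> C\<^sup>2 * (L2_norm \<Omega> g)\<^sup>2"
    unfolding L2_norm_sq using integral_mono_AE[OF L2_integrable_sq[OF fL] int le] by simp
  then show "L2_norm \<Omega> f \<le> C * L2_norm \<Omega> g"
    using assms(4) by (auto intro: power2_le_imp_le simp flip: power_mult_distrib)
qed

lemma L2_norm_mono:
  fixes f :: "'a::euclidean_space \<Rightarrow> 'b::euclidean_space" and g :: "'a \<Rightarrow> 'c::euclidean_space"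
  assumes "f \<in> borel_measurable (lebesgue_on \<Omega>)" "g \<in> L2 \<Omega>"
    and "AE x in lebesgue_on \<Omega>. norm (f x) \<le> norm (g x)"
  shows "L2_norm \<Omega> f \<le> L2_norm \<Omega> g"
  using L2_bound(2)[of f \<Omega> g 1] assms by simp

lemma L2_norm_cong:
  assumes "AE x in lebesgue_on \<Omega>. f x = g x" "f \<in> L2 \<Omega>" "g \<in> L2 \<Omega>"
  shows "L2_norm \<Omega> f = L2_norm \<Omega> g"
proof -
  have "AE x in lebesgue_on \<Omega>. norm (f x) \<le> norm (g x)" "AE x in lebesgue_on \<Omega>. norm (g x) \<le> norm (f x)"
    using assms(1) by (eventually_elim, simp)+
  then show ?thesis
    using L2_norm_mono[of f \<Omega> g] L2_norm_mono[of g \<Omega> f] assms(2,3) L2_measurable by (intro antisym) auto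
qed

lemma L2_zero [simp]: "(\<lambda>x. 0) \<in> L2 \<Omega>"
  by (simp add: L2_def)

lemma L2_norm_zero [simp]: "L2_norm \<Omega> (\<lambda>x. 0) = 0"
  by (simp add: L2_norm_def)

lemma L2_scaleR:
  assumes "f \<in> L2 \<Omega>"
  shows "(\<lambda>x. c *\<^sub>R f x) \<in> L2 \<Omega>" "L2_norm \<Omega> (\<lambda>x. c *\<^sub>R f x) = \<bar>c\<bar> * L2_norm \<Omega> f"
proof -
  show "(\<lambda>x. c *\<^sub>R f x) \<in> L2 \<Omega>"
    using assms by (auto simp: L2_def power_mult_distrib)
  show "L2_norm \<Omega> (\<lambda>x. c *\<^sub>R f x) = \<bar>c\<bar> * L2_norm \<Omega> f"
    by (simp add: L2_norm_def power_mult_distrib real_sqrt_mult)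
qed

lemma L2_mult:
  fixes f :: "'a::euclidean_space \<Rightarrow> real"
  assumes "f \<in> L2 \<Omega>"
  shows "(\<lambda>x. c * f x) \<in> L2 \<Omega>"
  using L2_scaleR(1)[OF assms, of c] by simp

lemma L2_norm_mult:
  fixes f :: "'a::euclidean_space \<Rightarrow> real"
  shows "L2_norm \<Omega> (\<lambda>x. c * f x) = \<bar>c\<bar> * L2_norm \<Omega> f"
  by (simp add: L2_norm_def power_mult_distrib real_sqrt_mult)

lemma L2_add:
  assumes "f \<in> L2 \<Omega>" "g \<in> L2 \<Omega>"
  shows "(\<lambda>x. f x + g x) \<in> L2 \<Omega>"
proof -
  have [measurable]: "f \<in> borel_measurable (lebesgue_on \<Omega>)" "g \<in> borel_measurable (lebesgue_on \<Omega>)"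
    using assms L2_measurable by auto
  have int: "integrable (lebesgue_on \<Omega>) (\<lambda>x. 2 * (norm (f x))\<^sup>2 + 2 * (norm (g x))\<^sup>2)"
    using assms[THEN L2_integrable_sq] by (intro Bochner_Integration.integrable_add) auto
  have "(norm (f x + g x))\<^sup>2 \<le> 2 * (norm (f x))\<^sup>2 + 2 * (norm (g x))\<^sup>2" for x
  proof -
    have "(norm (f x + g x))\<^sup>2 \<le> (norm (f x) + norm (g x))\<^sup>2"
      by (intro power_mono norm_triangle_ineq) simp
    also have "\<dots> \<le> 2 * (norm (f x))\<^sup>2 + 2 * (norm (g x))\<^sup>2"
      using sum_squares_bound[of "norm (f x)" "norm (g x)"] by (simp add: power2_sum)
    finally show ?thesis .
  qed
  then have "integrable (lebesgue_on \<Omega>) (\<lambda>x. (norm (f x + g x))\<^sup>2)"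
    by (intro Bochner_Integration.integrable_bound[OF int]) auto
  then show ?thesis by (simp add: L2_def)
qed

lemma L2_minus:
  assumes "f \<in> L2 \<Omega>"
  shows "(\<lambda>x. - f x) \<in> L2 \<Omega>"
  using L2_scaleR(1)[OF assms, of "-1"] by simp

lemma L2_diff:
  assumes "f \<in> L2 \<Omega>" "g \<in> L2 \<Omega>"
  shows "(\<lambda>x. f x - g x) \<in> L2 \<Omega>"
  using L2_add[OF assms(1) L2_minus[OF assms(2)]] by simp

lemma L2_norm_commute: "L2_norm \<Omega> (\<lambda>x. f x - g x) = L2_norm \<Omega> (\<lambda>x. g x - f x)"
  by (simp add: L2_norm_def norm_minus_commute)

lemma L2_norm_eq_0_iff:
  assumes "f \<in> L2 \<Omega>"
  shows "L2_norm \<Omega> f = 0 \<longleftrightarrow> (AE x in lebesgue_on \<Omega>. f x = 0)"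
proof -
  have "L2_norm \<Omega> f = 0 \<longleftrightarrow> (\<integral>x. (norm (f x))\<^sup>2 \<partial>lebesgue_on \<Omega>) = 0"
    by (simp add: L2_norm_def)
  also have "\<dots> \<longleftrightarrow> (AE x in lebesgue_on \<Omega>. (norm (f x))\<^sup>2 = 0)"
    by (rule integral_nonneg_eq_0_iff_AE) (use assms L2_integrable_sq in auto)
  finally show ?thesis by simp
qed

lemma L2_norm_mult_integrable:
  assumes "f \<in> L2 \<Omega>" "g \<in> L2 \<Omega>"
  shows "integrable (lebesgue_on \<Omega>) (\<lambda>x. norm (f x) * norm (g x))"
proof -
  have [measurable]: "f \<in> borel_measurable (lebesgue_on \<Omega>)" "g \<in> borel_measurable (lebesgue_on \<Omega>)"
    using assms L2_measurable by auto
  have int: "integrable (lebesgue_on \<Omega>) (\<lambda>x. (norm (f x))\<^sup>2 + (norm (g x))\<^sup>2)"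
    using assms[THEN L2_integrable_sq] by (intro Bochner_Integration.integrable_add) auto
  have "norm (f x) * norm (g x) \<le> (norm (f x))\<^sup>2 + (norm (g x))\<^sup>2" for x
  proof -
    have "2 * norm (f x) * norm (g x) \<le> (norm (f x))\<^sup>2 + (norm (g x))\<^sup>2" "0 \<le> norm (f x) * norm (g x)"
      by (simp_all add: sum_squares_bound)
    then show ?thesis by linarith
  qed
  then show ?thesis
    by (intro Bochner_Integration.integrable_bound[OF int]) (auto simp: abs_mult)
qed

lemma L2_inner_integrable:
  assumes "f \<in> L2 \<Omega>" "g \<in> L2 \<Omega>"
  shows "integrable (lebesgue_on \<Omega>) (\<lambda>x. f x \<bullet> g x)"
proof -
  have [measurable]: "f \<in> borel_measurable (lebesgue_on \<Omega>)" "g \<in> borel_measurable (lebesgue_on \<Omega>)"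
    using assms L2_measurable by auto
  show ?thesis
    by (rule Bochner_Integration.integrable_bound[OF L2_norm_mult_integrable[OF assms]])
       (auto simp: abs_mult Cauchy_Schwarz_ineq2)
qed

lemma L2_mult_integrable:
  fixes f g :: "'a::euclidean_space \<Rightarrow> real"
  assumes "f \<in> L2 \<Omega>" "g \<in> L2 \<Omega>"
  shows "integrable (lebesgue_on \<Omega>) (\<lambda>x. f x * g x)"
  using L2_inner_integrable[OF assms] by simp

lemma L2_Holder:
  assumes "f \<in> L2 \<Omega>" "g \<in> L2 \<Omega>"
  shows "(\<integral>x. norm (f x) * norm (g x) \<partial>lebesgue_on \<Omega>) \<le> L2_norm \<Omega> f * L2_norm \<Omega> g"
proof -
  let ?a = "L2_norm \<Omega> f" and ?b = "L2_norm \<Omega> g"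
  consider "?a = 0" | "?b = 0" | "?a > 0" "?b > 0"
    using L2_norm_nonneg[of \<Omega> f] L2_norm_nonneg[of \<Omega> g] by linarith
  then show ?thesis
  proof cases
    case 1
    then have "AE x in lebesgue_on \<Omega>. norm (f x) * norm (g x) = 0"
      using L2_norm_eq_0_iff[OF assms(1)] by (auto elim!: AE_mp)
    then show ?thesis using 1 by (simp add: integral_eq_zero_AE)
  next
    case 2
    then have "AE x in lebesgue_on \<Omega>. norm (f x) * norm (g x) = 0"
      using L2_norm_eq_0_iff[OF assms(2)] by (auto elim!: AE_mp)
    then show ?thesis using 2 by (simp add: integral_eq_zero_AE)
  next
    case 3
    \<comment> \<open>Young's inequality with weights balanced by the norms: after integration both
      terms equal half of \<open>?a * ?b\<close>. Vanishing norms were split off because of the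
      divisions.\<close>
    have le: "norm (f x) * norm (g x) \<le> ?b / ?a / 2 * (norm (f x))\<^sup>2 + ?a / ?b / 2 * (norm (g x))\<^sup>2" for x
    proof -
      have "2 * (?b * norm (f x)) * (?a * norm (g x)) \<le> (?b * norm (f x))\<^sup>2 + (?a * norm (g x))\<^sup>2"
        by (rule sum_squares_bound)
      then show ?thesis using 3 by (simp add: field_simps power2_eq_square)
    qed
    have int: "integrable (lebesgue_on \<Omega>)
        (\<lambda>x. ?b / ?a / 2 * (norm (f x))\<^sup>2 + ?a / ?b / 2 * (norm (g x))\<^sup>2)"
      using assms[THEN L2_integrable_sq] by (intro Bochner_Integration.integrable_add integrable_mult_right) auto
    have "(\<integral>x. norm (f x) * norm (g x) \<partial>lebesgue_on \<Omega>) \<le>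
       (\<integral>x. ?b / ?a / 2 * (norm (f x))\<^sup>2 + ?a / ?b / 2 * (norm (g x))\<^sup>2 \<partial>lebesgue_on \<Omega>)"
      by (rule integral_mono[OF L2_norm_mult_integrable[OF assms] int le])
    also have "\<dots> = ?b / ?a / 2 * ?a\<^sup>2 + ?a / ?b / 2 * ?b\<^sup>2"
      unfolding L2_norm_sq
      by (subst Bochner_Integration.integral_add)
         (use assms[THEN L2_integrable_sq] in auto)
    also have "\<dots> = ?a * ?b"
      using 3 by (simp add: field_simps power2_eq_square)
    finally show ?thesis .
  qed
qed

lemma L2_Cauchy_Schwarz:
  assumes "f \<in> L2 \<Omega>" "g \<in> L2 \<Omega>"
  shows "\<bar>\<integral>x. f x \<bullet> g x \<partial>lebesgue_on \<Omega>\<bar> \<le> L2_norm \<Omega> f * L2_norm \<Omega> g"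
proof -
  have "\<bar>\<integral>x. f x \<bullet> g x \<partial>lebesgue_on \<Omega>\<bar> \<le> (\<integral>x. \<bar>f x \<bullet> g x\<bar> \<partial>lebesgue_on \<Omega>)"
    by (rule integral_abs_bound)
  also have "\<dots> \<le> (\<integral>x. norm (f x) * norm (g x) \<partial>lebesgue_on \<Omega>)"
    by (intro integral_mono integrable_abs L2_inner_integrable L2_norm_mult_integrable assms
        Cauchy_Schwarz_ineq2)
  also have "\<dots> \<le> L2_norm \<Omega> f * L2_norm \<Omega> g"
    by (rule L2_Holder[OF assms])
  finally show ?thesis .
qed

lemma L2_Cauchy_Schwarz_real:
  fixes f g :: "'a::euclidean_space \<Rightarrow> real"
  assumes "f \<in> L2 \<Omega>" "g \<in> L2 \<Omega>"
  shows "\<bar>\<integral>x. f x * g x \<partial>lebesgue_on \<Omega>\<bar> \<le> L2_norm \<Omega> f * L2_norm \<Omega> g"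
  using L2_Cauchy_Schwarz[OF assms] by simp

lemma L2_norm_triangle:
  assumes "f \<in> L2 \<Omega>" "g \<in> L2 \<Omega>"
  shows "L2_norm \<Omega> (\<lambda>x. f x + g x) \<le> L2_norm \<Omega> f + L2_norm \<Omega> g"
proof (rule power2_le_imp_le)
  have "(L2_norm \<Omega> (\<lambda>x. f x + g x))\<^sup>2 =
      (\<integral>x. (norm (f x))\<^sup>2 + 2 * (f x \<bullet> g x) + (norm (g x))\<^sup>2 \<partial>lebesgue_on \<Omega>)"
    unfolding L2_norm_sq by (simp add: power2_norm_eq_inner inner_simps inner_commute algebra_simps)
  also have "\<dots> = (L2_norm \<Omega> f)\<^sup>2 + 2 * (\<integral>x. f x \<bullet> g x \<partial>lebesgue_on \<Omega>) + (L2_norm \<Omega> g)\<^sup>2"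
    unfolding L2_norm_sq using L2_inner_integrable[OF assms] assms
    by (simp add: L2_integrable_sq)
  also have "\<dots> \<le> (L2_norm \<Omega> f)\<^sup>2 + 2 * (L2_norm \<Omega> f * L2_norm \<Omega> g) + (L2_norm \<Omega> g)\<^sup>2"
    using L2_Cauchy_Schwarz[OF assms] by simp
  finally show "(L2_norm \<Omega> (\<lambda>x. f x + g x))\<^sup>2 \<le> (L2_norm \<Omega> f + L2_norm \<Omega> g)\<^sup>2"
    by (simp add: power2_sum)
qed simp

lemma L2_norm_triangle_diff:
  assumes "f \<in> L2 \<Omega>" "g \<in> L2 \<Omega>" "h \<in> L2 \<Omega>"
  shows "L2_norm \<Omega> (\<lambda>x. f x - h x) \<le> L2_norm \<Omega> (\<lambda>x. f x - g x) + L2_norm \<Omega> (\<lambda>x. g x - h x)"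
  using L2_norm_triangle[OF L2_diff[OF assms(1,2)] L2_diff[OF assms(2,3)]] by simp

text \<open>Pairing a function with its gradient turns the H1 norm into an L2 norm, which then
  passes on its triangle inequality and homogeneity.\<close>

lemma L2_Pair:
  assumes "f \<in> L2 \<Omega>" "g \<in> L2 \<Omega>"
  shows "(\<lambda>x. (f x, g x)) \<in> L2 \<Omega>"
    "(L2_norm \<Omega> (\<lambda>x. (f x, g x)))\<^sup>2 = (L2_norm \<Omega> f)\<^sup>2 + (L2_norm \<Omega> g)\<^sup>2"
proof -
  have [measurable]: "f \<in> borel_measurable (lebesgue_on \<Omega>)" "g \<in> borel_measurable (lebesgue_on \<Omega>)"
    using assms L2_measurable by auto
  have eq: "(norm (f x, g x))\<^sup>2 = (norm (f x))\<^sup>2 + (norm (g x))\<^sup>2" for x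
    by (simp add: norm_Pair)
  show "(\<lambda>x. (f x, g x)) \<in> L2 \<Omega>"
    using assms by (simp add: L2_def norm_Pair)
  show "(L2_norm \<Omega> (\<lambda>x. (f x, g x)))\<^sup>2 = (L2_norm \<Omega> f)\<^sup>2 + (L2_norm \<Omega> g)\<^sup>2"
    unfolding L2_norm_sq eq using assms by (simp add: L2_integrable_sq)
qed

lemma L2_dominated_convergence:
  fixes f :: "nat \<Rightarrow> 'a::euclidean_space \<Rightarrow> 'b::euclidean_space" and w :: "'a \<Rightarrow> 'c::euclidean_space"
  assumes "\<And>n. f n \<in> borel_measurable (lebesgue_on \<Omega>)" "w \<in> L2 \<Omega>"
    and "\<And>n. AE x in lebesgue_on \<Omega>. norm (f n x) \<le> norm (w x)"
    and "AE x in lebesgue_on \<Omega>. (\<lambda>n. f n x) \<longlonglongrightarrow> 0"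
  shows "(\<lambda>n. L2_norm \<Omega> (f n)) \<longlonglongrightarrow> 0"
proof -
  note assms(1)[measurable]
  have "(\<lambda>n. \<integral>x. (norm (f n x))\<^sup>2 \<partial>lebesgue_on \<Omega>) \<longlonglongrightarrow> (\<integral>x. 0 \<partial>lebesgue_on \<Omega>)"
  proof (rule integral_dominated_convergence[OF _ _ L2_integrable_sq[OF assms(2)]])
    show "AE x in lebesgue_on \<Omega>. (\<lambda>n. (norm (f n x))\<^sup>2) \<longlonglongrightarrow> 0"
      using assms(4)
      by eventually_elim (use tendsto_power[OF tendsto_norm_zero, of _ _ 2] in simp)
    show "AE x in lebesgue_on \<Omega>. norm ((norm (f n x))\<^sup>2) \<le> (norm (w x))\<^sup>2" for n
      using assms(3)[of n] by eventually_elim (simp add: power_mono)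
  qed measurable
  then have "(\<lambda>n. sqrt (\<integral>x. (norm (f n x))\<^sup>2 \<partial>lebesgue_on \<Omega>)) \<longlonglongrightarrow> sqrt 0"
    by (intro tendsto_real_sqrt) simp
  then show ?thesis by (simp add: L2_norm_def)
qed

lemma L2_AE_subseq:
  assumes "\<And>n. f n \<in> L2 \<Omega>" "F \<in> L2 \<Omega>" "(\<lambda>n. L2_norm \<Omega> (\<lambda>x. f n x - F x)) \<longlonglongrightarrow> 0"
  obtains r :: "nat \<Rightarrow> nat" where "strict_mono r" "AE x in lebesgue_on \<Omega>. (\<lambda>n. f (r n) x) \<longlonglongrightarrow> F x"
proof -
  have L: "(\<lambda>x. f n x - F x) \<in> L2 \<Omega>" for n
    using assms by (intro L2_diff)
  have "\<exists>r::nat\<Rightarrow>nat. strict_mono r \<and>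
     (AE x in lebesgue_on \<Omega>. (\<lambda>n. (norm (f (r n) x - F x))\<^sup>2) \<longlonglongrightarrow> 0)"
  proof (rule tendsto_L1_AE_subseq)
    show "integrable (lebesgue_on \<Omega>) (\<lambda>x. (norm (f n x - F x))\<^sup>2)" for n
      using L2_integrable_sq[OF L] .
    have "(\<lambda>n. (L2_norm \<Omega> (\<lambda>x. f n x - F x))\<^sup>2) \<longlonglongrightarrow> 0\<^sup>2"
      by (intro tendsto_power assms)
    then show "(\<lambda>n. \<integral>x. norm ((norm (f n x - F x))\<^sup>2) \<partial>lebesgue_on \<Omega>) \<longlonglongrightarrow> 0"
      by (simp add: L2_norm_sq)
  qed
  then obtain r :: "nat \<Rightarrow> nat" where r: "strict_mono r"
    "AE x in lebesgue_on \<Omega>. (\<lambda>n. (norm (f (r n) x - F x))\<^sup>2) \<longlonglongrightarrow> 0" by blast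
  from r(2) have "AE x in lebesgue_on \<Omega>. (\<lambda>n. f (r n) x) \<longlonglongrightarrow> F x"
  proof eventually_elim
    case (elim x)
    then have "(\<lambda>n. sqrt ((norm (f (r n) x - F x))\<^sup>2)) \<longlonglongrightarrow> sqrt 0"
      by (rule tendsto_real_sqrt)
    then show ?case
      by (simp add: tendsto_norm_zero_iff LIM_zero_iff)
  qed
  with r(1) show ?thesis using that by blast
qed

text \<open>A subsequence converges almost everywhere, so pointwise lower bounds survive L2 limits.
  This carries the obstacle constraint to the limit of a minimising sequence and makes the sum of a
  nonnegative series a majorant of its terms.\<close>

lemma L2_limit_ge:
  fixes f :: "nat \<Rightarrow> 'a::euclidean_space \<Rightarrow> real"
  assumes "\<And>n. f n \<in> L2 \<Omega>" "F \<in> L2 \<Omega>" "(\<lambda>n. L2_norm \<Omega> (\<lambda>x. f n x - F x)) \<longlonglongrightarrow> 0"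
    and "\<And>n. n \<ge> N \<Longrightarrow> AE x in lebesgue_on \<Omega>. P x \<longrightarrow> h x \<le> f n x"
  shows "AE x in lebesgue_on \<Omega>. P x \<longrightarrow> h x \<le> F x"
proof -
  obtain r :: "nat \<Rightarrow> nat" where r: "strict_mono r" "AE x in lebesgue_on \<Omega>. (\<lambda>n. f (r n) x) \<longlonglongrightarrow> F x"
    using L2_AE_subseq[OF assms(1-3)] by blast
  have "AE x in lebesgue_on \<Omega>. \<forall>n\<ge>N. P x \<longrightarrow> h x \<le> f n x"
    using assms(4) by (subst AE_all_countable) (auto simp: AE_impI)
  with r(2) show ?thesis
  proof eventually_elim
    case (elim x)
    show ?case
    proof
      assume "P x"
      have "h x \<le> f (r n) x" if "n \<ge> N" for n
        using elim(2) \<open>P x\<close> seq_suble[OF r(1), of n] that by auto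
      then show "h x \<le> F x"
        using elim(1) by (intro LIMSEQ_le_const) auto
    qed
  qed
qed

text \<open>Completeness is stated for geometric increments, with an explicit rate, since the later
  constructions choose their sequences with such increments.\<close>

lemma L2_complete:
  fixes f :: "nat \<Rightarrow> 'a::euclidean_space \<Rightarrow> 'b::euclidean_space"
  assumes f: "\<And>n. f n \<in> L2 \<Omega>"
    and le: "\<And>n. L2_norm \<Omega> (\<lambda>x. f (Suc n) x - f n x) \<le> (1/2)^n"
  obtains F where "F \<in> L2 \<Omega>" "\<And>n. L2_norm \<Omega> (\<lambda>x. f n x - F x) \<le> 2 * (1/2)^n"
proof -
  let ?M = "lebesgue_on \<Omega>"
  have [measurable]: "f n \<in> borel_measurable ?M" for n
    using f L2_measurable by auto
  define d where "d n x = norm (f (Suc n) x - f n x)" for n x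
  have [measurable]: "d n \<in> borel_measurable ?M" for n
    unfolding d_def by measurable
  have sq: "(\<integral>\<^sup>+x. ennreal ((norm (g x))\<^sup>2) \<partial>?M) = ennreal ((L2_norm \<Omega> g)\<^sup>2)" if "g \<in> L2 \<Omega>" for g :: "'a \<Rightarrow> 'b"
    unfolding L2_norm_sq using L2_integrable_sq[OF that] by (simp add: nn_integral_eq_integral)
  \<comment> \<open>The weight \<open>2^n\<close> gives away half of the decay: the squared
    increments integrate to at most \<open>(1/4)^n\<close>, so the weighted sum still has a finite
    integral and is finite almost everywhere.\<close>
  have "(\<integral>\<^sup>+x. (\<Sum>n. ennreal (2^n * (d n x)\<^sup>2)) \<partial>?M) = (\<Sum>n. \<integral>\<^sup>+x. ennreal (2^n * (d n x)\<^sup>2) \<partial>?M)"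
    by (intro nn_integral_suminf) measurable
  also have "\<dots> \<le> (\<Sum>n. ennreal ((1/2)^n))"
  proof (rule suminf_le)
    fix n
    have "(\<integral>\<^sup>+x. ennreal (2^n * (d n x)\<^sup>2) \<partial>?M) = ennreal (2^n) * (\<integral>\<^sup>+x. ennreal ((d n x)\<^sup>2) \<partial>?M)"
      by (subst nn_integral_cmult[symmetric]) (auto simp: ennreal_mult)
    also have "\<dots> = ennreal (2^n * (L2_norm \<Omega> (\<lambda>x. f (Suc n) x - f n x))\<^sup>2)"
      unfolding d_def using sq[OF L2_diff[OF f f]] by (simp add: ennreal_mult)
    also have "\<dots> \<le> ennreal (2^n * ((1/2)^n)\<^sup>2)"
      by (intro ennreal_leI mult_left_mono power_mono le) auto
    also have "2^n * ((1/2)^n)\<^sup>2 = (1/2::real)^n"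
      by (simp add: power2_eq_square power_one_over)
    finally show "(\<integral>\<^sup>+x. ennreal (2^n * (d n x)\<^sup>2) \<partial>?M) \<le> ennreal ((1/2)^n)" .
  qed auto
  also have "\<dots> < \<infinity>"
    by (subst suminf_ennreal2) (auto intro!: summable_geometric)
  finally have "(\<integral>\<^sup>+x. (\<Sum>n. ennreal (2^n * (d n x)\<^sup>2)) \<partial>?M) \<noteq> \<infinity>" by simp
  then have "AE x in ?M. (\<Sum>n. ennreal (2^n * (d n x)\<^sup>2)) \<noteq> \<infinity>"
    by (intro nn_integral_PInf_AE) measurable
  then have conv: "AE x in ?M. convergent (\<lambda>n. f n x)"
  proof eventually_elim
    case (elim x)
    then have s1: "summable (\<lambda>n. 2^n * (d n x)\<^sup>2)"
      by (intro summable_suminf_not_top) auto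
    have "summable (\<lambda>n. 2^n * (d n x)\<^sup>2 + (1/2)^n)"
      by (intro summable_add s1 summable_geometric) simp
    \<comment> \<open>Expanding a square converts summability of the weighted squares into
      summability of the increments themselves.\<close>
    moreover have "d n x \<le> 2^n * (d n x)\<^sup>2 + (1/2)^n" for n
    proof -
      have "0 \<le> (2^n * d n x - 1)\<^sup>2" "d n x \<ge> 0" by (simp_all add: d_def)
      then have "2^n * d n x \<le> 2^n * (2^n * (d n x)\<^sup>2 + (1/2)^n)"
        by (simp add: power2_eq_square algebra_simps power_one_over)
           (smt (verit) mult_nonneg_nonneg zero_le_power)
      then show ?thesis by simp
    qed
    ultimately have "summable (\<lambda>n. d n x)"
      by (intro summable_comparison_test'[where N=0 and f="\<lambda>n. d n x"]) (auto simp: d_def)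
    then have "summable (\<lambda>n. f (Suc n) x - f n x)"
      unfolding d_def by (rule summable_norm_cancel)
    then have "convergent (\<lambda>n. \<Sum>i<n. f (Suc i) x - f i x)"
      by (simp add: summable_iff_convergent)
    then have "convergent (\<lambda>n. f n x - f 0 x)"
      using sum_lessThan_telescope[of "\<lambda>n. f n x"] by simp
    then have "convergent (\<lambda>n. (f n x - f 0 x) + f 0 x)"
      by (rule convergent_add[OF _ convergent_const])
    then show ?case by simp
  qed
  define F where "F x = lim (\<lambda>n. f n x)" for x
  have [measurable]: "F \<in> borel_measurable ?M"
    unfolding F_def by measurable
  have lim: "AE x in ?M. (\<lambda>n. f n x) \<longlonglongrightarrow> F x"
    using conv by eventually_elim (simp add: F_def convergent_LIMSEQ_iff)
  \<comment> \<open>The subtracted power makes the induction on \<open>k\<close> close; the bound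
    \<open>2 * (1/2)^n\<close> alone would not be inductive.\<close>
  have dist: "L2_norm \<Omega> (\<lambda>x. f n x - f (n + k) x) \<le> 2 * (1/2)^n - 2 * (1/2)^(n+k)" for n k
  proof (induction k)
    case (Suc k)
    have "L2_norm \<Omega> (\<lambda>x. f n x - f (n + Suc k) x) \<le>
      L2_norm \<Omega> (\<lambda>x. f n x - f (n + k) x) + L2_norm \<Omega> (\<lambda>x. f (n + k) x - f (n + Suc k) x)"
      by (intro L2_norm_triangle_diff f)
    moreover have "L2_norm \<Omega> (\<lambda>x. f (n + k) x - f (n + Suc k) x) \<le> (1/2)^(n+k)"
      using le[of "n + k"] by (subst L2_norm_commute) simp
    ultimately show ?case using Suc.IH by simp
  qed simp
  \<comment> \<open>Fatou's lemma carries the uniform tail estimate to the pointwise limit; square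
    integrability of \<open>F\<close> comes with it.\<close>
  have fatou: "(\<integral>\<^sup>+x. ennreal ((norm (f n x - F x))\<^sup>2) \<partial>?M) \<le> ennreal ((2 * (1/2)^n)\<^sup>2)" for n
  proof -
    have "(\<integral>\<^sup>+x. ennreal ((norm (f n x - F x))\<^sup>2) \<partial>?M) =
        (\<integral>\<^sup>+x. liminf (\<lambda>m. ennreal ((norm (f n x - f m x))\<^sup>2)) \<partial>?M)"
    proof (rule nn_integral_cong_AE, use lim in eventually_elim)
      case (elim x)
      have "(\<lambda>m. ennreal ((norm (f n x - f m x))\<^sup>2)) \<longlonglongrightarrow> ennreal ((norm (f n x - F x))\<^sup>2)"
        by (intro tendsto_intros elim)
      from lim_imp_Liminf[OF sequentially_bot this] show ?case ..
    qed
    also have "\<dots> \<le> liminf (\<lambda>m. \<integral>\<^sup>+x. ennreal ((norm (f n x - f m x))\<^sup>2) \<partial>?M)"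
      by (intro nn_integral_liminf) measurable
    also have "\<dots> \<le> ennreal ((2 * (1/2)^n)\<^sup>2)"
    proof -
      have "(\<integral>\<^sup>+x. ennreal ((norm (f n x - f m x))\<^sup>2) \<partial>?M) \<le> ennreal ((2 * (1/2)^n)\<^sup>2)" if "m \<ge> n" for m
      proof -
        have "L2_norm \<Omega> (\<lambda>x. f n x - f m x) \<le> 2 * (1/2)^n"
        proof -
          have "L2_norm \<Omega> (\<lambda>x. f n x - f m x) \<le> 2 * (1/2)^n - 2 * (1/2)^m"
            using dist[of n "m - n"] that by simp
          moreover have "0 \<le> (1/2 :: real)^m" by simp
          ultimately show ?thesis by linarith
        qed
        then show ?thesis
          by (subst sq[OF L2_diff[OF f f]]) (intro ennreal_leI power_mono, auto)
      qed
      then have "liminf (\<lambda>m. \<integral>\<^sup>+x. ennreal ((norm (f n x - f m x))\<^sup>2) \<partial>?M) \<le> liminf (\<lambda>m::nat. ennreal ((2 * (1/2)^n)\<^sup>2))"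
        by (intro Liminf_mono) (auto simp: eventually_sequentially)
      then show ?thesis by (simp add: Liminf_const)
    qed
    finally show ?thesis .
  qed
  have fF: "(\<lambda>x. f n x - F x) \<in> L2 \<Omega>" for n
    unfolding L2_def
  proof (safe; (rule integrableI_bounded)?)
    show "(\<integral>\<^sup>+x. ennreal (norm ((norm (f n x - F x))\<^sup>2)) \<partial>?M) < \<infinity>"
      using order_le_less_trans[OF fatou[of n]] by simp
  qed measurable
  have "L2_norm \<Omega> (\<lambda>x. f n x - F x) \<le> 2 * (1/2)^n" for n
  proof (rule power2_le_imp_le)
    show "(L2_norm \<Omega> (\<lambda>x. f n x - F x))\<^sup>2 \<le> (2 * (1/2)^n)\<^sup>2"
      using fatou[of n] unfolding sq[OF fF] by (simp only: ennreal_le_iff zero_le_power2)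
  qed simp
  moreover have "F \<in> L2 \<Omega>"
    using L2_diff[OF f fF, of 0 0] by simp
  ultimately show ?thesis using that by blast
qed

subsection \<open>Test functions\<close>

lemma frechet_derivative_eq:
  assumes "(f has_derivative D) (at x)"
  shows "frechet_derivative f (at x) h = D h"
  using frechet_derivative_at[OF assms] by simp

lemma C_k_SucI:
  assumes "\<And>x. (\<phi> has_derivative D x) (at x)" "\<And>i. i \<in> Basis \<Longrightarrow> C_k k (\<lambda>x. D x i)"
  shows "C_k (Suc k) \<phi>"
proof -
  have "\<phi> differentiable_on UNIV"
    using assms(1) by (auto simp: differentiable_on_def differentiable_def)
  moreover have "frechet_derivative \<phi> (at x) = D x" for x
    using frechet_derivative_at[OF assms(1)] by simp
  ultimately show ?thesis using assms(2) by simp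
qed

lemma C_k_Suc_has_derivative:
  assumes "C_k (Suc k) \<phi>"
  shows "(\<phi> has_derivative frechet_derivative \<phi> (at x)) (at x)"
  using assms by (simp add: differentiable_on_def frechet_derivative_works[symmetric])

lemma C_k_Suc_imp: "C_k (Suc k) \<phi> \<Longrightarrow> C_k k \<phi>"
proof (induction k arbitrary: \<phi>)
  case 0
  then show ?case by (simp add: differentiable_imp_continuous_on)
next
  case (Suc k)
  then show ?case by (metis C_k.simps(2))
qed

lemma C_k_continuous: "C_k k \<phi> \<Longrightarrow> continuous_on UNIV \<phi>"
  by (induction k) (auto dest: differentiable_imp_continuous_on)

lemma C_k_const [simp]: "C_k k (\<lambda>x. c)"
  by (induction k arbitrary: c) (simp_all add: frechet_derivative_const)

lemma C_k_add: "C_k k \<phi> \<Longrightarrow> C_k k \<theta> \<Longrightarrow> C_k k (\<lambda>x. \<phi> x + \<theta> x)"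
proof (induction k arbitrary: \<phi> \<theta>)
  case 0
  then show ?case by (simp add: continuous_on_add)
next
  case (Suc k)
  show ?case
  proof (rule C_k_SucI)
    show "((\<lambda>x. \<phi> x + \<theta> x) has_derivative
        (\<lambda>h. frechet_derivative \<phi> (at x) h + frechet_derivative \<theta> (at x) h)) (at x)" for x
      using Suc.prems by (intro has_derivative_add C_k_Suc_has_derivative)
  qed (use Suc in auto)
qed

lemma C_k_mult: "C_k k \<phi> \<Longrightarrow> C_k k \<theta> \<Longrightarrow> C_k k (\<lambda>x. \<phi> x * \<theta> x)"
proof (induction k arbitrary: \<phi> \<theta>)
  case 0
  then show ?case by (simp add: continuous_on_mult)
next
  case (Suc k)
  note C = Suc.prems[THEN C_k_Suc_imp]
  show ?case
  proof (rule C_k_SucI)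
    show "((\<lambda>x. \<phi> x * \<theta> x) has_derivative
        (\<lambda>h. \<phi> x * frechet_derivative \<theta> (at x) h + frechet_derivative \<phi> (at x) h * \<theta> x)) (at x)" for x
      using Suc.prems by (intro has_derivative_mult C_k_Suc_has_derivative)
  qed (use Suc C in \<open>auto intro!: C_k_add Suc.IH\<close>)
qed

lemma C_k_prod: "finite I \<Longrightarrow> (\<And>i. i \<in> I \<Longrightarrow> C_k k (\<phi> i)) \<Longrightarrow> C_k k (\<lambda>x. \<Prod>i\<in>I. \<phi> i x)"
  by (induction I rule: finite_induct) (auto intro: C_k_mult)

text \<open>The chain rule gives a partial derivative as \<open>j'\<close> composed with \<phi>,
  times a partial derivative of \<phi>. The induction generalises \<open>j\<close>, so it covers the
  first factor, and products stay in the class.\<close>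

lemma C_k_compose:
  fixes j :: "real \<Rightarrow> real"
  shows "C_k k j \<Longrightarrow> C_k k \<phi> \<Longrightarrow> C_k k (\<lambda>x. j (\<phi> x))"
proof (induction k arbitrary: j \<phi>)
  case 0
  then show ?case using continuous_on_compose2[of UNIV j UNIV \<phi>] by simp
next
  case (Suc k)
  show ?case
  proof (rule C_k_SucI)
    fix x
    have "((\<lambda>x. j (\<phi> x)) has_derivative
        (\<lambda>h. frechet_derivative j (at (\<phi> x)) (frechet_derivative \<phi> (at x) h))) (at x)"
      by (rule has_derivative_compose[OF C_k_Suc_has_derivative[OF Suc.prems(2)]
            C_k_Suc_has_derivative[OF Suc.prems(1)]])
    moreover have "(\<lambda>h. frechet_derivative j (at (\<phi> x)) (frechet_derivative \<phi> (at x) h)) =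
        (\<lambda>h. frechet_derivative j (at (\<phi> x)) 1 * frechet_derivative \<phi> (at x) h)"
    proof
      fix h
      let ?s = "frechet_derivative \<phi> (at x) h"
      show "frechet_derivative j (at (\<phi> x)) ?s = frechet_derivative j (at (\<phi> x)) 1 * ?s"
        using linear_cmul[OF has_derivative_linear[OF C_k_Suc_has_derivative[OF Suc.prems(1)]], of "\<phi> x" ?s 1]
        by simp
    qed
    ultimately show "((\<lambda>x. j (\<phi> x)) has_derivative
        (\<lambda>h. frechet_derivative j (at (\<phi> x)) 1 * frechet_derivative \<phi> (at x) h)) (at x)"
      by simp
  next
    fix i :: 'a assume "i \<in> Basis"
    then show "C_k k (\<lambda>x. frechet_derivative j (at (\<phi> x)) 1 * frechet_derivative \<phi> (at x) i)"
      using Suc.prems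
      by (intro C_k_mult Suc.IH[of "\<lambda>t. frechet_derivative j (at t) 1"] C_k_Suc_imp[OF Suc.prems(2)]) auto
  qed
qed

lemma C_k_Suc_realI:
  fixes j :: "real \<Rightarrow> real"
  assumes "\<And>t. (j has_real_derivative j' t) (at t)" "C_k k j'"
  shows "C_k (Suc k) j"
  by (rule C_k_SucI[where D = "\<lambda>t h. j' t * h"]) (use assms in \<open>auto simp: has_field_derivative_def\<close>)

lemma C_k_deriv:
  fixes j :: "real \<Rightarrow> real"
  assumes "\<And>t. (j has_real_derivative j' t) (at t)" "C_k (Suc k) j"
  shows "C_k k j'"
proof -
  have "(\<lambda>t. frechet_derivative j (at t) 1) = j'"
    using frechet_derivative_eq[OF assms(1)[unfolded has_field_derivative_def]] by auto
  then show ?thesis using assms(2) by simp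
qed

lemma C_k_inner: "C_k k (\<lambda>x. x \<bullet> a)"
proof (cases k)
  case (Suc n)
  show ?thesis unfolding Suc
    by (rule C_k_SucI[where D = "\<lambda>x h. h \<bullet> a"]) (auto intro!: derivative_eq_intros)
qed (auto intro!: continuous_intros)

lemma C_k_ident_real: "C_k k (\<lambda>x::real. x)"
  using C_k_inner[of k "1::real"] by simp

text \<open>The derivative is \<open>- t\<close> times the cube of the function itself, so each
  order of smoothness gives the next. The function is a factor of the smoothed absolute
  value.\<close>

lemma C_k_inverse_sqrt: "C_k k (\<lambda>t::real. 1 / sqrt (1 + t\<^sup>2))"
proof (induction k)
  case 0
  have "1 + t\<^sup>2 > 0" for t :: real by (simp add: add_pos_nonneg)
  then show ?case by (auto intro!: continuous_intros simp: less_le)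
next
  case (Suc k)
  show ?case
  proof (rule C_k_Suc_realI)
    fix t :: real
    have p: "1 + t\<^sup>2 > 0" by (simp add: add_pos_nonneg)
    have "((\<lambda>t. 1 / sqrt (1 + t\<^sup>2)) has_real_derivative
        - (inverse (sqrt (1 + t\<^sup>2)) / 2 * (2 * t)) / (sqrt (1 + t\<^sup>2) * sqrt (1 + t\<^sup>2))) (at t)"
      using p by (auto intro!: derivative_eq_intros)
    also have "- (inverse (sqrt (1 + t\<^sup>2)) / 2 * (2 * t)) / (sqrt (1 + t\<^sup>2) * sqrt (1 + t\<^sup>2)) =
      (- t) * ((1 / sqrt (1 + t\<^sup>2)) * ((1 / sqrt (1 + t\<^sup>2)) * (1 / sqrt (1 + t\<^sup>2))))"
      by (simp add: field_simps)
    finally show "((\<lambda>t. 1 / sqrt (1 + t\<^sup>2)) has_real_derivative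
      (- t) * ((1 / sqrt (1 + t\<^sup>2)) * ((1 / sqrt (1 + t\<^sup>2)) * (1 / sqrt (1 + t\<^sup>2))))) (at t)" .
    have "C_k k (\<lambda>t::real. (-1) * t)"
      by (intro C_k_mult C_k_const C_k_ident_real)
    then have "C_k k (\<lambda>t::real. - t)" by simp
    then show "C_k k (\<lambda>t::real. (- t) * ((1 / sqrt (1 + t\<^sup>2)) * ((1 / sqrt (1 + t\<^sup>2)) * (1 / sqrt (1 + t\<^sup>2)))))"
      by (intro C_k_mult[of k "\<lambda>t::real. - t"] C_k_mult[OF Suc] Suc)
  qed
qed

lemma C_k_exp: "C_k k (\<lambda>t::real. exp (c * t))"
proof (induction k)
  case 0
  show ?case by (auto intro!: continuous_intros)
next
  case (Suc k)
  show ?case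
    by (rule C_k_Suc_realI[where j' = "\<lambda>t. c * exp (c * t)"])
       (auto intro!: derivative_eq_intros C_k_mult Suc)
qed

text \<open>The powers of \<open>1/t\<close> make the family closed under differentiation, up to
  linear combinations, so that one induction yields smoothness. The member \<open>m = 0\<close> is
  the standard smooth function that vanishes exactly on the nonpositive half-line.\<close>

definition flat_exp :: "nat \<Rightarrow> real \<Rightarrow> real" where
  "flat_exp m t = (if t > 0 then (1/t)^m * exp (- (1/t)) else 0)"

lemma flat_exp_tendsto: "(flat_exp m \<longlongrightarrow> 0) (at 0)"
proof -
  have "((\<lambda>t::real. inverse t ^ m / exp (inverse t)) \<longlongrightarrow> 0) (at_right 0)"
    by (rule filterlim_compose[OF tendsto_power_div_exp_0 filterlim_inverse_at_top_right])
  moreover have "eventually (\<lambda>t. inverse t ^ m / exp (inverse t) = flat_exp m t) (at_right 0)"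
    by (auto simp: eventually_at_filter flat_exp_def exp_minus field_simps)
  ultimately have "(flat_exp m \<longlongrightarrow> 0) (at_right 0)"
    by (rule Lim_transform_eventually)
  moreover have "(flat_exp m \<longlongrightarrow> 0) (at_left 0)"
    by (rule Lim_transform_eventually[OF tendsto_const])
       (auto simp: eventually_at_filter flat_exp_def)
  ultimately show ?thesis by (simp add: filterlim_split_at)
qed

lemma flat_exp_deriv:
  "(flat_exp m has_real_derivative flat_exp (m + 2) t - m * flat_exp (m + 1) t) (at t)"
proof -
  consider "t > 0" | "t < 0" | "t = 0" by linarith
  then show ?thesis
  proof cases
    case 1
    have "((\<lambda>t. (1/t)^m * exp (- (1/t))) has_real_derivative flat_exp (m + 2) t - m * flat_exp (m + 1) t) (at t)"
    proof (cases m)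
      case 0
      show ?thesis unfolding 0 using 1
        by (auto intro!: derivative_eq_intros simp: flat_exp_def power2_eq_square)
    next
      case (Suc n)
      show ?thesis unfolding Suc using 1
        by (auto intro!: derivative_eq_intros simp: flat_exp_def power2_eq_square field_simps; cases n; simp)
    qed
    moreover have "open {0::real<..}" "t \<in> {0::real<..}" using 1 by auto
    ultimately show ?thesis
      by (rule has_field_derivative_transform_within_open) (auto simp: flat_exp_def)
  next
    case 2
    have "((\<lambda>t::real. 0) has_real_derivative 0) (at t)" by simp
    moreover have "open {..<0::real}" "t \<in> {..<0::real}" using 2 by auto
    ultimately have "(flat_exp m has_real_derivative 0) (at t)"
      by (rule has_field_derivative_transform_within_open) (auto simp: flat_exp_def)
    then show ?thesis using 2 by (simp add: flat_exp_def)
  next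
    case 3
    \<comment> \<open>At the origin the difference quotient of index \<open>m\<close> is the
      function of index \<open>Suc m\<close>, whose limit is known.\<close>
    have "((\<lambda>h. (flat_exp m (0 + h) - flat_exp m 0) / h) \<longlongrightarrow> 0) (at 0)"
      by (rule Lim_transform_eventually[OF flat_exp_tendsto[of "Suc m"]])
         (auto simp: flat_exp_def eventually_at_filter)
    then show ?thesis unfolding 3 DERIV_def by (simp add: flat_exp_def)
  qed
qed

lemma C_k_flat_exp: "C_k k (flat_exp m)"
proof (induction k arbitrary: m)
  case 0
  show ?case
    using DERIV_continuous_on[OF has_field_derivative_at_within[OF flat_exp_deriv]] by simp
next
  case (Suc k)
  have "C_k k (\<lambda>t. flat_exp (m + 2) t + (- real m) * flat_exp (m + 1) t)"
    by (intro C_k_add C_k_mult C_k_const Suc)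
  then show ?case
    using C_k_Suc_realI[OF flat_exp_deriv] by simp
qed

lemma flat_exp_0_le: "0 \<le> flat_exp 0 t"
  and flat_exp_0_pos_iff: "flat_exp 0 t > 0 \<longleftrightarrow> t > 0"
  by (auto simp: flat_exp_def)

section \<open>Algebra of test functions\<close>

lemma test_functionsI:
  assumes "\<And>k. C_k k \<phi>" "compact K" "K \<subseteq> \<Omega>" "\<And>x. \<phi> x \<noteq> 0 \<Longrightarrow> x \<in> K"
  shows "\<phi> \<in> test_functions \<Omega>"
proof -
  have "closure {x. \<phi> x \<noteq> 0} \<subseteq> K"
    using assms by (intro closure_minimal) (auto simp: compact_imp_closed)
  then show ?thesis
    using assms by (auto simp: test_functions_def intro: compact_closure[THEN iffD2] bounded_subset
        compact_imp_bounded closure_subset)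
qed

lemma test_functionsE:
  assumes "\<phi> \<in> test_functions \<Omega>"
  obtains K where "compact K" "K \<subseteq> \<Omega>" "\<And>x. x \<notin> K \<Longrightarrow> \<phi> x = 0"
  using assms closure_subset[of "{x. \<phi> x \<noteq> 0}"] unfolding test_functions_def by blast

lemma test_C_k: "\<phi> \<in> test_functions \<Omega> \<Longrightarrow> C_k k \<phi>"
  by (simp add: test_functions_def)

lemma test_has_derivative:
  "\<phi> \<in> test_functions \<Omega> \<Longrightarrow> (\<phi> has_derivative frechet_derivative \<phi> (at x)) (at x)"
  using C_k_Suc_has_derivative test_C_k by blast

lemma test_continuous: "\<phi> \<in> test_functions \<Omega> \<Longrightarrow> continuous_on S \<phi>"
  using C_k_continuous[OF test_C_k[of _ _ 0]] continuous_on_subset by blast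

lemma test_zero [simp]: "(\<lambda>x. 0) \<in> test_functions \<Omega>"
  by (rule test_functionsI[of _ "{}"]) auto

lemma test_add:
  assumes "\<phi> \<in> test_functions \<Omega>" "\<theta> \<in> test_functions \<Omega>"
  shows "(\<lambda>x. \<phi> x + \<theta> x) \<in> test_functions \<Omega>"
proof -
  from assms(1) obtain K where K: "compact K" "K \<subseteq> \<Omega>" "\<And>x. x \<notin> K \<Longrightarrow> \<phi> x = 0"
    by (rule test_functionsE) blast
  from assms(2) obtain L where L: "compact L" "L \<subseteq> \<Omega>" "\<And>x. x \<notin> L \<Longrightarrow> \<theta> x = 0"
    by (rule test_functionsE) blast
  show ?thesis
    by (rule test_functionsI[of _ "K \<union> L"])
       (use K L assms in \<open>auto intro: C_k_add test_C_k\<close>, force)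
qed

lemma test_mult_smooth:
  assumes "\<phi> \<in> test_functions \<Omega>" "\<And>k. C_k k \<theta>"
  shows "(\<lambda>x. \<theta> x * \<phi> x) \<in> test_functions \<Omega>"
proof -
  from assms(1) obtain K where K: "compact K" "K \<subseteq> \<Omega>" "\<And>x. x \<notin> K \<Longrightarrow> \<phi> x = 0"
    by (rule test_functionsE) blast
  show ?thesis
    by (rule test_functionsI[of _ K]) (use K assms in \<open>auto intro: C_k_mult test_C_k\<close>)
qed

lemma test_cmult: "\<phi> \<in> test_functions \<Omega> \<Longrightarrow> (\<lambda>x. c * \<phi> x) \<in> test_functions \<Omega>"
  by (rule test_mult_smooth) auto

lemma test_diff:
  "\<phi> \<in> test_functions \<Omega> \<Longrightarrow> \<theta> \<in> test_functions \<Omega> \<Longrightarrow> (\<lambda>x. \<phi> x - \<theta> x) \<in> test_functions \<Omega>"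
  using test_add[OF _ test_cmult[of _ _ "-1"]] by fastforce

lemma test_sum:
  "finite I \<Longrightarrow> (\<And>i. i \<in> I \<Longrightarrow> \<phi> i \<in> test_functions \<Omega>) \<Longrightarrow> (\<lambda>x. \<Sum>i\<in>I. \<phi> i x) \<in> test_functions \<Omega>"
  by (induction I rule: finite_induct) (auto intro: test_add)

lemma test_compose:
  fixes j :: "real \<Rightarrow> real"
  assumes "\<phi> \<in> test_functions \<Omega>" "\<And>k. C_k k j" "j 0 = 0"
  shows "(\<lambda>x. j (\<phi> x)) \<in> test_functions \<Omega>"
proof -
  from assms(1) obtain K where K: "compact K" "K \<subseteq> \<Omega>" "\<And>x. x \<notin> K \<Longrightarrow> \<phi> x = 0"
    by (rule test_functionsE) blast
  show ?thesis
  proof (rule test_functionsI[OF _ K(1,2)])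
    show "C_k k (\<lambda>x. j (\<phi> x))" for k
      by (rule C_k_compose[OF assms(2) test_C_k[OF assms(1)]])
    show "x \<in> K" if "j (\<phi> x) \<noteq> 0" for x
      using that K(3)[of x] assms(3) by (cases "x \<in> K") auto
  qed
qed

lemma test_partial:
  assumes "\<phi> \<in> test_functions \<Omega>" "i \<in> Basis"
  shows "(\<lambda>x. frechet_derivative \<phi> (at x) i) \<in> test_functions \<Omega>"
proof -
  from assms(1) obtain K where K: "compact K" "K \<subseteq> \<Omega>" "\<And>x. x \<notin> K \<Longrightarrow> \<phi> x = 0"
    by (rule test_functionsE) blast
  show ?thesis
  proof (rule test_functionsI[OF _ K(1,2)])
    show "C_k k (\<lambda>x. frechet_derivative \<phi> (at x) i)" for k
      using test_C_k[OF assms(1), of "Suc k"] assms(2) by simp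
    fix x assume nz: "frechet_derivative \<phi> (at x) i \<noteq> 0"
    show "x \<in> K"
    proof (rule ccontr)
      assume "x \<notin> K"
      have "(\<phi> has_derivative (\<lambda>h. 0)) (at x)"
        by (rule has_derivative_transform_within_open[OF has_derivative_const[of 0], of "- K"])
           (use K \<open>x \<notin> K\<close> in \<open>auto simp: compact_imp_closed\<close>)
      then show False using frechet_derivative_eq nz by fastforce
    qed
  qed
qed

section \<open>Classical gradients of test functions\<close>

definition grad :: "('a::euclidean_space \<Rightarrow> real) \<Rightarrow> 'a \<Rightarrow> 'a" where
  "grad \<phi> x = (\<Sum>i\<in>Basis. frechet_derivative \<phi> (at x) i *\<^sub>R i)"

lemma grad_inner_Basis: "i \<in> Basis \<Longrightarrow> grad \<phi> x \<bullet> i = frechet_derivative \<phi> (at x) i"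
  by (simp add: grad_def inner_sum_left_Basis)

lemma gradI:
  assumes "(\<phi> has_derivative (\<lambda>h. g \<bullet> h)) (at x)"
  shows "grad \<phi> x = g"
  by (rule euclidean_eqI) (simp add: grad_inner_Basis frechet_derivative_eq[OF assms])

lemma test_has_derivative_grad:
  assumes "\<phi> \<in> test_functions \<Omega>"
  shows "(\<phi> has_derivative (\<lambda>h. grad \<phi> x \<bullet> h)) (at x)"
proof -
  note D = test_has_derivative[OF assms, of x]
  have "frechet_derivative \<phi> (at x) h = grad \<phi> x \<bullet> h" for h
  proof -
    have "frechet_derivative \<phi> (at x) (\<Sum>i\<in>Basis. (h \<bullet> i) *\<^sub>R i) = (\<Sum>i\<in>Basis. (h \<bullet> i) * frechet_derivative \<phi> (at x) i)"
      using has_derivative_linear[OF D] by (simp add: linear_sum linear_cmul)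
    also have "\<dots> = (\<Sum>i\<in>Basis. (h \<bullet> i) * (grad \<phi> x \<bullet> i))"
      by (intro sum.cong refl) (simp add: grad_inner_Basis)
    also have "\<dots> = grad \<phi> x \<bullet> h"
      by (subst euclidean_inner) (simp add: mult.commute)
    finally show ?thesis by (simp add: euclidean_representation)
  qed
  then have "frechet_derivative \<phi> (at x) = (\<lambda>h. grad \<phi> x \<bullet> h)" by blast
  with D show ?thesis by simp
qed

lemma grad_add:
  assumes "\<phi> \<in> test_functions \<Omega>" "\<theta> \<in> test_functions \<Omega>"
  shows "grad (\<lambda>x. \<phi> x + \<theta> x) x = grad \<phi> x + grad \<theta> x"
  by (rule gradI) (use assms in \<open>auto intro!: derivative_eq_intros test_has_derivative_grad simp: inner_add_left\<close>)

lemma grad_cmult: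
  assumes "\<phi> \<in> test_functions \<Omega>"
  shows "grad (\<lambda>x. c * \<phi> x) x = c *\<^sub>R grad \<phi> x"
  by (rule gradI) (use assms in \<open>auto intro!: derivative_eq_intros test_has_derivative_grad\<close>)

lemma grad_mult:
  assumes "\<phi> \<in> test_functions \<Omega>" "\<theta> \<in> test_functions \<Omega>"
  shows "grad (\<lambda>x. \<phi> x * \<theta> x) x = \<phi> x *\<^sub>R grad \<theta> x + \<theta> x *\<^sub>R grad \<phi> x"
  by (rule gradI) (use assms in \<open>auto intro!: derivative_eq_intros test_has_derivative_grad simp: inner_add_left\<close>)

lemma grad_compose:
  assumes "\<phi> \<in> test_functions \<Omega>" "(j has_real_derivative d) (at (\<phi> x))"
  shows "grad (\<lambda>x. j (\<phi> x)) x = d *\<^sub>R grad \<phi> x"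
proof (rule gradI)
  have "((\<lambda>x. j (\<phi> x)) has_derivative (\<lambda>h. d * (grad \<phi> x \<bullet> h))) (at x)"
    using has_derivative_compose[OF test_has_derivative_grad[OF assms(1)] assms(2)[unfolded has_field_derivative_def]] .
  then show "((\<lambda>x. j (\<phi> x)) has_derivative (\<lambda>h. (d *\<^sub>R grad \<phi> x) \<bullet> h)) (at x)" by simp
qed

text \<open>Each factor is positive exactly strictly between two opposite faces. Positivity exactly
  on the open box allows coverings by boxes to be read as coverings by positivity sets of
  bumps.\<close>

lemma test_box_bump:
  assumes "cbox a b \<subseteq> \<Omega>"
  obtains \<beta> where "\<beta> \<in> test_functions \<Omega>" "\<And>x. \<beta> x \<ge> 0" "\<And>x. \<beta> x > 0 \<longleftrightarrow> x \<in> box a b"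
proof
  let ?\<beta> = "\<lambda>x. \<Prod>i\<in>Basis. flat_exp 0 (x \<bullet> i - a \<bullet> i) * flat_exp 0 (b \<bullet> i - x \<bullet> i)"
  show nn: "?\<beta> x \<ge> 0" for x by (intro prod_nonneg) (simp add: flat_exp_0_le)
  have pos: "flat_exp 0 s * flat_exp 0 t > 0 \<longleftrightarrow> s > 0 \<and> t > 0" for s t
    by (simp add: flat_exp_0_le flat_exp_0_pos_iff zero_less_mult_iff order_le_less not_less)
      (metis flat_exp_0_le flat_exp_0_pos_iff linorder_not_less)
  show posx: "?\<beta> x > 0 \<longleftrightarrow> x \<in> box a b" for x
  proof
    assume "x \<in> box a b"
    then show "?\<beta> x > 0" by (intro prod_pos) (auto simp: pos mem_box)
  next
    assume p: "?\<beta> x > 0"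
    have "flat_exp 0 (x \<bullet> i - a \<bullet> i) * flat_exp 0 (b \<bullet> i - x \<bullet> i) > 0" if "i \<in> Basis" for i
    proof -
      have "flat_exp 0 (x \<bullet> i - a \<bullet> i) * flat_exp 0 (b \<bullet> i - x \<bullet> i) \<noteq> 0"
        using p that prod_zero_iff[OF finite_Basis] by (metis (no_types, lifting) less_irrefl)
      moreover have "flat_exp 0 (x \<bullet> i - a \<bullet> i) * flat_exp 0 (b \<bullet> i - x \<bullet> i) \<ge> 0"
        by (simp add: flat_exp_0_le)
      ultimately show ?thesis by linarith
    qed
    then show "x \<in> box a b" unfolding pos by (simp add: mem_box)
  qed
  show "?\<beta> \<in> test_functions \<Omega>"
  proof (rule test_functionsI[OF _ compact_cbox assms])
    fix k
    have "C_k k (\<lambda>x. flat_exp 0 (x \<bullet> i - a \<bullet> i))" for i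
      using C_k_compose[OF C_k_flat_exp C_k_add[OF C_k_inner C_k_const], of k 0 i "- (a \<bullet> i)"] by simp
    moreover have "C_k k (\<lambda>x. flat_exp 0 (b \<bullet> i - x \<bullet> i))" for i
      using C_k_compose[OF C_k_flat_exp C_k_add[OF C_k_inner C_k_const], of k 0 "- i" "b \<bullet> i"] by simp
    ultimately show "C_k k ?\<beta>"
      by (intro C_k_prod C_k_mult) auto
  next
    fix x assume "?\<beta> x \<noteq> 0"
    then have "?\<beta> x > 0" using nn[of x] by linarith
    then show "x \<in> cbox a b" using posx box_subset_cbox by blast
  qed
qed

lemma test_exhaustion:
  fixes V :: "'a::euclidean_space set"
  assumes "open V"
  shows "\<exists>\<beta> :: nat \<Rightarrow> 'a \<Rightarrow> real. (\<forall>n. \<beta> n \<in> test_functions V) \<and> (\<forall>n x. \<beta> n x \<ge> 0) \<and>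
    (\<forall>x. x \<in> V \<longleftrightarrow> (\<exists>n. \<beta> n x > 0))"
proof (cases "V = {}")
  case True
  show ?thesis by (intro exI[of _ "\<lambda>n x. 0"]) (auto simp: True)
next
  case False
  \<comment> \<open>The closed boxes, which carry the supports of the bumps, have to lie in
    \<open>V\<close>; rational corners keep the family countable.\<close>
  define B :: "('a \<times> 'a) set" where
    "B = {(a, b). (\<forall>i\<in>Basis. a \<bullet> i \<in> \<rat> \<and> b \<bullet> i \<in> \<rat>) \<and> cbox a b \<subseteq> V}"
  let ?Q = "{a::'a. \<forall>i\<in>Basis. a \<bullet> i \<in> \<rat>}"
  have "countable ?Q"
  proof -
    let ?r = "\<lambda>f. \<Sum>i\<in>Basis. f i *\<^sub>R (i::'a)"
    have "?Q \<subseteq> ?r ` (Basis \<rightarrow>\<^sub>E \<rat>)"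
    proof
      fix a :: 'a assume a: "a \<in> ?Q"
      have "a = ?r (restrict (\<lambda>i. a \<bullet> i) Basis)"
        by (simp add: euclidean_representation)
      moreover have "restrict (\<lambda>i. a \<bullet> i) Basis \<in> Basis \<rightarrow>\<^sub>E \<rat>" using a by auto
      ultimately show "a \<in> ?r ` (Basis \<rightarrow>\<^sub>E \<rat>)" by (rule image_eqI)
    qed
    moreover have "countable (Basis \<rightarrow>\<^sub>E (\<rat>::real set) :: ('a \<Rightarrow> real) set)"
      by (intro countable_PiE finite_Basis countable_rat)
    ultimately show ?thesis by (meson countable_image countable_subset)
  qed
  then have "countable (?Q \<times> ?Q)" by simp
  then have cB: "countable B" by (rule countable_subset[rotated]) (auto simp: B_def)
  have cover: "\<exists>(a, b)\<in>B. x \<in> box a b" if xV: "x \<in> V" for x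
  proof -
    obtain e where e: "e > 0" "cball x e \<subseteq> V"
      using xV open_contains_cball_eq[OF assms] by auto
    obtain a b where ab: "\<forall>i\<in>Basis. a \<bullet> i \<in> \<rat> \<and> b \<bullet> i \<in> \<rat>" "x \<in> box a b" "box a b \<subseteq> ball x e"
      using rational_boxes[OF e(1)] by metis
    \<comment> \<open>The open box contains \<open>x\<close>, hence is nonempty and has the closed
      box as closure; this stays in the closed ball that was chosen inside \<open>V\<close>.\<close>
    have "cbox a b = closure (box a b)"
      using ab(2) closure_box[of a b] by (metis empty_iff)
    also have "\<dots> \<subseteq> cball x e"
      by (rule closure_minimal[OF order_trans[OF ab(3) ball_subset_cball] closed_cball])
    finally have "cbox a b \<subseteq> V" using e(2) by blast
    then have "(a, b) \<in> B" using ab(1) unfolding B_def by blast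
    then show ?thesis using ab(2) by blast
  qed
  have "B \<noteq> {}" using cover False by fastforce
  have "\<exists>\<beta>::'a \<Rightarrow> real. \<beta> \<in> test_functions V \<and> (\<forall>x. \<beta> x \<ge> 0) \<and>
    (\<forall>x. \<beta> x > 0 \<longleftrightarrow> x \<in> box (fst (from_nat_into B n)) (snd (from_nat_into B n)))" for n
  proof -
    have "from_nat_into B n \<in> B" using \<open>B \<noteq> {}\<close> by (rule from_nat_into)
    then have "cbox (fst (from_nat_into B n)) (snd (from_nat_into B n)) \<subseteq> V" by (auto simp: B_def)
    then show ?thesis by (rule test_box_bump) blast
  qed
  then obtain \<beta> :: "nat \<Rightarrow> 'a \<Rightarrow> real" where
    \<beta>: "\<And>n. \<beta> n \<in> test_functions V \<and> (\<forall>x. \<beta> n x \<ge> 0) \<and>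
    (\<forall>x. \<beta> n x > 0 \<longleftrightarrow> x \<in> box (fst (from_nat_into B n)) (snd (from_nat_into B n)))"
    by metis
  show ?thesis
  proof (intro exI[of _ \<beta>] conjI)
    show "\<forall>n. \<beta> n \<in> test_functions V" "\<forall>n x. \<beta> n x \<ge> 0" using \<beta> by auto
    show "\<forall>x. x \<in> V \<longleftrightarrow> (\<exists>n. \<beta> n x > 0)"
    proof (intro allI iffI)
      fix x
      assume "x \<in> V"
      then obtain ab where "ab \<in> B" "x \<in> box (fst ab) (snd ab)" using cover by fastforce
      moreover obtain n where "ab = from_nat_into B n"
        using \<open>ab \<in> B\<close> cB by (metis from_nat_into_surj)
      ultimately show "\<exists>n. \<beta> n x > 0" using \<beta> by auto
    next
      fix x
      assume "\<exists>n. \<beta> n x > 0"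
      then obtain n where "x \<in> box (fst (from_nat_into B n)) (snd (from_nat_into B n))" using \<beta> by blast
      moreover have "from_nat_into B n \<in> B" using \<open>B \<noteq> {}\<close> by (rule from_nat_into)
      ultimately show "x \<in> V" using box_subset_cbox by (force simp: B_def)
    qed
  qed
qed

lemma test_mono: "\<Omega> \<subseteq> (\<Omega>' :: 'a::euclidean_space set) \<Longrightarrow> \<phi> \<in> test_functions \<Omega> \<Longrightarrow> \<phi> \<in> test_functions \<Omega>'"
  by (auto simp: test_functions_def)

text \<open>By compactness finitely many bumps have a positive sum on all of \<open>K\<close>;
  division by a positive lower bound of this sum on \<open>K\<close> raises it to at least
  1.\<close>

lemma test_cutoff:
  fixes \<Omega> :: "'a::euclidean_space set"
  assumes "open \<Omega>" "compact K" "K \<subseteq> \<Omega>"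
  obtains \<kappa> where "\<kappa> \<in> test_functions \<Omega>" "\<And>x. \<kappa> x \<ge> 0" "\<And>x. x \<in> K \<Longrightarrow> \<kappa> x \<ge> 1"
proof -
  from test_exhaustion[OF assms(1)] obtain \<beta> :: "nat \<Rightarrow> 'a \<Rightarrow> real" where
    \<beta>': "(\<forall>n. \<beta> n \<in> test_functions \<Omega>) \<and> (\<forall>n x. \<beta> n x \<ge> 0) \<and>
      (\<forall>x. x \<in> \<Omega> \<longleftrightarrow> (\<exists>n. \<beta> n x > 0))" ..
  note \<beta> = \<beta>'[THEN conjunct1, rule_format] \<beta>'[THEN conjunct2, THEN conjunct1, rule_format]
    \<beta>'[THEN conjunct2, THEN conjunct2, rule_format]
  have "K \<subseteq> (\<Union>n\<in>UNIV. {x. \<beta> n x > 0})" using \<beta>(3) assms(3) by blast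
  moreover have "open {x. \<beta> n x > 0}" for n
    by (intro open_Collect_less continuous_on_const test_continuous[OF \<beta>(1)])
  ultimately obtain I where I: "finite I" "K \<subseteq> (\<Union>n\<in>I. {x. \<beta> n x > 0})"
    using compactE_image[OF assms(2), of UNIV "\<lambda>n. {x. \<beta> n x > 0}"] by metis
  let ?s = "\<lambda>x. \<Sum>n\<in>I. \<beta> n x"
  have s: "?s \<in> test_functions \<Omega>" by (intro test_sum I \<beta>)
  have nn: "?s x \<ge> 0" for x by (intro sum_nonneg \<beta>)
  have pos: "?s x > 0" if xK: "x \<in> K" for x
  proof -
    obtain n where "n \<in> I" "\<beta> n x > 0" using I(2) xK by blast
    then show ?thesis using \<beta>(2) by (intro sum_pos2[OF I(1)]) auto
  qed
  have "\<exists>c>0. \<forall>x\<in>K. c \<le> ?s x"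
  proof (cases "K = {}")
    case False
    then obtain x0 where "x0 \<in> K" "\<forall>x\<in>K. ?s x0 \<le> ?s x"
      using continuous_attains_inf[OF assms(2) False test_continuous[OF s]] by blast
    then show ?thesis using pos by blast
  qed (auto intro: exI[of _ 1])
  then obtain c where c: "c > 0" "\<And>x. x \<in> K \<Longrightarrow> c \<le> ?s x" by blast
  show ?thesis
  proof (rule that[of "\<lambda>x. (1/c) * ?s x"])
    show "(\<lambda>x. (1/c) * ?s x) \<in> test_functions \<Omega>" by (rule test_cmult[OF s])
    show "(1/c) * ?s x \<ge> 0" for x using nn c by simp
    show "(1/c) * ?s x \<ge> 1" if "x \<in> K" for x using c(1) c(2)[OF that] by (simp add: field_simps)
  qed
qed

text \<open>The map \<open>1 - exp (- n t)\<close> fixes 0, so composition preserves the compact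
  support, and it sends nonnegative numbers into [0, 1). The partial sums of the bumps eventually
  stay above any single bump, so the factor \<open>n\<close> drives the values to 1 at every point
  of \<open>V\<close>.\<close>

lemma test_approx_indicator:
  fixes V :: "'a::euclidean_space set"
  assumes "open V"
  obtains s :: "nat \<Rightarrow> 'a \<Rightarrow> real" where "\<And>n. s n \<in> test_functions V" "\<And>n x. \<bar>s n x\<bar> \<le> 1"
    "\<And>x. (\<lambda>n. s n x) \<longlonglongrightarrow> indicator V x"
proof -
  from test_exhaustion[OF assms(1)] obtain \<beta> :: "nat \<Rightarrow> 'a \<Rightarrow> real" where
    \<beta>': "(\<forall>n. \<beta> n \<in> test_functions V) \<and> (\<forall>n x. \<beta> n x \<ge> 0) \<and>
      (\<forall>x. x \<in> V \<longleftrightarrow> (\<exists>n. \<beta> n x > 0))" ..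
  note \<beta> = \<beta>'[THEN conjunct1, rule_format] \<beta>'[THEN conjunct2, THEN conjunct1, rule_format]
    \<beta>'[THEN conjunct2, THEN conjunct2, rule_format]
  define S where "S n x = (\<Sum>i<n. \<beta> i x)" for n x
  define s where "s n x = 1 - exp (- real n * S n x)" for n x
  have S: "S n \<in> test_functions V" for n unfolding S_def by (intro test_sum \<beta>) simp
  have nn: "S n x \<ge> 0" for n x unfolding S_def by (intro sum_nonneg \<beta>)
  show ?thesis
  proof (rule that[of s])
    show "s n \<in> test_functions V" for n
    proof -
      have "C_k k (\<lambda>t. 1 + (-1) * exp (- real n * t))" for k
        by (intro C_k_add C_k_mult C_k_const C_k_exp)
      then have "(\<lambda>x. 1 + (-1) * exp (- real n * S n x)) \<in> test_functions V"
        by (intro test_compose[OF S, of "\<lambda>t. 1 + (-1) * exp (- real n * t)"]) auto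
      then show ?thesis by (simp add: s_def[abs_def])
    qed
    show "\<bar>s n x\<bar> \<le> 1" for n x using nn[of n x] by (simp add: s_def)
    show "(\<lambda>n. s n x) \<longlonglongrightarrow> indicator V x" for x
    proof (cases "x \<in> V")
      case False
      then have "\<not> \<beta> n x > 0" for n using \<beta>(3) by blast
      then have "\<beta> n x = 0" for n using \<beta>(2)[of n x] by (simp add: order_le_less)
      then show ?thesis using False by (simp add: s_def S_def)
    next
      case True
      then obtain m where m: "\<beta> m x > 0" using \<beta> by blast
      have "filterlim (\<lambda>n. \<beta> m x * real n) at_top sequentially"
        using m by (intro filterlim_tendsto_pos_mult_at_top[OF tendsto_const _ filterlim_real_sequentially])
      moreover have "eventually (\<lambda>n. \<beta> m x * real n \<le> real n * S n x) sequentially"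
        using eventually_gt_at_top[of m]
      proof eventually_elim
        case (elim n)
        have "\<beta> m x \<le> S n x"
          unfolding S_def using elim \<beta>(2) by (intro member_le_sum) auto
        then show ?case by (simp add: mult.commute mult_left_mono)
      qed
      ultimately have "filterlim (\<lambda>n. real n * S n x) at_top sequentially"
        by (rule filterlim_at_top_mono)
      then have "filterlim (\<lambda>n. - (real n * S n x)) at_bot sequentially"
        by (simp add: filterlim_uminus_at_top)
      then have "(\<lambda>n. exp (- (real n * S n x))) \<longlonglongrightarrow> 0"
        by (rule filterlim_compose[OF exp_at_bot])
      then have "(\<lambda>n. 1 - exp (- (real n * S n x))) \<longlonglongrightarrow> 1 - 0"
        by (intro tendsto_diff tendsto_const)
      then show ?thesis using True by (simp add: s_def)
    qed
  qed
qed

subsection \<open>Weak gradients\<close>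

lemma compact_support_bounded:
  fixes f :: "'a::euclidean_space \<Rightarrow> 'b::real_normed_vector"
  assumes "continuous_on UNIV f" "compact K" "\<And>x. x \<notin> K \<Longrightarrow> f x = 0"
  obtains B where "B \<ge> 0" "\<And>x. norm (f x) \<le> B"
proof -
  have "bounded (f ` K)"
    using assms(1,2) by (meson compact_continuous_image compact_imp_bounded continuous_on_subset top_greatest)
  then obtain B where B: "B > 0" "\<And>x. x \<in> K \<Longrightarrow> norm (f x) \<le> B"
    by (auto simp: bounded_pos)
  then have "norm (f x) \<le> B" for x
    using assms(3)[of x] by (cases "x \<in> K") auto
  with B(1) show ?thesis using that[of B] by simp
qed

lemma compact_support_integrable_lborel:
  fixes f :: "'a::euclidean_space \<Rightarrow> real"
  assumes "continuous_on UNIV f" "compact K" "\<And>x. x \<notin> K \<Longrightarrow> f x = 0"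
  shows "integrable lborel f"
proof -
  have "integrable lborel (\<lambda>x. indicator K x *\<^sub>R f x)"
    using assms by (intro borel_integrable_compact) (auto intro: continuous_on_subset)
  moreover have "(\<lambda>x. indicator K x *\<^sub>R f x) = f"
    by (intro ext) (metis assms(3) indicator_simps(1) indicator_simps(2) scaleR_one scaleR_zero_left)
  ultimately show ?thesis by simp
qed

section \<open>Integration by parts and the fundamental lemma on a bounded open set\<close>

locale bounded_open =
  fixes \<Omega> :: "'a::euclidean_space set"
  assumes open_\<Omega>: "open \<Omega>" and bounded_\<Omega>: "bounded \<Omega>"
begin

lemma \<Omega>_sets: "\<Omega> \<in> sets lebesgue"
  using open_\<Omega> by (simp add: borel_open)

lemma \<Omega>_lmeasurable: "\<Omega> \<in> lmeasurable"
  using open_\<Omega> bounded_\<Omega> by (simp add: lmeasurable_open)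

lemma finite_measure_\<Omega>: "finite_measure (lebesgue_on \<Omega>)"
  using \<Omega>_lmeasurable by (rule finite_measure_lebesgue_on)

lemma borel_measurable_on_\<Omega>:
  "continuous_on UNIV (f :: 'a \<Rightarrow> 'b::euclidean_space) \<Longrightarrow> f \<in> borel_measurable (lebesgue_on \<Omega>)"
  using continuous_imp_measurable_on_sets_lebesgue[OF continuous_on_subset \<Omega>_sets] by blast

lemma L2_bounded:
  fixes f :: "'a \<Rightarrow> 'b::euclidean_space"
  assumes "f \<in> borel_measurable (lebesgue_on \<Omega>)" "\<And>x. x \<in> \<Omega> \<Longrightarrow> norm (f x) \<le> B"
  shows "f \<in> L2 \<Omega>"
proof -
  interpret finite_measure "lebesgue_on \<Omega>" by (rule finite_measure_\<Omega>)
  have "integrable (lebesgue_on \<Omega>) (\<lambda>x. (norm (f x))\<^sup>2)"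
  proof (rule integrable_const_bound[of _ "B\<^sup>2"])
    show "AE x in lebesgue_on \<Omega>. norm ((norm (f x))\<^sup>2) \<le> B\<^sup>2"
      using assms(2) by (intro AE_I2) (auto intro!: power_mono)
  qed (use assms(1) in measurable)
  then show ?thesis using assms(1) by (simp add: L2_def)
qed

lemma L2_const: "(\<lambda>x. c :: 'b::euclidean_space) \<in> L2 \<Omega>"
  by (rule L2_bounded[of _ "norm c"]) auto

lemma L2_integrable:
  fixes f :: "'a \<Rightarrow> real"
  assumes "f \<in> L2 \<Omega>"
  shows "integrable (lebesgue_on \<Omega>) f"
  using L2_mult_integrable[OF assms L2_const[of 1]] by simp

lemma L2_test:
  assumes "\<phi> \<in> test_functions \<Omega>"
  shows "\<phi> \<in> L2 \<Omega>"
proof -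
  obtain K where K: "compact K" "K \<subseteq> \<Omega>" "\<And>x. x \<notin> K \<Longrightarrow> \<phi> x = 0"
    using assms by (rule test_functionsE) blast
  obtain B where "\<And>x. norm (\<phi> x) \<le> B"
    using compact_support_bounded[OF test_continuous[OF assms] K(1,3)] by blast
  then show ?thesis
    using test_continuous[OF assms] by (intro L2_bounded borel_measurable_on_\<Omega>) auto
qed

lemma continuous_grad:
  assumes "\<phi> \<in> test_functions \<Omega>"
  shows "continuous_on S (grad \<phi>)"
  unfolding grad_def using test_continuous[OF test_partial[OF assms]]
  by (intro continuous_on_sum continuous_on_scaleR continuous_on_const) auto

lemma grad_bounded:
  assumes "\<phi> \<in> test_functions \<Omega>"
  obtains B where "B \<ge> 0" "\<And>x. norm (grad \<phi> x) \<le> B"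
proof -
  obtain K where K: "compact K" "K \<subseteq> \<Omega>" "\<And>x. x \<notin> K \<Longrightarrow> \<phi> x = 0"
    using assms by (rule test_functionsE) blast
  have "grad \<phi> x = 0" if "x \<notin> K" for x
  proof (rule gradI)
    show "(\<phi> has_derivative (\<lambda>h. 0 \<bullet> h)) (at x)"
      by (rule has_derivative_transform_within_open[of "\<lambda>x. 0" _ _ _ "- K"])
         (use K that in \<open>auto simp: compact_imp_closed\<close>)
  qed
  then show ?thesis
    using compact_support_bounded[OF continuous_grad[OF assms] K(1)] that by blast
qed

lemma L2_grad:
  assumes "\<phi> \<in> test_functions \<Omega>"
  shows "grad \<phi> \<in> L2 \<Omega>"
proof -
  obtain B where "\<And>x. norm (grad \<phi> x) \<le> B" using grad_bounded[OF assms] by blast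
  then show ?thesis
    by (intro L2_bounded borel_measurable_on_\<Omega> continuous_grad[OF assms]) auto
qed

text \<open>Translation invariance is exploited for \<open>lborel\<close>, while weak gradients are
  defined through \<open>lebesgue_on \<Omega>\<close>; for a support inside \<Omega> the two
  integrals agree.\<close>

lemma integral_test_lborel:
  assumes "\<phi> \<in> test_functions \<Omega>"
  shows "integral\<^sup>L (lebesgue_on \<Omega>) \<phi> = integral\<^sup>L lborel \<phi>"
proof -
  obtain K where K: "compact K" "K \<subseteq> \<Omega>" "\<And>x. x \<notin> K \<Longrightarrow> \<phi> x = 0"
    using assms by (rule test_functionsE) blast
  have "integral\<^sup>L (lebesgue_on \<Omega>) \<phi> = integral\<^sup>L lebesgue (\<lambda>x. indicator \<Omega> x *\<^sub>R \<phi> x)"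
    using \<Omega>_sets by (intro integral_restrict_space) auto
  also have "(\<lambda>x. indicator \<Omega> x *\<^sub>R \<phi> x) = \<phi>"
    using K by (auto simp: indicator_def fun_eq_iff)
  also have "integral\<^sup>L lebesgue \<phi> = integral\<^sup>L lborel \<phi>"
    using borel_measurable_continuous_onI[OF test_continuous[OF assms]]
    by (intro integral_completion) auto
  finally show ?thesis .
qed

text \<open>Differentiate the translation invariance of Lebesgue measure.\<close>

lemma integral_partial_zero:
  assumes "\<phi> \<in> test_functions \<Omega>" "i \<in> Basis"
  shows "(\<integral>x. frechet_derivative \<phi> (at x) i \<partial>lebesgue_on \<Omega>) = 0"
proof -
  obtain K where K: "compact K" "K \<subseteq> \<Omega>" "\<And>x. x \<notin> K \<Longrightarrow> \<phi> x = 0"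
    using assms(1) by (rule test_functionsE) blast
  obtain R where R: "\<And>x. x \<in> K \<Longrightarrow> norm x \<le> R"
    using compact_imp_bounded[OF K(1)] by (auto simp: bounded_iff)
  obtain B where B: "B \<ge> 0" "\<And>x. norm (grad \<phi> x) \<le> B" using grad_bounded[OF assms(1)] by blast
  \<comment> \<open>A global Lipschitz constant bounds all difference quotients at once and so
    supplies the dominating function.\<close>
  have Lip: "norm (\<phi> x - \<phi> y) \<le> B * norm (x - y)" for x y
  proof (rule differentiable_bound[of UNIV \<phi> "\<lambda>x h. grad \<phi> x \<bullet> h"])
    show "onorm (\<lambda>h. grad \<phi> x \<bullet> h) \<le> B" for x
    proof (rule onorm_le)
      fix h
      have "norm (grad \<phi> x \<bullet> h) \<le> norm (grad \<phi> x) * norm h"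
        by (simp add: Cauchy_Schwarz_ineq2)
      also have "\<dots> \<le> B * norm h"
        using B(2) by (intro mult_right_mono) auto
      finally show "norm (grad \<phi> x \<bullet> h) \<le> B * norm h" .
    qed
  qed (use test_has_derivative_grad[OF assms(1)] in auto)
  have int\<phi>: "integrable lborel \<phi>"
    by (rule compact_support_integrable_lborel[OF test_continuous[OF assms(1)] K(1,3)])
  have [measurable]: "\<phi> \<in> borel_measurable borel"
    using borel_measurable_continuous_onI[OF test_continuous[OF assms(1)]] .
  define t where "t n = 1 / real (Suc n)" for n
  have t: "t n > 0" "t n \<le> 1" for n by (auto simp: t_def)
  have t0: "t \<longlonglongrightarrow> 0" unfolding t_def by (rule LIMSEQ_inverse_real_of_nat[unfolded inverse_eq_divide])
  define d where "d n x = (\<phi> (t n *\<^sub>R i + x) - \<phi> x) / t n" for n x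
  have transl: "integral\<^sup>L lborel (\<lambda>x. \<phi> (c + x)) = integral\<^sup>L lborel \<phi>"
    "integrable lborel (\<lambda>x. \<phi> (c + x))" for c
  proof -
    have "integral\<^sup>L (distr lborel borel ((+) c)) \<phi> = integral\<^sup>L lborel (\<lambda>x. \<phi> (c + x))"
      by (intro integral_distr) auto
    then show "integral\<^sup>L lborel (\<lambda>x. \<phi> (c + x)) = integral\<^sup>L lborel \<phi>"
      by (simp add: lborel_distr_plus)
    have "integrable (distr lborel borel ((+) c)) \<phi> \<longleftrightarrow> integrable lborel (\<lambda>x. \<phi> (c + x))"
      by (intro integrable_distr_eq) auto
    then show "integrable lborel (\<lambda>x. \<phi> (c + x))"
      using int\<phi> by (simp add: lborel_distr_plus)
  qed
  have "(\<integral>x. d n x \<partial>lborel) = 0" for n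
    unfolding d_def using transl int\<phi> by simp
  moreover have "(\<lambda>n. \<integral>x. d n x \<partial>lborel) \<longlonglongrightarrow> (\<integral>x. frechet_derivative \<phi> (at x) i \<partial>lborel)"
  proof (rule integral_dominated_convergence)
    show "(\<lambda>x. frechet_derivative \<phi> (at x) i) \<in> borel_measurable lborel"
      using borel_measurable_continuous_onI[OF test_continuous[OF test_partial[OF assms]]] by simp
    show "d n \<in> borel_measurable lborel" for n unfolding d_def by measurable
    \<comment> \<open>The increments have length at most 1, so every difference quotient vanishes
      outside the ball of radius \<open>R + 1\<close>.\<close>
    have "integrable lborel (\<lambda>x::'a. indicator (cball 0 (R + 1)) x *\<^sub>R B)"
      by (intro borel_integrable_compact) auto
    then show "integrable lborel (\<lambda>x::'a. B * indicator (cball 0 (R + 1)) x)"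
      by (simp add: mult.commute)
    show "AE x in lborel. norm (d n x) \<le> B * indicator (cball 0 (R + 1)) x" for n
    proof (intro AE_I2)
      fix x
      show "norm (d n x) \<le> B * indicator (cball 0 (R + 1)) x"
      proof (cases "x \<in> cball 0 (R + 1)")
        case True
        have "norm (\<phi> (t n *\<^sub>R i + x) - \<phi> x) \<le> B * norm (t n *\<^sub>R i + x - x)" by (rule Lip)
        also have "\<dots> = B * t n" using t[of n] assms(2) by simp
        finally have "norm (d n x) \<le> B"
          using t[of n] by (simp add: d_def field_simps)
        then show ?thesis using True by simp
      next
        case False
        have "norm x \<le> norm (t n *\<^sub>R i + x) + norm (t n *\<^sub>R i)"
          by (metis add_diff_cancel_left' norm_triangle_ineq4 norm_minus_commute add.commute)
        then have "norm (t n *\<^sub>R i + x) > R" "norm x > R"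
          using False t[of n] assms(2) by auto
        then have "\<phi> (t n *\<^sub>R i + x) = 0" "\<phi> x = 0"
          using K(3) R by (meson linorder_not_less)+
        then show ?thesis using False by (simp add: d_def)
      qed
    qed
    show "AE x in lborel. (\<lambda>n. d n x) \<longlonglongrightarrow> frechet_derivative \<phi> (at x) i"
    proof (intro AE_I2)
      fix x
      have "((\<lambda>s. \<phi> (s *\<^sub>R i + x)) has_derivative (\<lambda>h. frechet_derivative \<phi> (at x) (h *\<^sub>R i))) (at 0)"
      proof -
        have 1: "((\<lambda>s. s *\<^sub>R i + x) has_derivative (\<lambda>h. h *\<^sub>R i)) (at 0)"
          by (auto intro!: derivative_eq_intros)
        have 2: "(\<phi> has_derivative frechet_derivative \<phi> (at x)) (at (0 *\<^sub>R i + x))"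
          using test_has_derivative[OF assms(1)] by simp
        show ?thesis using has_derivative_compose[OF 1 2] .
      qed
      moreover have "frechet_derivative \<phi> (at x) (h *\<^sub>R i) = frechet_derivative \<phi> (at x) i * h" for h
        using linear_cmul[OF has_derivative_linear[OF test_has_derivative[OF assms(1)]]] by simp
      ultimately have "((\<lambda>s. \<phi> (s *\<^sub>R i + x)) has_real_derivative frechet_derivative \<phi> (at x) i) (at 0)"
        by (simp add: has_field_derivative_def)
      then have "((\<lambda>h. (\<phi> (h *\<^sub>R i + x) - \<phi> x) / h) \<longlongrightarrow> frechet_derivative \<phi> (at x) i) (at 0)"
        by (simp add: DERIV_def)
      moreover have "filterlim t (at 0) sequentially"
        using t0 t by (auto simp: filterlim_at less_imp_neq[symmetric])
      ultimately show "(\<lambda>n. d n x) \<longlonglongrightarrow> frechet_derivative \<phi> (at x) i"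
        unfolding d_def by (rule filterlim_compose)
    qed
  qed
  ultimately have "(\<integral>x. frechet_derivative \<phi> (at x) i \<partial>lborel) = 0"
    by (simp add: LIMSEQ_const_iff)
  then show ?thesis
    by (simp add: integral_test_lborel[OF test_partial[OF assms]])
qed

text \<open>The product of two test functions is a test function, and the integral of its partial
  derivative vanishes; the product rule then gives integration by parts.\<close>

lemma weak_gradient_test:
  assumes "\<phi> \<in> test_functions \<Omega>"
  shows "weak_gradient \<Omega> \<phi> (grad \<phi>)"
  unfolding weak_gradient_def
proof (intro conjI ballI)
  show "grad \<phi> \<in> L2 \<Omega>" by (rule L2_grad[OF assms])
  fix \<theta> i assume \<theta>: "\<theta> \<in> test_functions \<Omega>" and i: "i \<in> (Basis :: 'a set)"
  have prod: "(\<lambda>x. \<phi> x * \<theta> x) \<in> test_functions \<Omega>"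
    using test_mult_smooth[OF \<theta> test_C_k[OF assms]] .
  have "frechet_derivative (\<lambda>x. \<phi> x * \<theta> x) (at x) i =
      \<phi> x * frechet_derivative \<theta> (at x) i + (grad \<phi> x \<bullet> i) * \<theta> x" for x
    using grad_mult[OF assms \<theta>, of x] grad_inner_Basis[OF i, of "\<lambda>x. \<phi> x * \<theta> x" x]
    by (simp add: inner_add_left grad_inner_Basis[OF i] algebra_simps)
  then have "(\<integral>x. \<phi> x * frechet_derivative \<theta> (at x) i + (grad \<phi> x \<bullet> i) * \<theta> x \<partial>lebesgue_on \<Omega>) = 0"
    using integral_partial_zero[OF prod i] by simp
  moreover have "integrable (lebesgue_on \<Omega>) (\<lambda>x. \<phi> x * frechet_derivative \<theta> (at x) i)"
    by (intro L2_mult_integrable L2_test assms test_partial \<theta> i)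
  moreover have "integrable (lebesgue_on \<Omega>) (\<lambda>x. (grad \<phi> x \<bullet> i) * \<theta> x)"
    unfolding grad_inner_Basis[OF i]
    by (intro L2_mult_integrable L2_test assms test_partial \<theta> i)
  ultimately show "(\<integral>x. \<phi> x * frechet_derivative \<theta> (at x) i \<partial>lebesgue_on \<Omega>) =
      - (\<integral>x. (grad \<phi> x \<bullet> i) * \<theta> x \<partial>lebesgue_on \<Omega>)"
    by simp
qed

text \<open>Orthogonality passes from test functions to indicators of open subsets by dominated
  convergence, then to the indicator of the set where \<open>h\<close> is positive by outer
  regularity. Hence the positive part of \<open>h\<close> has integral zero. Equality almost
  everywhere follows by applying this to \<open>- h\<close> as well.\<close>

lemma orthogonal_test_imp_AE_le_0:
  fixes h :: "'a \<Rightarrow> real"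
  assumes h: "h \<in> L2 \<Omega>" and orth: "\<And>\<phi>. \<phi> \<in> test_functions \<Omega> \<Longrightarrow> (\<integral>x. h x * \<phi> x \<partial>lebesgue_on \<Omega>) = 0"
  shows "AE x in lebesgue_on \<Omega>. h x \<le> 0"
proof -
  let ?M = "lebesgue_on \<Omega>"
  have hm [measurable]: "h \<in> borel_measurable ?M" using h L2_measurable by auto
  have hi: "integrable ?M h" by (rule L2_integrable[OF h])
  interpret finite_measure ?M by (rule finite_measure_\<Omega>)
  have ind: "(\<lambda>x. indicator E x) \<in> borel_measurable ?M" if "E \<in> sets lebesgue" "E \<subseteq> \<Omega>" for E
    using that \<Omega>_sets by (intro borel_measurable_indicator) (auto simp: sets_restrict_space_iff)
  have op: "(\<integral>x. h x * indicator V x \<partial>?M) = 0" if V: "open V" "V \<subseteq> \<Omega>" for V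
  proof -
    obtain s :: "nat \<Rightarrow> 'a \<Rightarrow> real" where s: "\<And>n. s n \<in> test_functions V" "\<And>n x. \<bar>s n x\<bar> \<le> 1"
      "\<And>x. (\<lambda>n. s n x) \<longlonglongrightarrow> indicator V x"
      using test_approx_indicator[OF V(1)] by blast
    have s': "s n \<in> test_functions \<Omega>" for n using test_mono[OF V(2) s(1)] .
    have "(\<lambda>n. \<integral>x. h x * s n x \<partial>?M) \<longlonglongrightarrow> (\<integral>x. h x * indicator V x \<partial>?M)"
    proof (rule integral_dominated_convergence[of _ _ _ "\<lambda>x. \<bar>h x\<bar>"])
      show "(\<lambda>x. h x * indicator V x) \<in> borel_measurable ?M"
        using ind[of V] V by (intro borel_measurable_times hm) (auto simp: borel_open)
      show "(\<lambda>x. h x * s n x) \<in> borel_measurable ?M" for n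
        using L2_measurable[OF L2_test[OF s']] by (intro borel_measurable_times hm) auto
      show "integrable ?M (\<lambda>x. \<bar>h x\<bar>)" using hi by simp
      show "AE x in ?M. (\<lambda>n. h x * s n x) \<longlonglongrightarrow> h x * indicator V x"
        using s(3) by (intro AE_I2 tendsto_mult tendsto_const)
      show "AE x in ?M. norm (h x * s n x) \<le> \<bar>h x\<bar>" for n
        using s(2) by (intro AE_I2) (auto simp: abs_mult intro: mult_left_le)
    qed
    then show ?thesis using orth[OF s'] by (simp add: LIMSEQ_const_iff)
  qed
  define A where "A = {x \<in> \<Omega>. h x > 0}"
  have "A \<in> sets ?M"
    unfolding A_def using hm by (metis borel_measurable_iff_greater space_lebesgue_on)
  then have A: "A \<in> sets lebesgue" "A \<subseteq> \<Omega>"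
    using \<Omega>_sets by (auto simp: sets_restrict_space_iff A_def)
  have small: "\<bar>\<integral>x. h x * indicator A x \<partial>?M\<bar> \<le> L2_norm \<Omega> h * e" if e: "e > 0" for e :: real
  proof -
    \<comment> \<open>An excess of measure below \<open>e^2\<close> has an indicator of L2 norm at
      most \<open>e\<close>, the quantity that enters the Cauchy-Schwarz estimate.\<close>
    obtain T where T: "open T" "A \<subseteq> T" "(T - A) \<in> lmeasurable" "emeasure lebesgue (T - A) < ennreal (e\<^sup>2)"
      using sets_lebesgue_outer_open[OF A(1) zero_less_power[OF e, of 2]] by metis
    let ?V = "T \<inter> \<Omega>"
    have V: "open ?V" "?V \<subseteq> \<Omega>" using T open_\<Omega> by auto
    let ?E = "?V - A"
    have E: "?E \<in> sets lebesgue" "?E \<subseteq> \<Omega>" using V A by (auto simp: borel_open)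
    have mE: "measure lebesgue ?E \<le> e\<^sup>2"
    proof -
      have "emeasure lebesgue ?E \<le> emeasure lebesgue (T - A)"
        using T(3) by (intro emeasure_mono) auto
      also have "\<dots> \<le> ennreal (e\<^sup>2)" using T(4) by simp
      finally show ?thesis by (simp add: measure_def enn2real_leI)
    qed
    have nE: "L2_norm \<Omega> (indicator ?E :: 'a \<Rightarrow> real) \<le> e"
    proof (rule power2_le_imp_le)
      have "(L2_norm \<Omega> (indicator ?E :: 'a \<Rightarrow> real))\<^sup>2 = (\<integral>x. indicator ?E x \<partial>?M)"
        unfolding L2_norm_sq by (intro Bochner_Integration.integral_cong) (auto simp: indicator_def)
      also have "\<dots> = measure ?M ?E"
        using E by (simp add: Int_absorb1 Int_commute Int_absorb2)
      also have "\<dots> = measure lebesgue ?E"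
        using E \<Omega>_sets by (simp add: measure_restrict_space)
      finally show "(L2_norm \<Omega> (indicator ?E :: 'a \<Rightarrow> real))\<^sup>2 \<le> e\<^sup>2" using mE by simp
    qed (use that in simp)
    have hL: "integrable ?M (\<lambda>x. h x * indicator F x)" if "F \<in> sets lebesgue" "F \<subseteq> \<Omega>" for F
      using integrable_real_mult_indicator[of F ?M h] that \<Omega>_sets hi
      by (auto simp: sets_restrict_space_iff)
    have "(\<integral>x. h x * indicator ?V x \<partial>?M) = (\<integral>x. h x * indicator A x + h x * indicator ?E x \<partial>?M)"
      using T A by (intro Bochner_Integration.integral_cong) (auto simp: indicator_def)
    also have "\<dots> = (\<integral>x. h x * indicator A x \<partial>?M) + (\<integral>x. h x * indicator ?E x \<partial>?M)"
      using hL A E by (intro Bochner_Integration.integral_add) auto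
    finally have "\<bar>\<integral>x. h x * indicator A x \<partial>?M\<bar> = \<bar>\<integral>x. h x * indicator ?E x \<partial>?M\<bar>"
      using op[OF V] by simp
    also have "\<dots> \<le> L2_norm \<Omega> h * L2_norm \<Omega> (indicator ?E :: 'a \<Rightarrow> real)"
      by (rule L2_Cauchy_Schwarz_real[OF h L2_bounded[of _ 1]]) (use ind[OF E] in \<open>auto simp: indicator_def\<close>)
    also have "\<dots> \<le> L2_norm \<Omega> h * e" using nE by (intro mult_left_mono) auto
    finally show ?thesis .
  qed
  have "\<bar>\<integral>x. h x * indicator A x \<partial>?M\<bar> \<le> 0"
  proof (rule field_le_epsilon)
    fix e :: real assume "e > 0"
    have "\<bar>\<integral>x. h x * indicator A x \<partial>?M\<bar> \<le> L2_norm \<Omega> h * (e / (L2_norm \<Omega> h + 1))"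
      using \<open>e > 0\<close> by (intro small divide_pos_pos) (simp_all add: add_nonneg_pos)
    also have "\<dots> \<le> e"
      using \<open>e > 0\<close> add_nonneg_pos[OF L2_norm_nonneg[of \<Omega> h] zero_less_one]
      by (simp add: pos_divide_le_eq algebra_simps)
    finally show "\<bar>\<integral>x. h x * indicator A x \<partial>?M\<bar> \<le> 0 + e" by simp
  qed
  then have z: "(\<integral>x. h x * indicator A x \<partial>?M) = 0" by simp
  have "AE x in ?M. h x * indicator A x = 0"
  proof (rule integral_nonneg_eq_0_iff_AE[THEN iffD1, OF _ _ z])
    show "integrable ?M (\<lambda>x. h x * indicator A x)"
      using integrable_real_mult_indicator[OF \<open>A \<in> sets ?M\<close> hi] by simp
    show "AE x in ?M. 0 \<le> h x * indicator A x"
      by (intro AE_I2) (auto simp: A_def indicator_def)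
  qed
  moreover have "AE x in ?M. x \<in> \<Omega>" by (intro AE_I2) simp
  ultimately show ?thesis
    by eventually_elim (auto simp: A_def indicator_def split: if_splits)
qed

lemma orthogonal_test_imp_AE_0:
  fixes h :: "'a \<Rightarrow> real"
  assumes h: "h \<in> L2 \<Omega>" and orth: "\<And>\<phi>. \<phi> \<in> test_functions \<Omega> \<Longrightarrow> (\<integral>x. h x * \<phi> x \<partial>lebesgue_on \<Omega>) = 0"
  shows "AE x in lebesgue_on \<Omega>. h x = 0"
proof -
  have "AE x in lebesgue_on \<Omega>. - h x \<le> 0"
    by (rule orthogonal_test_imp_AE_le_0[OF L2_minus[OF h]]) (simp add: orth)
  moreover have "AE x in lebesgue_on \<Omega>. h x \<le> 0"
    using assms by (rule orthogonal_test_imp_AE_le_0)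
  ultimately show ?thesis
    by eventually_elim simp
qed

lemma L2_inner_Basis:
  assumes "(g :: 'a \<Rightarrow> 'a) \<in> L2 \<Omega>" "i \<in> Basis"
  shows "(\<lambda>x. g x \<bullet> i) \<in> L2 \<Omega>"
proof (rule L2_bound(1)[OF _ assms(1), of _ 1])
  show "(\<lambda>x. g x \<bullet> i) \<in> borel_measurable (lebesgue_on \<Omega>)"
    using L2_measurable[OF assms(1)] by measurable
  show "AE x in lebesgue_on \<Omega>. norm (g x \<bullet> i) \<le> 1 * norm (g x)"
    using assms(2) by (intro AE_I2) (auto simp: Basis_le_norm)
qed simp

lemma weak_gradient_unique:
  assumes "weak_gradient \<Omega> v g" "weak_gradient \<Omega> v g'"
  shows "AE x in lebesgue_on \<Omega>. g x = g' x"
proof -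
  have g: "g \<in> L2 \<Omega>" "g' \<in> L2 \<Omega>" using assms by (auto simp: weak_gradient_def)
  have "AE x in lebesgue_on \<Omega>. g x \<bullet> i - g' x \<bullet> i = 0" if i: "i \<in> Basis" for i
  proof (rule orthogonal_test_imp_AE_0)
    show "(\<lambda>x. g x \<bullet> i - g' x \<bullet> i) \<in> L2 \<Omega>"
      using g i by (intro L2_diff L2_inner_Basis)
    fix \<phi> assume \<phi>: "\<phi> \<in> test_functions \<Omega>"
    have "(\<integral>x. (g x \<bullet> i) * \<phi> x \<partial>lebesgue_on \<Omega>) = (\<integral>x. (g' x \<bullet> i) * \<phi> x \<partial>lebesgue_on \<Omega>)"
      using assms \<phi> i unfolding weak_gradient_def by fastforce
    moreover have "integrable (lebesgue_on \<Omega>) (\<lambda>x. (g x \<bullet> i) * \<phi> x)"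
        "integrable (lebesgue_on \<Omega>) (\<lambda>x. (g' x \<bullet> i) * \<phi> x)"
      using g i \<phi> by (intro L2_mult_integrable L2_inner_Basis L2_test; simp)+
    ultimately show "(\<integral>x. (g x \<bullet> i - g' x \<bullet> i) * \<phi> x \<partial>lebesgue_on \<Omega>) = 0"
      by (simp add: left_diff_distrib)
  qed
  then have "AE x in lebesgue_on \<Omega>. \<forall>i\<in>Basis. g x \<bullet> i - g' x \<bullet> i = 0"
    by (intro AE_finite_allI) auto
  then show ?thesis
    by eventually_elim (auto intro: euclidean_eqI)
qed

end

subsection \<open>The space \<open>H1_0\<close>\<close>

text \<open>The closure in L2 x L2 of the pairs (\<phi>, grad \<phi>). The gradient is explicit data
  here, unlike \<open>wgrad\<close>, so calculus rules can be proved by L2 limits alone;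
  \<open>H1_0\<close> is the projection to the first component.\<close>

definition sobolev_graph :: "'a::euclidean_space set \<Rightarrow> ('a \<Rightarrow> real) \<Rightarrow> ('a \<Rightarrow> 'a) \<Rightarrow> bool" where
  "sobolev_graph \<Omega> v g \<longleftrightarrow> v \<in> L2 \<Omega> \<and> g \<in> L2 \<Omega> \<and>
     (\<forall>\<epsilon>>0. \<exists>\<phi>\<in>test_functions \<Omega>. L2_norm \<Omega> (\<lambda>x. \<phi> x - v x) < \<epsilon> \<and> L2_norm \<Omega> (\<lambda>x. grad \<phi> x - g x) < \<epsilon>)"

context bounded_open
begin

lemma graph_L2: "sobolev_graph \<Omega> v g \<Longrightarrow> v \<in> L2 \<Omega>" "sobolev_graph \<Omega> v g \<Longrightarrow> g \<in> L2 \<Omega>"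
  by (simp_all add: sobolev_graph_def)

lemma graph_test: "\<phi> \<in> test_functions \<Omega> \<Longrightarrow> sobolev_graph \<Omega> \<phi> (grad \<phi>)"
  unfolding sobolev_graph_def using L2_test L2_grad by (auto intro!: bexI[of _ \<phi>])

lemma graph_approx:
  assumes "sobolev_graph \<Omega> v g"
  obtains \<phi> where "\<And>n. \<phi> n \<in> test_functions \<Omega>"
    "(\<lambda>n. L2_norm \<Omega> (\<lambda>x. \<phi> n x - v x)) \<longlonglongrightarrow> 0" "(\<lambda>n. L2_norm \<Omega> (\<lambda>x. grad (\<phi> n) x - g x)) \<longlonglongrightarrow> 0"
proof -
  have "\<exists>\<phi>\<in>test_functions \<Omega>. L2_norm \<Omega> (\<lambda>x. \<phi> x - v x) < inverse (real (Suc n)) \<and>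
      L2_norm \<Omega> (\<lambda>x. grad \<phi> x - g x) < inverse (real (Suc n))" for n
    using assms unfolding sobolev_graph_def by simp
  then obtain \<phi> where \<phi>: "\<And>n. \<phi> n \<in> test_functions \<Omega>"
    "\<And>n. L2_norm \<Omega> (\<lambda>x. \<phi> n x - v x) < inverse (real (Suc n))"
    "\<And>n. L2_norm \<Omega> (\<lambda>x. grad (\<phi> n) x - g x) < inverse (real (Suc n))"
    by metis
  show ?thesis
  proof (rule that[OF \<phi>(1)])
    show "(\<lambda>n. L2_norm \<Omega> (\<lambda>x. \<phi> n x - v x)) \<longlonglongrightarrow> 0"
      by (rule tendsto_sandwich[OF _ _ tendsto_const LIMSEQ_inverse_real_of_nat])
         (use less_imp_le[OF \<phi>(2)] in \<open>auto intro!: always_eventually\<close>)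
    show "(\<lambda>n. L2_norm \<Omega> (\<lambda>x. grad (\<phi> n) x - g x)) \<longlonglongrightarrow> 0"
      by (rule tendsto_sandwich[OF _ _ tendsto_const LIMSEQ_inverse_real_of_nat])
         (use less_imp_le[OF \<phi>(3)] in \<open>auto intro!: always_eventually\<close>)
  qed
qed

text \<open>An approximant of a late member of the sequence approximates the limit. The calculus
  rules for the graph are obtained by verifying them for test functions and passing to the limit
  through this lemma.\<close>

lemma graph_closed:
  assumes "\<And>n::nat. sobolev_graph \<Omega> (v n) (g n)" "V \<in> L2 \<Omega>" "G \<in> L2 \<Omega>"
    and "(\<lambda>n. L2_norm \<Omega> (\<lambda>x. v n x - V x)) \<longlonglongrightarrow> 0" "(\<lambda>n. L2_norm \<Omega> (\<lambda>x. g n x - G x)) \<longlonglongrightarrow> 0"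
  shows "sobolev_graph \<Omega> V G"
  unfolding sobolev_graph_def
proof (intro conjI allI impI assms(2,3))
  fix e :: real assume e: "e > 0"
  have "eventually (\<lambda>n. L2_norm \<Omega> (\<lambda>x. v n x - V x) < e/2 \<and> L2_norm \<Omega> (\<lambda>x. g n x - G x) < e/2) sequentially"
    using order_tendstoD(2)[OF assms(4), of "e/2"] order_tendstoD(2)[OF assms(5), of "e/2"] e
    by (simp add: eventually_conj)
  then obtain n where n: "L2_norm \<Omega> (\<lambda>x. v n x - V x) < e/2" "L2_norm \<Omega> (\<lambda>x. g n x - G x) < e/2"
    by (auto simp: eventually_sequentially)
  obtain \<phi> where \<phi>: "\<phi> \<in> test_functions \<Omega>" "L2_norm \<Omega> (\<lambda>x. \<phi> x - v n x) < e/2"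
      "L2_norm \<Omega> (\<lambda>x. grad \<phi> x - g n x) < e/2"
    using assms(1)[of n] e unfolding sobolev_graph_def by (meson half_gt_zero)
  have "L2_norm \<Omega> (\<lambda>x. \<phi> x - V x) < e"
    using L2_norm_triangle_diff[OF L2_test[OF \<phi>(1)] graph_L2(1)[OF assms(1)] assms(2), of n] n \<phi> by linarith
  moreover have "L2_norm \<Omega> (\<lambda>x. grad \<phi> x - G x) < e"
    using L2_norm_triangle_diff[OF L2_grad[OF \<phi>(1)] graph_L2(2)[OF assms(1)] assms(3), of n] n \<phi> by linarith
  ultimately show "\<exists>\<phi>\<in>test_functions \<Omega>. L2_norm \<Omega> (\<lambda>x. \<phi> x - V x) < e \<and> L2_norm \<Omega> (\<lambda>x. grad \<phi> x - G x) < e"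
    using \<phi>(1) by blast
qed

lemma graph_weak_gradient:
  assumes "sobolev_graph \<Omega> v g"
  shows "weak_gradient \<Omega> v g"
  unfolding weak_gradient_def
proof (intro conjI ballI graph_L2(2)[OF assms])
  fix \<theta> i assume \<theta>: "\<theta> \<in> test_functions \<Omega>" and i: "i \<in> (Basis :: 'a set)"
  obtain \<phi> where \<phi>: "\<And>n. \<phi> n \<in> test_functions \<Omega>"
    "(\<lambda>n. L2_norm \<Omega> (\<lambda>x. \<phi> n x - v x)) \<longlonglongrightarrow> 0" "(\<lambda>n. L2_norm \<Omega> (\<lambda>x. grad (\<phi> n) x - g x)) \<longlonglongrightarrow> 0"
    using graph_approx[OF assms] by blast
  let ?d = "\<lambda>x. frechet_derivative \<theta> (at x) i"
  have d: "?d \<in> L2 \<Omega>" by (intro L2_test test_partial \<theta> i)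
  \<comment> \<open>Testing against the vector field \<theta> i turns the coordinate of the gradient
    into an inner product, so one limit statement serves the function and its gradient.\<close>
  have \<theta>i: "(\<lambda>x. \<theta> x *\<^sub>R i) \<in> L2 \<Omega>"
  proof (rule L2_bound(1)[OF _ L2_test[OF \<theta>], of _ 1])
    show "(\<lambda>x. \<theta> x *\<^sub>R i) \<in> borel_measurable (lebesgue_on \<Omega>)"
      using L2_measurable[OF L2_test[OF \<theta>]] by measurable
    show "AE x in lebesgue_on \<Omega>. norm (\<theta> x *\<^sub>R i) \<le> 1 * norm (\<theta> x)" using i by simp
  qed simp
  note v = graph_L2[OF assms]
  have lim: "(\<lambda>n. \<integral>x. F n x \<bullet> t x \<partial>lebesgue_on \<Omega>) \<longlonglongrightarrow> (\<integral>x. G x \<bullet> t x \<partial>lebesgue_on \<Omega>)"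
    if "\<And>n. F n \<in> L2 \<Omega>" "G \<in> L2 \<Omega>" "t \<in> L2 \<Omega>" "(\<lambda>n. L2_norm \<Omega> (\<lambda>x. F n x - G x)) \<longlonglongrightarrow> 0"
    for F :: "nat \<Rightarrow> 'a \<Rightarrow> 'z::euclidean_space" and G t
  proof (rule LIM_zero_cancel, rule Lim_null_comparison)
    have "(\<integral>x. F n x \<bullet> t x \<partial>lebesgue_on \<Omega>) - (\<integral>x. G x \<bullet> t x \<partial>lebesgue_on \<Omega>) =
        (\<integral>x. (F n x - G x) \<bullet> t x \<partial>lebesgue_on \<Omega>)" for n
      using that by (simp add: inner_diff_left L2_inner_integrable)
    then show "eventually (\<lambda>n. norm ((\<integral>x. F n x \<bullet> t x \<partial>lebesgue_on \<Omega>) - (\<integral>x. G x \<bullet> t x \<partial>lebesgue_on \<Omega>))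
        \<le> L2_norm \<Omega> (\<lambda>x. F n x - G x) * L2_norm \<Omega> t) sequentially"
      using L2_Cauchy_Schwarz[OF L2_diff[OF that(1,2)] that(3)] by simp
    show "(\<lambda>n. L2_norm \<Omega> (\<lambda>x. F n x - G x) * L2_norm \<Omega> t) \<longlonglongrightarrow> 0"
      using tendsto_mult_right[OF that(4), of "L2_norm \<Omega> t"] by simp
  qed
  have 1: "(\<lambda>n. \<integral>x. \<phi> n x * ?d x \<partial>lebesgue_on \<Omega>) \<longlonglongrightarrow> (\<integral>x. v x * ?d x \<partial>lebesgue_on \<Omega>)"
    using lim[OF L2_test[OF \<phi>(1)] v(1) d \<phi>(2)] by simp
  have 2: "(\<lambda>n. \<integral>x. (grad (\<phi> n) x \<bullet> i) * \<theta> x \<partial>lebesgue_on \<Omega>) \<longlonglongrightarrow> (\<integral>x. (g x \<bullet> i) * \<theta> x \<partial>lebesgue_on \<Omega>)"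
    using lim[OF L2_grad[OF \<phi>(1)] v(2) \<theta>i \<phi>(3)] by (simp add: mult.commute)
  have "(\<lambda>n. \<integral>x. \<phi> n x * ?d x \<partial>lebesgue_on \<Omega>) \<longlonglongrightarrow> - (\<integral>x. (g x \<bullet> i) * \<theta> x \<partial>lebesgue_on \<Omega>)"
    using tendsto_minus[OF 2] weak_gradient_test[OF \<phi>(1)] \<theta> i unfolding weak_gradient_def by simp
  with 1 show "(\<integral>x. v x * ?d x \<partial>lebesgue_on \<Omega>) = - (\<integral>x. (g x \<bullet> i) * \<theta> x \<partial>lebesgue_on \<Omega>)"
    by (rule LIMSEQ_unique)
qed

lemma graph_add:
  assumes "sobolev_graph \<Omega> v g" "sobolev_graph \<Omega> w h"
  shows "sobolev_graph \<Omega> (\<lambda>x. v x + w x) (\<lambda>x. g x + h x)"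
proof -
  note L = graph_L2[OF assms(1)] graph_L2[OF assms(2)]
  obtain \<phi> where \<phi>: "\<And>n. \<phi> n \<in> test_functions \<Omega>"
    "(\<lambda>n. L2_norm \<Omega> (\<lambda>x. \<phi> n x - v x)) \<longlonglongrightarrow> 0" "(\<lambda>n. L2_norm \<Omega> (\<lambda>x. grad (\<phi> n) x - g x)) \<longlonglongrightarrow> 0"
    using graph_approx[OF assms(1)] by blast
  obtain \<theta> where \<theta>: "\<And>n. \<theta> n \<in> test_functions \<Omega>"
    "(\<lambda>n. L2_norm \<Omega> (\<lambda>x. \<theta> n x - w x)) \<longlonglongrightarrow> 0" "(\<lambda>n. L2_norm \<Omega> (\<lambda>x. grad (\<theta> n) x - h x)) \<longlonglongrightarrow> 0"
    using graph_approx[OF assms(2)] by blast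
  have lim: "(\<lambda>n. L2_norm \<Omega> (\<lambda>x. (F n x + H n x) - (G x + K x))) \<longlonglongrightarrow> 0"
    if "\<And>n. F n \<in> L2 \<Omega>" "\<And>n. H n \<in> L2 \<Omega>" "G \<in> L2 \<Omega>" "K \<in> L2 \<Omega>"
      "(\<lambda>n. L2_norm \<Omega> (\<lambda>x. F n x - G x)) \<longlonglongrightarrow> 0" "(\<lambda>n. L2_norm \<Omega> (\<lambda>x. H n x - K x)) \<longlonglongrightarrow> 0"
    for F H :: "nat \<Rightarrow> 'a \<Rightarrow> 'z::euclidean_space" and G K
  proof (rule tendsto_sandwich[OF _ _ tendsto_const])
    show "(\<lambda>n. L2_norm \<Omega> (\<lambda>x. F n x - G x) + L2_norm \<Omega> (\<lambda>x. H n x - K x)) \<longlonglongrightarrow> 0"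
      using tendsto_add[OF that(5,6)] by simp
    show "eventually (\<lambda>n. L2_norm \<Omega> (\<lambda>x. (F n x + H n x) - (G x + K x)) \<le>
      L2_norm \<Omega> (\<lambda>x. F n x - G x) + L2_norm \<Omega> (\<lambda>x. H n x - K x)) sequentially"
      using L2_norm_triangle[OF L2_diff[OF that(1,3)] L2_diff[OF that(2,4)]]
      by (simp add: algebra_simps)
  qed simp
  show ?thesis
  proof (rule graph_closed[OF graph_test[OF test_add[OF \<phi>(1) \<theta>(1)]]])
    show "(\<lambda>n. L2_norm \<Omega> (\<lambda>x. grad (\<lambda>x. \<phi> n x + \<theta> n x) x - (g x + h x))) \<longlonglongrightarrow> 0"
      unfolding grad_add[OF \<phi>(1) \<theta>(1)] by (intro lim L2_grad L \<phi> \<theta>)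
  qed (intro lim L2_add L2_test L \<phi> \<theta>)+
qed

lemma graph_cmult:
  assumes "sobolev_graph \<Omega> v g"
  shows "sobolev_graph \<Omega> (\<lambda>x. c * v x) (\<lambda>x. c *\<^sub>R g x)"
proof -
  note L = graph_L2[OF assms]
  obtain \<phi> where \<phi>: "\<And>n. \<phi> n \<in> test_functions \<Omega>"
    "(\<lambda>n. L2_norm \<Omega> (\<lambda>x. \<phi> n x - v x)) \<longlonglongrightarrow> 0" "(\<lambda>n. L2_norm \<Omega> (\<lambda>x. grad (\<phi> n) x - g x)) \<longlonglongrightarrow> 0"
    using graph_approx[OF assms] by blast
  show ?thesis
  proof (rule graph_closed[OF graph_test[OF test_cmult[OF \<phi>(1), of c]]])
    have "L2_norm \<Omega> (\<lambda>x. c * \<phi> n x - c * v x) = \<bar>c\<bar> * L2_norm \<Omega> (\<lambda>x. \<phi> n x - v x)" for n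
      using L2_norm_mult[of \<Omega> c "\<lambda>x. \<phi> n x - v x"] by (simp add: right_diff_distrib)
    then show "(\<lambda>n. L2_norm \<Omega> (\<lambda>x. c * \<phi> n x - c * v x)) \<longlonglongrightarrow> 0"
      using tendsto_mult_left[OF \<phi>(2), of "\<bar>c\<bar>"] by simp
    have "L2_norm \<Omega> (\<lambda>x. c *\<^sub>R grad (\<phi> n) x - c *\<^sub>R g x) = \<bar>c\<bar> * L2_norm \<Omega> (\<lambda>x. grad (\<phi> n) x - g x)" for n
      using L2_scaleR(2)[OF L2_diff[OF L2_grad[OF \<phi>(1)] L(2)], of c n] by (simp add: scaleR_diff_right)
    then show "(\<lambda>n. L2_norm \<Omega> (\<lambda>x. grad (\<lambda>x. c * \<phi> n x) x - c *\<^sub>R g x)) \<longlonglongrightarrow> 0"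
      using tendsto_mult_left[OF \<phi>(3), of "\<bar>c\<bar>"] by (simp add: grad_cmult[OF \<phi>(1)])
  qed (intro L2_mult L2_scaleR L)+
qed

section \<open>Identification of \<open>H1_0\<close> with the domain of the graph\<close>

lemma weak_gradient_diff:
  assumes "weak_gradient \<Omega> v g" "weak_gradient \<Omega> w h" "v \<in> L2 \<Omega>" "w \<in> L2 \<Omega>"
  shows "weak_gradient \<Omega> (\<lambda>x. v x - w x) (\<lambda>x. g x - h x)"
  unfolding weak_gradient_def
proof (intro conjI ballI)
  have L: "g \<in> L2 \<Omega>" "h \<in> L2 \<Omega>" using assms by (auto simp: weak_gradient_def)
  then show "(\<lambda>x. g x - h x) \<in> L2 \<Omega>" by (rule L2_diff)
  fix \<theta> i assume \<theta>: "\<theta> \<in> test_functions \<Omega>" and i: "i \<in> (Basis :: 'a set)"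
  note d = L2_test[OF test_partial[OF \<theta> i]] and t = L2_test[OF \<theta>]
  show "(\<integral>x. (v x - w x) * frechet_derivative \<theta> (at x) i \<partial>lebesgue_on \<Omega>) =
      - (\<integral>x. ((g x - h x) \<bullet> i) * \<theta> x \<partial>lebesgue_on \<Omega>)"
    using assms \<theta> i L2_mult_integrable[OF assms(3) d] L2_mult_integrable[OF assms(4) d]
      L2_mult_integrable[OF L2_inner_Basis[OF L(1) i] t] L2_mult_integrable[OF L2_inner_Basis[OF L(2) i] t]
    by (simp add: left_diff_distrib inner_diff_left weak_gradient_def)
qed

lemma weak_gradient_wgrad: "weak_gradient \<Omega> v g \<Longrightarrow> weak_gradient \<Omega> v (wgrad \<Omega> v)"
  unfolding wgrad_def by (rule someI[of "weak_gradient \<Omega> v"])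

lemma wgrad_eq: "weak_gradient \<Omega> v g \<Longrightarrow> AE x in lebesgue_on \<Omega>. wgrad \<Omega> v x = g x"
  using weak_gradient_unique weak_gradient_wgrad by blast

lemma L2_wgrad: "weak_gradient \<Omega> v g \<Longrightarrow> wgrad \<Omega> v \<in> L2 \<Omega>"
  using weak_gradient_wgrad by (auto simp: weak_gradient_def)

lemma H1_norm_sq:
  assumes "weak_gradient \<Omega> v g"
  shows "(H1_norm \<Omega> v)\<^sup>2 = (L2_norm \<Omega> v)\<^sup>2 + (L2_norm \<Omega> g)\<^sup>2"
  using L2_norm_cong[OF wgrad_eq[OF assms] L2_wgrad[OF assms]] assms
  by (simp add: H1_norm_def weak_gradient_def)

lemma H1_norm_nonneg [simp]: "H1_norm \<Omega> v \<ge> 0"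
  by (simp add: H1_norm_def)

lemma L2_norm_le_H1_norm: "L2_norm \<Omega> v \<le> H1_norm \<Omega> v" "L2_norm \<Omega> (wgrad \<Omega> v) \<le> H1_norm \<Omega> v"
  by (auto simp: H1_norm_def intro!: real_le_rsqrt)

text \<open>By uniqueness of weak gradients, convergence in \<open>H1_norm\<close> splits into L2
  convergence of the functions and of the classical gradients. With \<open>graph_H1_0\<close> this
  allows free passage between \<open>H1_0\<close> and the graph.\<close>

lemma H1_0_graph:
  assumes "v \<in> H1_0 \<Omega>"
  shows "sobolev_graph \<Omega> v (wgrad \<Omega> v)"
proof -
  obtain g where v: "v \<in> L2 \<Omega>" and g: "weak_gradient \<Omega> v g"
    using assms by (auto simp: H1_0_def H1_def)
  note w = weak_gradient_wgrad[OF g]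
  obtain \<phi> where \<phi>: "\<And>n. \<phi> n \<in> test_functions \<Omega>" "(\<lambda>n. H1_norm \<Omega> (\<lambda>x. \<phi> n x - v x)) \<longlonglongrightarrow> 0"
    using assms by (auto simp: H1_0_def)
  show ?thesis
  proof (rule graph_closed[OF graph_test[OF \<phi>(1)] v L2_wgrad[OF g]])
    show "(\<lambda>n. L2_norm \<Omega> (\<lambda>x. \<phi> n x - v x)) \<longlonglongrightarrow> 0"
      by (rule tendsto_sandwich[OF _ _ tendsto_const \<phi>(2)]) (auto simp: L2_norm_le_H1_norm)
    have "L2_norm \<Omega> (\<lambda>x. grad (\<phi> n) x - wgrad \<Omega> v x) \<le> H1_norm \<Omega> (\<lambda>x. \<phi> n x - v x)" for n
    proof (rule power2_le_imp_le)
      show "(L2_norm \<Omega> (\<lambda>x. grad (\<phi> n) x - wgrad \<Omega> v x))\<^sup>2 \<le> (H1_norm \<Omega> (\<lambda>x. \<phi> n x - v x))\<^sup>2"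
        using H1_norm_sq[OF weak_gradient_diff[OF weak_gradient_test[OF \<phi>(1)] w L2_test[OF \<phi>(1)] v]] by simp
    qed simp
    then show "(\<lambda>n. L2_norm \<Omega> (\<lambda>x. grad (\<phi> n) x - wgrad \<Omega> v x)) \<longlonglongrightarrow> 0"
      by (intro tendsto_sandwich[OF _ _ tendsto_const \<phi>(2)]) auto
  qed
qed

lemma graph_H1_0:
  assumes "sobolev_graph \<Omega> v g"
  shows "v \<in> H1_0 \<Omega>"
proof -
  note L = graph_L2[OF assms]
  note w = graph_weak_gradient[OF assms]
  obtain \<phi> where \<phi>: "\<And>n. \<phi> n \<in> test_functions \<Omega>"
    "(\<lambda>n. L2_norm \<Omega> (\<lambda>x. \<phi> n x - v x)) \<longlonglongrightarrow> 0" "(\<lambda>n. L2_norm \<Omega> (\<lambda>x. grad (\<phi> n) x - g x)) \<longlonglongrightarrow> 0"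
    using graph_approx[OF assms] by blast
  have "H1_norm \<Omega> (\<lambda>x. \<phi> n x - v x) =
      sqrt ((L2_norm \<Omega> (\<lambda>x. \<phi> n x - v x))\<^sup>2 + (L2_norm \<Omega> (\<lambda>x. grad (\<phi> n) x - g x))\<^sup>2)" for n
    using H1_norm_sq[OF weak_gradient_diff[OF weak_gradient_test[OF \<phi>(1)] w L2_test[OF \<phi>(1)] L(1)], of n]
    by (simp add: real_sqrt_unique)
  moreover have "(\<lambda>n. sqrt ((L2_norm \<Omega> (\<lambda>x. \<phi> n x - v x))\<^sup>2 + (L2_norm \<Omega> (\<lambda>x. grad (\<phi> n) x - g x))\<^sup>2))
      \<longlonglongrightarrow> sqrt (0\<^sup>2 + 0\<^sup>2)"
    by (intro tendsto_intros \<phi>)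
  ultimately have "(\<lambda>n. H1_norm \<Omega> (\<lambda>x. \<phi> n x - v x)) \<longlonglongrightarrow> 0" by simp
  then show ?thesis using L w \<phi>(1) by (auto simp: H1_0_def H1_def)
qed

text \<open>A bounded derivative makes \<open>j\<close> Lipschitz, which settles the functions. The
  gradient error splits into \<open>j' (\<phi> n x)\<close> times the error of the gradients, small
  in L2, and the error of \<open>j'\<close> times the fixed field \<open>g\<close>, which tends to
  zero by dominated convergence.\<close>

lemma graph_compose:
  assumes "sobolev_graph \<Omega> v g" "\<And>k. C_k k j" "j 0 = 0"
    and j': "\<And>t. (j has_real_derivative j' t) (at t)" and bd: "\<And>t. \<bar>j' t\<bar> \<le> C"
  shows "sobolev_graph \<Omega> (\<lambda>x. j (v x)) (\<lambda>x. j' (v x) *\<^sub>R g x)"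
proof -
  let ?M = "lebesgue_on \<Omega>"
  note L = graph_L2[OF assms(1)]
  have C: "C \<ge> 0" using bd[of 0] by linarith
  have cj: "isCont j t" "isCont j' t" for t
    using C_k_continuous[OF assms(2)[of 0]] C_k_continuous[OF C_k_deriv[OF j' assms(2), of 0]]
    by (auto simp: continuous_on_eq_continuous_at)
  have [measurable]: "j \<in> borel_measurable borel" "j' \<in> borel_measurable borel"
    using C_k_continuous[OF assms(2)[of 0]] C_k_continuous[OF C_k_deriv[OF j' assms(2), of 0]]
    by (auto intro: borel_measurable_continuous_onI)
  have [measurable]: "v \<in> borel_measurable ?M" "g \<in> borel_measurable ?M"
    using L L2_measurable by auto
  have Lip: "\<bar>j s - j t\<bar> \<le> C * \<bar>s - t\<bar>" for s t
    using field_differentiable_bound[of UNIV j j' C s t] j' bd by auto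
  obtain \<theta> where \<theta>: "\<And>n. \<theta> n \<in> test_functions \<Omega>"
    "(\<lambda>n. L2_norm \<Omega> (\<lambda>x. \<theta> n x - v x)) \<longlonglongrightarrow> 0" "(\<lambda>n. L2_norm \<Omega> (\<lambda>x. grad (\<theta> n) x - g x)) \<longlonglongrightarrow> 0"
    using graph_approx[OF assms(1)] by blast
  \<comment> \<open>Dominated convergence for the error of \<open>j'\<close> uses convergence almost
    everywhere, hence the passage to a subsequence.\<close>
  obtain r :: "nat \<Rightarrow> nat" where r: "strict_mono r" "AE x in ?M. (\<lambda>n. \<theta> (r n) x) \<longlonglongrightarrow> v x"
    using L2_AE_subseq[OF L2_test[OF \<theta>(1)] L(1) \<theta>(2)] by blast
  define \<phi> where "\<phi> n = \<theta> (r n)" for n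
  have \<phi>: "\<phi> n \<in> test_functions \<Omega>" for n using \<theta> by (simp add: \<phi>_def)
  have \<phi>v: "(\<lambda>n. L2_norm \<Omega> (\<lambda>x. \<phi> n x - v x)) \<longlonglongrightarrow> 0"
    using LIMSEQ_subseq_LIMSEQ[OF \<theta>(2) r(1)] by (simp add: \<phi>_def o_def)
  have \<phi>g: "(\<lambda>n. L2_norm \<Omega> (\<lambda>x. grad (\<phi> n) x - g x)) \<longlonglongrightarrow> 0"
    using LIMSEQ_subseq_LIMSEQ[OF \<theta>(3) r(1)] by (simp add: \<phi>_def o_def)
  have \<phi>AE: "AE x in ?M. (\<lambda>n. \<phi> n x) \<longlonglongrightarrow> v x" using r(2) by (simp add: \<phi>_def)
  have [measurable]: "\<phi> n \<in> borel_measurable ?M" "grad (\<phi> n) \<in> borel_measurable ?M" for n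
    using L2_measurable L2_test[OF \<phi>] L2_grad[OF \<phi>] by auto
  have jv: "(\<lambda>x. j (v x)) \<in> L2 \<Omega>"
    by (rule L2_bound(1)[OF _ L(1) _ C]) (use Lip[of _ 0] assms(3) in auto)
  have jg: "(\<lambda>x. j' (v x) *\<^sub>R g x) \<in> L2 \<Omega>"
    by (rule L2_bound(1)[OF _ L(2) _ C]) (use bd in \<open>auto intro!: mult_right_mono\<close>)
  show ?thesis
  proof (rule graph_closed[OF graph_test[OF test_compose[OF \<phi> assms(2,3)]] jv jg])
    show "(\<lambda>n. L2_norm \<Omega> (\<lambda>x. j (\<phi> n x) - j (v x))) \<longlonglongrightarrow> 0"
    proof (rule tendsto_sandwich[OF _ _ tendsto_const])
      show "(\<lambda>n. C * L2_norm \<Omega> (\<lambda>x. \<phi> n x - v x)) \<longlonglongrightarrow> 0"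
        using tendsto_mult_left[OF \<phi>v, of C] by simp
      have "L2_norm \<Omega> (\<lambda>x. j (\<phi> n x) - j (v x)) \<le> C * L2_norm \<Omega> (\<lambda>x. \<phi> n x - v x)" for n
        by (rule L2_bound(2)[OF _ L2_diff[OF L2_test[OF \<phi>] L(1)] _ C]) (use Lip in auto)
      then show "eventually (\<lambda>n. L2_norm \<Omega> (\<lambda>x. j (\<phi> n x) - j (v x)) \<le> C * L2_norm \<Omega> (\<lambda>x. \<phi> n x - v x)) sequentially"
        by simp
    qed simp
    let ?A = "\<lambda>n x. j' (\<phi> n x) *\<^sub>R (grad (\<phi> n) x - g x)" and ?B = "\<lambda>n x. (j' (\<phi> n x) - j' (v x)) *\<^sub>R g x"
    have "AE x in ?M. norm (?A n x) \<le> C * norm (grad (\<phi> n) x - g x)" for n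
      using bd by (intro AE_I2) (simp add: mult_right_mono)
    then have A: "?A n \<in> L2 \<Omega>" "L2_norm \<Omega> (?A n) \<le> C * L2_norm \<Omega> (\<lambda>x. grad (\<phi> n) x - g x)" for n
      using L2_bound[OF _ L2_diff[OF L2_grad[OF \<phi>[of n]] L(2)] _ C, of "?A n"] by auto
    have bB: "norm (?B n x) \<le> norm ((2 * C) *\<^sub>R g x)" for n x
    proof -
      have "\<bar>j' (\<phi> n x) - j' (v x)\<bar> \<le> 2 * C" using bd[of "\<phi> n x"] bd[of "v x"] by linarith
      then show ?thesis using C by (simp add: mult_right_mono)
    qed
    have "(\<lambda>n. L2_norm \<Omega> (?B n)) \<longlonglongrightarrow> 0"
    proof (rule L2_dominated_convergence[OF _ L2_scaleR(1)[OF L(2), of "2 * C"]])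
      show "AE x in ?M. (\<lambda>n. ?B n x) \<longlonglongrightarrow> 0"
        using \<phi>AE
      proof eventually_elim
        case (elim x)
        have "(\<lambda>n. (j' (\<phi> n x) - j' (v x)) *\<^sub>R g x) \<longlonglongrightarrow> (j' (v x) - j' (v x)) *\<^sub>R g x"
          by (intro tendsto_intros isCont_tendsto_compose[OF cj(2)] elim)
        then show ?case by simp
      qed
    qed (use bB in auto)
    then have lim: "(\<lambda>n. C * L2_norm \<Omega> (\<lambda>x. grad (\<phi> n) x - g x) + L2_norm \<Omega> (?B n)) \<longlonglongrightarrow> 0"
      using tendsto_add[OF tendsto_mult_left[OF \<phi>g, of C]] by fastforce
    have B: "?B n \<in> L2 \<Omega>" for n
      by (rule L2_bound(1)[OF _ L2_scaleR(1)[OF L(2), of "2 * C"], of _ 1]) (use bB in auto)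
    have "L2_norm \<Omega> (\<lambda>x. grad (\<lambda>x. j (\<phi> n x)) x - j' (v x) *\<^sub>R g x) \<le>
       C * L2_norm \<Omega> (\<lambda>x. grad (\<phi> n) x - g x) + L2_norm \<Omega> (?B n)" for n
    proof -
      have "(\<lambda>x. grad (\<lambda>x. j (\<phi> n x)) x - j' (v x) *\<^sub>R g x) = (\<lambda>x. ?A n x + ?B n x)"
        by (simp add: grad_compose[OF \<phi> j'] algebra_simps)
      then show ?thesis
        using L2_norm_triangle[OF A(1) B, of n n] A(2)[of n] by simp
    qed
    then show "(\<lambda>n. L2_norm \<Omega> (\<lambda>x. grad (\<lambda>x. j (\<phi> n x)) x - j' (v x) *\<^sub>R g x)) \<longlonglongrightarrow> 0"
      by (intro tendsto_sandwich[OF _ _ tendsto_const lim]) auto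
  qed
qed

text \<open>The absolute value is the limit of the smooth functions \<open>t \<mapsto> n t\<^sup>2 / sqrt (1 + n\<^sup>2 t\<^sup>2)\<close>.\<close>

lemma graph_abs:
  assumes "sobolev_graph \<Omega> v g"
  shows "sobolev_graph \<Omega> (\<lambda>x. \<bar>v x\<bar>) (\<lambda>x. sgn (v x) *\<^sub>R g x)"
proof -
  let ?M = "lebesgue_on \<Omega>"
  note L = graph_L2[OF assms]
  have [measurable]: "v \<in> borel_measurable ?M" "g \<in> borel_measurable ?M"
    using L L2_measurable by auto
  \<comment> \<open>With this \<open>q\<close> the smoothing is
    \<open>\<bar>t\<bar> sqrt (1 - q)\<close> and its derivative is
    \<open>sgn t sqrt (1 - q) (1 + q)\<close>. All bounds follow from
    \<open>0 \<le> q \<le> 1\<close>, all limits from the decay of \<open>q\<close> for nonzero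
    \<open>t\<close>; at \<open>t = 0\<close> both expressions vanish, in agreement with
    \<open>sgn 0 = 0\<close>.\<close>
  define q where "q n t = 1 / (1 + (real (Suc n) * t)\<^sup>2)" for n t
  define j where "j n t = real (Suc n) * (t * t) * (1 / sqrt (1 + (real (Suc n) * t)\<^sup>2))" for n t
  define j' where "j' n t = sgn t * sqrt (1 - q n t) * (1 + q n t)" for n t
  have pos: "1 + s\<^sup>2 > 0" for s :: real by (simp add: add_pos_nonneg)
  have q01: "0 \<le> q n t" "q n t \<le> 1" for n t
    using pos[of "real (Suc n) * t"] unfolding q_def by (simp_all add: pos_divide_le_eq del: of_nat_Suc)
  have sq: "sqrt (1 - q n t) = real (Suc n) * \<bar>t\<bar> / sqrt (1 + (real (Suc n) * t)\<^sup>2)" for n t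
  proof -
    have "1 - q n t = (real (Suc n) * t)\<^sup>2 / (1 + (real (Suc n) * t)\<^sup>2)"
      unfolding q_def using pos[of "real (Suc n) * t"] by (simp add: field_simps)
    then show ?thesis by (simp add: real_sqrt_divide abs_mult)
  qed
  have j_eq: "j n t = \<bar>t\<bar> * sqrt (1 - q n t)" for n t
    unfolding sq j_def by simp
  have smooth: "C_k k (j n)" for k n
    unfolding j_def[abs_def]
    by (intro C_k_mult C_k_const C_k_ident_real C_k_compose[OF C_k_inverse_sqrt, of k "\<lambda>t. real (Suc n) * t"])
  have deriv: "(j n has_real_derivative j' n t) (at t)" for n t
  proof -
    define N where "N = real (Suc n)"
    define S where "S = sqrt (1 + (N * t)\<^sup>2)"
    have S: "S > 0" "S * S = 1 + (N * t)\<^sup>2" using pos[of "N * t"] by (auto simp: S_def)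
    have "((\<lambda>t. 1 / sqrt (1 + (N * t)\<^sup>2)) has_real_derivative
        - (inverse S / 2 * (2 * (N * t) * N)) / (S * S)) (at t)"
      unfolding S_def using pos[of "N * t"] by (auto intro!: derivative_eq_intros)
    moreover have "((\<lambda>t. N * (t * t)) has_real_derivative N * (t + t)) (at t)"
      by (auto intro!: derivative_eq_intros)
    ultimately have "((\<lambda>t. N * (t * t) * (1 / sqrt (1 + (N * t)\<^sup>2))) has_real_derivative
        N * (t + t) * (1 / S) + - (inverse S / 2 * (2 * (N * t) * N)) / (S * S) * (N * (t * t))) (at t)"
      unfolding S_def by (rule DERIV_mult[rotated])
    then have "(j n has_real_derivative
        N * (t + t) * (1 / S) + N * (t * t) * (- (inverse S / 2 * (2 * (N * t) * N)) / (S * S))) (at t)"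
      unfolding j_def[abs_def] N_def[symmetric] by (simp only: mult.commute[of _ "N * (t * t)"])
    moreover have "j' n t = N * t / S * (1 + 1 / (S * S))"
      unfolding j'_def sq unfolding q_def N_def[symmetric] S_def[symmetric] S(2)[symmetric]
      using S(1) by (cases "t = 0"; cases "t > 0") auto
    moreover have "N * (t + t) * (1 / S) + N * (t * t) * (- (inverse S / 2 * (2 * (N * t) * N)) / (S * S)) =
       N * t / S * (2 - (N * t)\<^sup>2 / (S * S))"
      using S(1) by (simp add: field_simps power2_eq_square)
    moreover have "2 - (N * t)\<^sup>2 / (S * S) = 1 + 1 / (S * S)"
    proof -
      have "(N * t)\<^sup>2 = S * S - 1" using S(2) by simp
      then show ?thesis using S(1) by (simp add: field_simps)
    qed
    ultimately show ?thesis by simp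
  qed
  have j'2: "\<bar>j' n t\<bar> \<le> 2" for n t
  proof -
    have "\<bar>sgn t\<bar> * \<bar>sqrt (1 - q n t)\<bar> * \<bar>1 + q n t\<bar> \<le> 1 * 1 * 2"
      using q01[of n t] by (intro mult_mono) (auto simp: sgn_if)
    then show ?thesis by (simp add: j'_def abs_mult)
  qed
  have q0: "(\<lambda>n. q n t) \<longlonglongrightarrow> 0" if "t \<noteq> 0" for t
  proof (rule tendsto_sandwich[OF _ _ tendsto_const])
    show "(\<lambda>n. 1 / t\<^sup>2 * inverse (real (Suc n))) \<longlonglongrightarrow> 0"
      using tendsto_mult_left[OF LIMSEQ_inverse_real_of_nat, of "1 / t\<^sup>2"] by simp
    have "q n t \<le> 1 / t\<^sup>2 * inverse (real (Suc n))" for n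
    proof -
      have "real (Suc n) * t\<^sup>2 \<le> (real (Suc n))\<^sup>2 * t\<^sup>2"
        by (intro mult_right_mono) (auto simp: power2_eq_square)
      then have "real (Suc n) * t\<^sup>2 \<le> 1 + (real (Suc n) * t)\<^sup>2"
        by (simp only: power_mult_distrib)
      moreover have "real (Suc n) * t\<^sup>2 > 0" using that by simp
      ultimately have "q n t \<le> 1 / (real (Suc n) * t\<^sup>2)"
        unfolding q_def by (intro divide_left_mono mult_pos_pos) (use pos in auto)
      then show ?thesis by (simp add: field_simps)
    qed
    then show "eventually (\<lambda>n. q n t \<le> 1 / t\<^sup>2 * inverse (real (Suc n))) sequentially" by simp
  qed (use q01 in auto)
  have jlim: "(\<lambda>n. j n t) \<longlonglongrightarrow> \<bar>t\<bar>" and j'lim: "(\<lambda>n. j' n t) \<longlonglongrightarrow> sgn t" for t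
  proof -
    have "(\<lambda>n. j n t) \<longlonglongrightarrow> \<bar>t\<bar> * sqrt (1 - 0)" if "t \<noteq> 0"
      unfolding j_eq by (intro tendsto_intros q0 that)
    then show "(\<lambda>n. j n t) \<longlonglongrightarrow> \<bar>t\<bar>" by (cases "t = 0") (auto simp: j_eq)
    have "(\<lambda>n. j' n t) \<longlonglongrightarrow> sgn t * sqrt (1 - 0) * (1 + 0)" if "t \<noteq> 0"
      unfolding j'_def by (intro tendsto_intros q0 that)
    then show "(\<lambda>n. j' n t) \<longlonglongrightarrow> sgn t" by (cases "t = 0") (auto simp: j'_def)
  qed
  have [measurable]: "j n \<in> borel_measurable borel" "j' n \<in> borel_measurable borel" for n
    using C_k_continuous[OF smooth[of 0]] C_k_continuous[OF C_k_deriv[OF deriv smooth, of 0]]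
    by (auto intro: borel_measurable_continuous_onI)
  have absL: "(\<lambda>x. \<bar>v x\<bar>) \<in> L2 \<Omega>"
    by (rule L2_bound(1)[OF _ L(1), of _ 1]) auto
  have sgnL: "(\<lambda>x. sgn (v x) *\<^sub>R g x) \<in> L2 \<Omega>"
    by (rule L2_bound(1)[OF _ L(2), of _ 1]) (auto simp: abs_sgn_eq)
  show ?thesis
  proof (rule graph_closed[OF graph_compose[OF assms smooth _ deriv j'2] absL sgnL])
    show "j n 0 = 0" for n by (simp add: j_def)
    show "(\<lambda>n. L2_norm \<Omega> (\<lambda>x. j n (v x) - \<bar>v x\<bar>)) \<longlonglongrightarrow> 0"
    proof (rule L2_dominated_convergence[OF _ L(1)])
      show "AE x in ?M. norm (j n (v x) - \<bar>v x\<bar>) \<le> norm (v x)" for n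
      proof (intro AE_I2)
        fix x
        have "0 \<le> sqrt (1 - q n (v x))" "sqrt (1 - q n (v x)) \<le> 1" using q01[of n "v x"] by auto
        then have "0 \<le> \<bar>v x\<bar> * sqrt (1 - q n (v x))" "\<bar>v x\<bar> * sqrt (1 - q n (v x)) \<le> \<bar>v x\<bar>"
          by (auto intro: mult_left_le)
        then show "norm (j n (v x) - \<bar>v x\<bar>) \<le> norm (v x)" unfolding j_eq by simp
      qed
      show "AE x in ?M. (\<lambda>n. j n (v x) - \<bar>v x\<bar>) \<longlonglongrightarrow> 0"
        by (intro AE_I2 LIM_zero jlim)
    qed measurable
    show "(\<lambda>n. L2_norm \<Omega> (\<lambda>x. j' n (v x) *\<^sub>R g x - sgn (v x) *\<^sub>R g x)) \<longlonglongrightarrow> 0"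
    proof (rule L2_dominated_convergence[OF _ L2_scaleR(1)[OF L(2), of 3]])
      show "AE x in ?M. norm (j' n (v x) *\<^sub>R g x - sgn (v x) *\<^sub>R g x) \<le> norm (3 *\<^sub>R g x)" for n
      proof (intro AE_I2)
        fix x
        have "\<bar>j' n (v x) - sgn (v x)\<bar> \<le> 3" using j'2[of n "v x"] by (auto simp: sgn_if)
        then show "norm (j' n (v x) *\<^sub>R g x - sgn (v x) *\<^sub>R g x) \<le> norm (3 *\<^sub>R g x)"
          by (simp add: scaleR_diff_left[symmetric] mult_right_mono)
      qed
      show "AE x in ?M. (\<lambda>n. j' n (v x) *\<^sub>R g x - sgn (v x) *\<^sub>R g x) \<longlonglongrightarrow> 0"
        by (intro AE_I2 LIM_zero tendsto_scaleR tendsto_const j'lim)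
    qed measurable
  qed
qed

section \<open>Vector lattice structure of \<open>H1_0\<close>\<close>

lemma H1_0_L2: "v \<in> H1_0 \<Omega> \<Longrightarrow> v \<in> L2 \<Omega>"
  by (simp add: H1_0_def H1_def)

lemma H1_0_wgrad_L2: "v \<in> H1_0 \<Omega> \<Longrightarrow> wgrad \<Omega> v \<in> L2 \<Omega>"
  using H1_0_graph graph_L2 by blast

lemma H1_0_test: "\<phi> \<in> test_functions \<Omega> \<Longrightarrow> \<phi> \<in> H1_0 \<Omega>"
  by (rule graph_H1_0[OF graph_test])

lemma H1_0_add: "v \<in> H1_0 \<Omega> \<Longrightarrow> w \<in> H1_0 \<Omega> \<Longrightarrow> (\<lambda>x. v x + w x) \<in> H1_0 \<Omega>"
  using graph_H1_0[OF graph_add[OF H1_0_graph H1_0_graph]] .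

lemma H1_0_cmult: "v \<in> H1_0 \<Omega> \<Longrightarrow> (\<lambda>x. c * v x) \<in> H1_0 \<Omega>"
  using graph_H1_0[OF graph_cmult[OF H1_0_graph]] .

lemma H1_0_minus: "v \<in> H1_0 \<Omega> \<Longrightarrow> (\<lambda>x. - v x) \<in> H1_0 \<Omega>"
  using H1_0_cmult[of v "-1"] by simp

lemma H1_0_diff: "v \<in> H1_0 \<Omega> \<Longrightarrow> w \<in> H1_0 \<Omega> \<Longrightarrow> (\<lambda>x. v x - w x) \<in> H1_0 \<Omega>"
  using H1_0_add[OF _ H1_0_minus] by fastforce

lemma H1_0_zero: "(\<lambda>x. 0) \<in> H1_0 \<Omega>"
  by (rule H1_0_test[OF test_zero])

lemma H1_0_sum:
  "finite I \<Longrightarrow> (\<And>i. i \<in> I \<Longrightarrow> v i \<in> H1_0 \<Omega>) \<Longrightarrow> (\<lambda>x. \<Sum>i\<in>I. v i x) \<in> H1_0 \<Omega>"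
  by (induction I rule: finite_induct) (auto intro: H1_0_zero H1_0_add)

lemma H1_0_abs: "v \<in> H1_0 \<Omega> \<Longrightarrow> (\<lambda>x. \<bar>v x\<bar>) \<in> H1_0 \<Omega>"
  using graph_H1_0[OF graph_abs[OF H1_0_graph]] .

lemma H1_0_max:
  assumes "v \<in> H1_0 \<Omega>" "w \<in> H1_0 \<Omega>"
  shows "(\<lambda>x. max (v x) (w x)) \<in> H1_0 \<Omega>"
proof -
  have "(\<lambda>x. max (v x) (w x)) = (\<lambda>x. (1/2) * ((v x + w x) + \<bar>v x - w x\<bar>))"
    by (auto simp: max_def)
  moreover have "(\<lambda>x. (1/2) * ((v x + w x) + \<bar>v x - w x\<bar>)) \<in> H1_0 \<Omega>"
    using assms by (intro H1_0_cmult H1_0_add H1_0_abs H1_0_diff)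
  ultimately show ?thesis by (simp only:)
qed

lemma H1_0_min:
  assumes "v \<in> H1_0 \<Omega>" "w \<in> H1_0 \<Omega>"
  shows "(\<lambda>x. min (v x) (w x)) \<in> H1_0 \<Omega>"
  using H1_0_minus[OF H1_0_max[OF H1_0_minus[OF assms(1)] H1_0_minus[OF assms(2)]]]
  by (simp add: minus_max_eq_min)

section \<open>The H1 norm and completeness\<close>

lemma graph_wgrad_eq: "sobolev_graph \<Omega> v g \<Longrightarrow> AE x in lebesgue_on \<Omega>. wgrad \<Omega> v x = g x"
  by (rule wgrad_eq[OF graph_weak_gradient])

lemma graph_H1_norm_sq: "sobolev_graph \<Omega> v g \<Longrightarrow> (H1_norm \<Omega> v)\<^sup>2 = (L2_norm \<Omega> v)\<^sup>2 + (L2_norm \<Omega> g)\<^sup>2"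
  by (rule H1_norm_sq[OF graph_weak_gradient])

lemma graph_H1_norm:
  assumes "sobolev_graph \<Omega> v g"
  shows "H1_norm \<Omega> v = L2_norm \<Omega> (\<lambda>x. (v x, g x))"
  using graph_H1_norm_sq[OF assms] L2_Pair(2)[OF graph_L2[OF assms]]
  by (metis H1_norm_nonneg L2_norm_nonneg power2_eq_iff_nonneg)

lemma H1_norm_triangle:
  assumes "v \<in> H1_0 \<Omega>" "w \<in> H1_0 \<Omega>"
  shows "H1_norm \<Omega> (\<lambda>x. v x + w x) \<le> H1_norm \<Omega> v + H1_norm \<Omega> w"
proof -
  note G = H1_0_graph[OF assms(1)] H1_0_graph[OF assms(2)]
  show ?thesis
    unfolding G[THEN graph_H1_norm] graph_H1_norm[OF graph_add[OF G]]
    using L2_norm_triangle[OF L2_Pair(1)[OF graph_L2[OF G(1)]] L2_Pair(1)[OF graph_L2[OF G(2)]]] by simp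
qed

lemma H1_norm_cmult:
  assumes "v \<in> H1_0 \<Omega>"
  shows "H1_norm \<Omega> (\<lambda>x. c * v x) = \<bar>c\<bar> * H1_norm \<Omega> v"
proof -
  note G = H1_0_graph[OF assms]
  show ?thesis
    unfolding graph_H1_norm[OF G] graph_H1_norm[OF graph_cmult[OF G]]
    using L2_scaleR(2)[OF L2_Pair(1)[OF graph_L2[OF G]], of c] by simp
qed

lemma H1_norm_minus: "v \<in> H1_0 \<Omega> \<Longrightarrow> H1_norm \<Omega> (\<lambda>x. - v x) = H1_norm \<Omega> v"
  using H1_norm_cmult[of v "-1"] by simp

lemma H1_norm_commute:
  assumes "v \<in> H1_0 \<Omega>" "w \<in> H1_0 \<Omega>"
  shows "H1_norm \<Omega> (\<lambda>x. v x - w x) = H1_norm \<Omega> (\<lambda>x. w x - v x)"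
  using H1_norm_minus[OF H1_0_diff[OF assms]] by simp

lemma H1_norm_triangle_diff:
  assumes "u \<in> H1_0 \<Omega>" "v \<in> H1_0 \<Omega>" "w \<in> H1_0 \<Omega>"
  shows "H1_norm \<Omega> (\<lambda>x. u x - w x) \<le> H1_norm \<Omega> (\<lambda>x. u x - v x) + H1_norm \<Omega> (\<lambda>x. v x - w x)"
  using H1_norm_triangle[OF H1_0_diff[OF assms(1,2)] H1_0_diff[OF assms(2,3)]] by simp

text \<open>The gradient is multiplied by a sign of modulus at most 1. The estimate allows
  competitors for the capacity to be taken nonnegative and controls the remainder when a negative
  part is truncated.\<close>

lemma H1_norm_abs:
  assumes "v \<in> H1_0 \<Omega>"
  shows "H1_norm \<Omega> (\<lambda>x. \<bar>v x\<bar>) \<le> H1_norm \<Omega> v"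
proof (rule power2_le_imp_le)
  note G = H1_0_graph[OF assms]
  note G' = graph_abs[OF G]
  have "L2_norm \<Omega> (\<lambda>x. \<bar>v x\<bar>) = L2_norm \<Omega> v" by (simp add: L2_norm_def)
  moreover have "L2_norm \<Omega> (\<lambda>x. sgn (v x) *\<^sub>R wgrad \<Omega> v x) \<le> L2_norm \<Omega> (wgrad \<Omega> v)"
    using L2_measurable[OF graph_L2(2)[OF G']]
    by (intro L2_norm_mono graph_L2(2)[OF G]) (auto simp: abs_sgn_eq)
  ultimately show "(H1_norm \<Omega> (\<lambda>x. \<bar>v x\<bar>))\<^sup>2 \<le> (H1_norm \<Omega> v)\<^sup>2"
    unfolding graph_H1_norm_sq[OF G] graph_H1_norm_sq[OF G'] by (simp add: power_mono)
qed simp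

text \<open>Functions and gradients converge separately in L2, and closedness of the graph matches
  the two limits. The constant 4 rounds up the factor \<open>2 sqrt 2\<close> from two errors of
  size \<open>2 * (1/2)^n\<close>.\<close>

lemma H1_0_complete:
  assumes v: "\<And>n. v n \<in> H1_0 \<Omega>"
    and le: "\<And>n. H1_norm \<Omega> (\<lambda>x. v (Suc n) x - v n x) \<le> (1/2)^n"
  obtains V where "V \<in> H1_0 \<Omega>" "\<And>n. H1_norm \<Omega> (\<lambda>x. v n x - V x) \<le> 4 * (1/2)^n"
proof -
  note G = H1_0_graph[OF v]
  have GD: "sobolev_graph \<Omega> (\<lambda>x. v m x - v n x) (\<lambda>x. wgrad \<Omega> (v m) x - wgrad \<Omega> (v n) x)" for m n
    using graph_add[OF G graph_cmult[OF G, of "-1"], of m n] by simp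
  have "L2_norm \<Omega> (\<lambda>x. v (Suc n) x - v n x) \<le> (1/2)^n" for n
    using L2_norm_le_H1_norm(1)[of "\<lambda>x. v (Suc n) x - v n x"] le[of n] by linarith
  then obtain V where V: "V \<in> L2 \<Omega>" "\<And>n. L2_norm \<Omega> (\<lambda>x. v n x - V x) \<le> 2 * (1/2)^n"
    using L2_complete[of v \<Omega>, OF graph_L2(1)[OF G]] by blast
  have "L2_norm \<Omega> (\<lambda>x. wgrad \<Omega> (v (Suc n)) x - wgrad \<Omega> (v n) x) \<le> (1/2)^n" for n
  proof -
    have "(L2_norm \<Omega> (\<lambda>x. wgrad \<Omega> (v (Suc n)) x - wgrad \<Omega> (v n) x))\<^sup>2 \<le> (H1_norm \<Omega> (\<lambda>x. v (Suc n) x - v n x))\<^sup>2"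
      unfolding graph_H1_norm_sq[OF GD] by simp
    then have "L2_norm \<Omega> (\<lambda>x. wgrad \<Omega> (v (Suc n)) x - wgrad \<Omega> (v n) x) \<le> H1_norm \<Omega> (\<lambda>x. v (Suc n) x - v n x)"
      by (rule power2_le_imp_le) simp
    then show ?thesis using le[of n] by linarith
  qed
  then obtain W where W: "W \<in> L2 \<Omega>" "\<And>n. L2_norm \<Omega> (\<lambda>x. wgrad \<Omega> (v n) x - W x) \<le> 2 * (1/2)^n"
    using L2_complete[of "\<lambda>n. wgrad \<Omega> (v n)" \<Omega>, OF graph_L2(2)[OF G]] by blast
  have p0: "(\<lambda>n. 2 * (1/2::real)^n) \<longlonglongrightarrow> 0"
    using tendsto_mult_left[OF LIMSEQ_power_zero[of "1/2::real"], of 2] by simp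
  have GV: "sobolev_graph \<Omega> V W"
  proof (rule graph_closed[OF G V(1) W(1)])
    show "(\<lambda>n. L2_norm \<Omega> (\<lambda>x. v n x - V x)) \<longlonglongrightarrow> 0"
      by (rule tendsto_sandwich[OF _ _ tendsto_const p0]) (use V(2) in auto)
    show "(\<lambda>n. L2_norm \<Omega> (\<lambda>x. wgrad \<Omega> (v n) x - W x)) \<longlonglongrightarrow> 0"
      by (rule tendsto_sandwich[OF _ _ tendsto_const p0]) (use W(2) in auto)
  qed
  have "H1_norm \<Omega> (\<lambda>x. v n x - V x) \<le> 4 * (1/2)^n" for n
  proof (rule power2_le_imp_le)
    have GD: "sobolev_graph \<Omega> (\<lambda>x. v n x - V x) (\<lambda>x. wgrad \<Omega> (v n) x - W x)"
      using graph_add[OF G graph_cmult[OF GV, of "-1"], of n] by simp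
    have "(L2_norm \<Omega> (\<lambda>x. v n x - V x))\<^sup>2 \<le> (2 * (1/2)^n)\<^sup>2"
      "(L2_norm \<Omega> (\<lambda>x. wgrad \<Omega> (v n) x - W x))\<^sup>2 \<le> (2 * (1/2)^n)\<^sup>2"
      by (intro power_mono V(2) W(2) L2_norm_nonneg)+
    then have "(H1_norm \<Omega> (\<lambda>x. v n x - V x))\<^sup>2 \<le> 2 * (2 * (1/2)^n)\<^sup>2"
      unfolding graph_H1_norm_sq[OF GD] by linarith
    also have "\<dots> \<le> (4 * (1/2)^n)\<^sup>2" by (simp add: power_mult_distrib)
    finally show "(H1_norm \<Omega> (\<lambda>x. v n x - V x))\<^sup>2 \<le> (4 * (1/2)^n)\<^sup>2" .
  qed simp
  then show ?thesis using that graph_H1_0[OF GV] by blast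
qed

section \<open>The Dirichlet form, the Poincare inequality and the first eigenvalue\<close>

lemma dirichlet_form_graph:
  assumes "sobolev_graph \<Omega> v g" "sobolev_graph \<Omega> w h"
  shows "dirichlet_form \<Omega> v w = (\<integral>x. g x \<bullet> h x \<partial>lebesgue_on \<Omega>)"
  unfolding dirichlet_form_def
proof (rule integral_cong_AE)
  have [measurable]: "wgrad \<Omega> v \<in> borel_measurable (lebesgue_on \<Omega>)" "wgrad \<Omega> w \<in> borel_measurable (lebesgue_on \<Omega>)"
    "g \<in> borel_measurable (lebesgue_on \<Omega>)" "h \<in> borel_measurable (lebesgue_on \<Omega>)"
    using assms graph_L2 H1_0_wgrad_L2 graph_H1_0 L2_measurable by blast+
  show "(\<lambda>x. wgrad \<Omega> v x \<bullet> wgrad \<Omega> w x) \<in> borel_measurable (lebesgue_on \<Omega>)"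
    "(\<lambda>x. g x \<bullet> h x) \<in> borel_measurable (lebesgue_on \<Omega>)" by measurable
  show "AE x in lebesgue_on \<Omega>. wgrad \<Omega> v x \<bullet> wgrad \<Omega> w x = g x \<bullet> h x"
    using graph_wgrad_eq[OF assms(1)] graph_wgrad_eq[OF assms(2)] by eventually_elim simp
qed

lemma dirichlet_form_commute: "dirichlet_form \<Omega> v w = dirichlet_form \<Omega> w v"
  by (simp add: dirichlet_form_def inner_commute)

lemma dirichlet_form_add:
  assumes "u \<in> H1_0 \<Omega>" "v \<in> H1_0 \<Omega>" "w \<in> H1_0 \<Omega>"
  shows "dirichlet_form \<Omega> u (\<lambda>x. v x + w x) = dirichlet_form \<Omega> u v + dirichlet_form \<Omega> u w"
proof -
  note G = assms[THEN H1_0_graph]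
  note L = G[THEN graph_L2(2)]
  show ?thesis
    unfolding dirichlet_form_graph[OF G(1) graph_add[OF G(2,3)]] dirichlet_form_def[of _ u v] dirichlet_form_def[of _ u w]
    by (simp add: inner_add_right L2_inner_integrable[OF L(1,2)] L2_inner_integrable[OF L(1,3)])
qed

lemma dirichlet_form_cmult:
  assumes "u \<in> H1_0 \<Omega>" "v \<in> H1_0 \<Omega>"
  shows "dirichlet_form \<Omega> u (\<lambda>x. c * v x) = c * dirichlet_form \<Omega> u v"
proof -
  note G = assms[THEN H1_0_graph]
  show ?thesis
    unfolding dirichlet_form_graph[OF G(1) graph_cmult[OF G(2)]] dirichlet_form_def[of _ u v] by simp
qed

lemma dirichlet_form_diff:
  assumes "u \<in> H1_0 \<Omega>" "v \<in> H1_0 \<Omega>" "w \<in> H1_0 \<Omega>"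
  shows "dirichlet_form \<Omega> u (\<lambda>x. v x - w x) = dirichlet_form \<Omega> u v - dirichlet_form \<Omega> u w"
  using dirichlet_form_add[OF assms(1,2) H1_0_cmult[OF assms(3), of "-1"]]
    dirichlet_form_cmult[OF assms(1,3), of "-1"] by simp

lemma dirichlet_form_self: "dirichlet_form \<Omega> v v = (L2_norm \<Omega> (wgrad \<Omega> v))\<^sup>2"
  by (simp add: dirichlet_form_def L2_norm_sq power2_norm_eq_inner)

lemma dirichlet_form_nonneg [simp]: "dirichlet_form \<Omega> v v \<ge> 0"
  by (simp add: dirichlet_form_self)

text \<open>For a test function \<open>\<phi>\<close>, integrate \<open>\<partial>\<^sub>i (x\<^sub>i \<phi>\<^sup>2) = \<phi>\<^sup>2 + 2 x\<^sub>i \<phi> \<partial>\<^sub>i \<phi>\<close>.\<close>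

lemma Poincare:
  obtains C where "C > 0" "\<And>v. v \<in> H1_0 \<Omega> \<Longrightarrow> (L2_norm \<Omega> v)\<^sup>2 \<le> C\<^sup>2 * dirichlet_form \<Omega> v v"
proof -
  obtain R where R: "R > 0" "\<And>x. x \<in> \<Omega> \<Longrightarrow> norm x \<le> R"
    using bounded_\<Omega> by (auto simp: bounded_pos)
  obtain i :: 'a where i: "i \<in> Basis" using nonempty_Basis by blast
  have test: "L2_norm \<Omega> \<phi> \<le> 2 * R * L2_norm \<Omega> (grad \<phi>)" if \<phi>: "\<phi> \<in> test_functions \<Omega>" for \<phi>
  proof -
    have \<phi>2: "(\<lambda>x. \<phi> x * \<phi> x) \<in> test_functions \<Omega>" by (rule test_mult_smooth[OF \<phi> test_C_k[OF \<phi>]])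
    have \<theta>: "(\<lambda>x. (x \<bullet> i) * (\<phi> x * \<phi> x)) \<in> test_functions \<Omega>" by (rule test_mult_smooth[OF \<phi>2 C_k_inner])
    have "frechet_derivative (\<lambda>x. (x \<bullet> i) * (\<phi> x * \<phi> x)) (at x) i =
        \<phi> x * \<phi> x + 2 * ((x \<bullet> i) * (\<phi> x * (grad \<phi> x \<bullet> i)))" for x
    proof -
      have "((\<lambda>x. (x \<bullet> i) * (\<phi> x * \<phi> x)) has_derivative
        (\<lambda>h. (x \<bullet> i) * (\<phi> x * (grad \<phi> x \<bullet> h) + (grad \<phi> x \<bullet> h) * \<phi> x) + (h \<bullet> i) * (\<phi> x * \<phi> x))) (at x)"
        by (intro has_derivative_mult test_has_derivative_grad[OF \<phi>] has_derivative_inner_left has_derivative_ident)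
      from frechet_derivative_eq[OF this, of i] show ?thesis using i by (simp add: algebra_simps)
    qed
    then have z: "(\<integral>x. \<phi> x * \<phi> x + 2 * ((x \<bullet> i) * (\<phi> x * (grad \<phi> x \<bullet> i))) \<partial>lebesgue_on \<Omega>) = 0"
      using integral_partial_zero[OF \<theta> i] by simp
    have x\<phi>: "(\<lambda>x. (x \<bullet> i) * \<phi> x) \<in> L2 \<Omega>"
      by (rule L2_test[OF test_mult_smooth[OF \<phi> C_k_inner]])
    have gi: "(\<lambda>x. grad \<phi> x \<bullet> i) \<in> L2 \<Omega>" by (rule L2_inner_Basis[OF L2_grad[OF \<phi>] i])
    have nx: "L2_norm \<Omega> (\<lambda>x. (x \<bullet> i) * \<phi> x) \<le> R * L2_norm \<Omega> \<phi>"
    proof (rule L2_bound(2)[OF L2_measurable[OF x\<phi>] L2_test[OF \<phi>]])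
      show "AE x in lebesgue_on \<Omega>. norm ((x \<bullet> i) * \<phi> x) \<le> R * norm (\<phi> x)"
      proof (intro AE_I2)
        fix x assume "x \<in> space (lebesgue_on \<Omega>)"
        then have "\<bar>x \<bullet> i\<bar> \<le> R" using R(2)[of x] Basis_le_norm[OF i, of x] by simp
        then show "norm ((x \<bullet> i) * \<phi> x) \<le> R * norm (\<phi> x)" by (simp add: abs_mult mult_right_mono)
      qed
    qed (use R in simp)
    have ng: "L2_norm \<Omega> (\<lambda>x. grad \<phi> x \<bullet> i) \<le> L2_norm \<Omega> (grad \<phi>)"
      using i by (intro L2_norm_mono L2_grad \<phi> L2_measurable[OF gi] AE_I2) (auto simp: Basis_le_norm)
    have "(L2_norm \<Omega> \<phi>)\<^sup>2 = (\<integral>x. \<phi> x * \<phi> x \<partial>lebesgue_on \<Omega>)"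
      unfolding L2_norm_sq_real by (simp add: power2_eq_square)
    also have "\<dots> = - 2 * (\<integral>x. ((x \<bullet> i) * \<phi> x) * (grad \<phi> x \<bullet> i) \<partial>lebesgue_on \<Omega>)"
      using z L2_mult_integrable[OF L2_test[OF \<phi>] L2_test[OF \<phi>]] L2_mult_integrable[OF x\<phi> gi]
      by (simp add: mult.assoc)
    also have "\<dots> \<le> 2 * (L2_norm \<Omega> (\<lambda>x. (x \<bullet> i) * \<phi> x) * L2_norm \<Omega> (\<lambda>x. grad \<phi> x \<bullet> i))"
      using L2_Cauchy_Schwarz_real[OF x\<phi> gi] by linarith
    also have "\<dots> \<le> 2 * (R * L2_norm \<Omega> \<phi> * L2_norm \<Omega> (grad \<phi>))"
      using nx ng R(1) by (intro mult_left_mono mult_mono) auto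
    finally have "L2_norm \<Omega> \<phi> * L2_norm \<Omega> \<phi> \<le> (2 * R * L2_norm \<Omega> (grad \<phi>)) * L2_norm \<Omega> \<phi>"
      by (simp add: power2_eq_square algebra_simps)
    then show ?thesis
      using R(1) L2_norm_nonneg[of \<Omega> \<phi>] L2_norm_nonneg[of \<Omega> "grad \<phi>"]
      by (cases "L2_norm \<Omega> \<phi> = 0") (auto simp: mult_le_cancel_right)
  qed
  \<comment> \<open>Both norms are continuous along the approximation by test functions, so the
    estimate extends by density.\<close>
  have "(L2_norm \<Omega> v)\<^sup>2 \<le> (2 * R)\<^sup>2 * dirichlet_form \<Omega> v v" if v: "v \<in> H1_0 \<Omega>" for v
  proof -
    note G = H1_0_graph[OF v]
    obtain \<phi> where \<phi>: "\<And>n. \<phi> n \<in> test_functions \<Omega>"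
      "(\<lambda>n. L2_norm \<Omega> (\<lambda>x. \<phi> n x - v x)) \<longlonglongrightarrow> 0" "(\<lambda>n. L2_norm \<Omega> (\<lambda>x. grad (\<phi> n) x - wgrad \<Omega> v x)) \<longlonglongrightarrow> 0"
      using graph_approx[OF G] by blast
    have "L2_norm \<Omega> v \<le> L2_norm \<Omega> (\<lambda>x. \<phi> n x - v x) +
        2 * R * (L2_norm \<Omega> (\<lambda>x. grad (\<phi> n) x - wgrad \<Omega> v x) + L2_norm \<Omega> (wgrad \<Omega> v))" for n
    proof -
      have "L2_norm \<Omega> v \<le> L2_norm \<Omega> (\<lambda>x. \<phi> n x - v x) + L2_norm \<Omega> (\<phi> n)"
        using L2_norm_triangle_diff[OF graph_L2(1)[OF G] L2_test[OF \<phi>(1)] L2_zero, of n]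
        by (simp add: L2_norm_commute)
      also have "\<dots> \<le> L2_norm \<Omega> (\<lambda>x. \<phi> n x - v x) + 2 * R * L2_norm \<Omega> (grad (\<phi> n))"
        using test[OF \<phi>(1)] by simp
      also have "L2_norm \<Omega> (grad (\<phi> n)) \<le> L2_norm \<Omega> (\<lambda>x. grad (\<phi> n) x - wgrad \<Omega> v x) + L2_norm \<Omega> (wgrad \<Omega> v)"
        using L2_norm_triangle_diff[OF L2_grad[OF \<phi>(1)] graph_L2(2)[OF G] L2_zero, of n] by simp
      finally show ?thesis using R(1) by (simp add: mult_left_mono)
    qed
    moreover have "(\<lambda>n. L2_norm \<Omega> (\<lambda>x. \<phi> n x - v x) +
        2 * R * (L2_norm \<Omega> (\<lambda>x. grad (\<phi> n) x - wgrad \<Omega> v x) + L2_norm \<Omega> (wgrad \<Omega> v)))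
        \<longlonglongrightarrow> 0 + 2 * R * (0 + L2_norm \<Omega> (wgrad \<Omega> v))"
      by (intro tendsto_intros \<phi>)
    ultimately have "L2_norm \<Omega> v \<le> 2 * R * L2_norm \<Omega> (wgrad \<Omega> v)"
      using LIMSEQ_le_const[of _ _ "L2_norm \<Omega> v"] by fastforce
    then have "(L2_norm \<Omega> v)\<^sup>2 \<le> (2 * R * L2_norm \<Omega> (wgrad \<Omega> v))\<^sup>2"
      by (intro power_mono) auto
    then show ?thesis by (simp add: power_mult_distrib dirichlet_form_self)
  qed
  then show ?thesis using that[of "2 * R"] R(1) by simp
qed

text \<open>Rayleigh quotients are nonnegative, so their infimum is a genuine lower bound. Functions
  vanishing almost everywhere are excluded from the quotients and are treated apart.\<close>

lemma lambda1_le: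
  assumes "v \<in> H1_0 \<Omega>"
  shows "lambda1 \<Omega> * (L2_norm \<Omega> v)\<^sup>2 \<le> dirichlet_form \<Omega> v v"
proof (cases "AE x in lebesgue_on \<Omega>. v x = 0")
  case True
  then have "L2_norm \<Omega> v = 0" using L2_norm_eq_0_iff[OF H1_0_L2[OF assms]] by simp
  then show ?thesis by simp
next
  case False
  then have p: "(L2_norm \<Omega> v)\<^sup>2 > 0"
    using L2_norm_eq_0_iff[OF H1_0_L2[OF assms]] by simp
  have "lambda1 \<Omega> \<le> dirichlet_form \<Omega> v v / (\<integral>x. (v x)\<^sup>2 \<partial>lebesgue_on \<Omega>)"
    unfolding lambda1_def
  proof (rule cInf_lower)
    show "bdd_below {dirichlet_form \<Omega> \<phi> \<phi> / (\<integral>x. (\<phi> x)\<^sup>2 \<partial>lebesgue_on \<Omega>) |\<phi>.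
      \<phi> \<in> H1_0 \<Omega> \<and> \<not> (AE x in lebesgue_on \<Omega>. \<phi> x = 0)}"
      by (rule bdd_belowI[of _ 0]) (auto intro!: divide_nonneg_nonneg)
  qed (use assms False in blast)
  then show ?thesis using p by (simp add: L2_norm_sq_real pos_le_divide_eq)
qed

subsection \<open>Capacity and quasi-continuous representatives\<close>

lemma capacity_le:
  assumes "v \<in> H1_0 \<Omega>" "open U" "A \<subseteq> U" "AE x in lebesgue_on \<Omega>. x \<in> U \<longrightarrow> v x \<ge> 1"
  shows "capacity \<Omega> A \<le> ennreal ((H1_norm \<Omega> v)\<^sup>2)"
  unfolding capacity_def by (rule Inf_lower) (use assms in blast)

text \<open>A near-optimal competitor is made nonnegative by its absolute value. Sums of such
  functions then remain at least 1 on the union of the corresponding open sets.\<close>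

lemma capacity_lessE:
  assumes "capacity \<Omega> A < ennreal e"
  obtains v U where "v \<in> H1_0 \<Omega>" "open U" "A \<subseteq> U" "AE x in lebesgue_on \<Omega>. x \<in> U \<longrightarrow> v x \<ge> 1"
    "\<And>x. v x \<ge> 0" "(H1_norm \<Omega> v)\<^sup>2 < e"
proof -
  obtain v U where v: "v \<in> H1_0 \<Omega>" "open U" "A \<subseteq> U" "AE x in lebesgue_on \<Omega>. x \<in> U \<longrightarrow> v x \<ge> 1"
    "ennreal ((H1_norm \<Omega> v)\<^sup>2) < ennreal e"
    using assms unfolding capacity_def Inf_less_iff by blast
  have "AE x in lebesgue_on \<Omega>. x \<in> U \<longrightarrow> \<bar>v x\<bar> \<ge> 1"
    using v(4) by eventually_elim auto
  moreover have "(H1_norm \<Omega> (\<lambda>x. \<bar>v x\<bar>))\<^sup>2 < e"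
  proof (rule order_le_less_trans)
    show "(H1_norm \<Omega> (\<lambda>x. \<bar>v x\<bar>))\<^sup>2 \<le> (H1_norm \<Omega> v)\<^sup>2"
      using H1_norm_abs[OF v(1)] by (intro power_mono) auto
    show "(H1_norm \<Omega> v)\<^sup>2 < e" using v(5) by (simp add: ennreal_less_iff)
  qed
  ultimately show ?thesis
    using that[OF H1_0_abs[OF v(1)] v(2,3)] by simp
qed

lemma capacity_mono: "A \<subseteq> B \<Longrightarrow> capacity \<Omega> A \<le> capacity \<Omega> B"
  unfolding capacity_def by (rule Inf_superset_mono) blast

text \<open>The sum of two competitors is a competitor for the union, and
  \<open>(a + b)^2 \<le> 2 a^2 + 2 b^2\<close> costs the factor 4. The loss is harmless wherever the
  two capacities can be made arbitrarily small.\<close>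

lemma capacity_Un:
  assumes "capacity \<Omega> A < ennreal e" "capacity \<Omega> B < ennreal e"
  shows "capacity \<Omega> (A \<union> B) \<le> ennreal (4 * e)"
proof -
  obtain v U where v: "v \<in> H1_0 \<Omega>" "open U" "A \<subseteq> U" "AE x in lebesgue_on \<Omega>. x \<in> U \<longrightarrow> v x \<ge> 1"
    "\<And>x. v x \<ge> 0" "(H1_norm \<Omega> v)\<^sup>2 < e"
    using capacity_lessE[OF assms(1)] by blast
  obtain w V where w: "w \<in> H1_0 \<Omega>" "open V" "B \<subseteq> V" "AE x in lebesgue_on \<Omega>. x \<in> V \<longrightarrow> w x \<ge> 1"
    "\<And>x. w x \<ge> 0" "(H1_norm \<Omega> w)\<^sup>2 < e"
    using capacity_lessE[OF assms(2)] by blast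
  have "capacity \<Omega> (A \<union> B) \<le> ennreal ((H1_norm \<Omega> (\<lambda>x. v x + w x))\<^sup>2)"
  proof (rule capacity_le[OF H1_0_add[OF v(1) w(1)] open_Un[OF v(2) w(2)]])
    show "A \<union> B \<subseteq> U \<union> V" using v w by blast
    show "AE x in lebesgue_on \<Omega>. x \<in> U \<union> V \<longrightarrow> v x + w x \<ge> 1"
      using v(4) w(4)
    proof eventually_elim
      case (elim x)
      then show ?case using v(5)[of x] w(5)[of x] by auto
    qed
  qed
  also have "(H1_norm \<Omega> (\<lambda>x. v x + w x))\<^sup>2 \<le> 4 * e"
  proof -
    have "(H1_norm \<Omega> (\<lambda>x. v x + w x))\<^sup>2 \<le> (H1_norm \<Omega> v + H1_norm \<Omega> w)\<^sup>2"
      by (intro power_mono H1_norm_triangle v w) simp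
    also have "\<dots> \<le> 2 * (H1_norm \<Omega> v)\<^sup>2 + 2 * (H1_norm \<Omega> w)\<^sup>2"
      using sum_squares_bound[of "H1_norm \<Omega> v" "H1_norm \<Omega> w"] by (simp add: power2_sum)
    finally show ?thesis using v(6) w(6) by simp
  qed
  finally show ?thesis by (simp add: ennreal_leI)
qed

text \<open>The majorant is the sum of the series. It takes the role of countable subadditivity of
  the capacity: one function of controlled norm serves as competitor for infinitely many exceptional
  sets at once. The scaling by \<open>1/c\<close> normalises the increments for
  \<open>H1_0_complete\<close>.\<close>

lemma H1_0_series_majorant:
  assumes v: "\<And>n. v n \<in> H1_0 \<Omega>" "\<And>n x. v n x \<ge> 0" "\<And>n. H1_norm \<Omega> (v n) \<le> c * (1/2)^n" and c: "c > 0"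
  obtains V where "V \<in> H1_0 \<Omega>" "H1_norm \<Omega> V \<le> 4 * c" "\<And>n. AE x in lebesgue_on \<Omega>. v n x \<le> V x"
proof -
  define S where "S N x = (\<Sum>n<N. (1/c) * v n x)" for N x
  have vc: "(\<lambda>x. (1/c) * v n x) \<in> H1_0 \<Omega>" for n by (rule H1_0_cmult[OF v(1)])
  have S: "S N \<in> H1_0 \<Omega>" for N unfolding S_def by (intro H1_0_sum vc) simp
  have "H1_norm \<Omega> (\<lambda>x. S (Suc n) x - S n x) \<le> (1/2)^n" for n
  proof -
    have "H1_norm \<Omega> (\<lambda>x. S (Suc n) x - S n x) = (1/c) * H1_norm \<Omega> (v n)"
      using H1_norm_cmult[OF v(1), of "1/c" n] c by (simp add: S_def)
    also have "\<dots> \<le> (1/c) * (c * (1/2)^n)"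
      using v(3)[of n] c by (intro mult_left_mono) auto
    finally show ?thesis using c by simp
  qed
  then obtain V where V: "V \<in> H1_0 \<Omega>" "\<And>n. H1_norm \<Omega> (\<lambda>x. S n x - V x) \<le> 4 * (1/2)^n"
    using H1_0_complete[of S, OF S] by blast
  have lim: "(\<lambda>n. L2_norm \<Omega> (\<lambda>x. S n x - V x)) \<longlonglongrightarrow> 0"
  proof (rule tendsto_sandwich[OF _ _ tendsto_const])
    show "(\<lambda>n. 4 * (1/2::real)^n) \<longlonglongrightarrow> 0"
      using tendsto_mult_left[OF LIMSEQ_power_zero[of "1/2::real"], of 4] by simp
    show "eventually (\<lambda>n. L2_norm \<Omega> (\<lambda>x. S n x - V x) \<le> 4 * (1/2)^n) sequentially"
      using V(2) L2_norm_le_H1_norm(1) by (intro always_eventually allI) (meson order_trans)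
  qed simp
  show ?thesis
  proof (rule that[of "\<lambda>x. c * V x"])
    show "(\<lambda>x. c * V x) \<in> H1_0 \<Omega>" by (rule H1_0_cmult[OF V(1)])
    have "H1_norm \<Omega> V \<le> 4"
      using V(2)[of 0] H1_norm_minus[OF V(1)] by (simp add: S_def)
    then show "H1_norm \<Omega> (\<lambda>x. c * V x) \<le> 4 * c"
      using H1_norm_cmult[OF V(1), of c] c by simp
    fix n
    have "AE x in lebesgue_on \<Omega>. True \<longrightarrow> (1/c) * v n x \<le> V x"
    proof (rule L2_limit_ge[OF H1_0_L2[OF S] H1_0_L2[OF V(1)] lim])
      fix N assume "N \<ge> Suc n"
      then have "(1/c) * v n x \<le> S N x" for x
        unfolding S_def using v(2) c by (intro member_le_sum) auto
      then show "AE x in lebesgue_on \<Omega>. True \<longrightarrow> (1/c) * v n x \<le> S N x" by simp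
    qed
    then show "AE x in lebesgue_on \<Omega>. v n x \<le> c * V x"
      by eventually_elim (use c in \<open>simp add: field_simps\<close>)
  qed
qed

lemma quasi_continuous_linear:
  assumes "quasi_continuous \<Omega> v" "quasi_continuous \<Omega> w"
  shows "quasi_continuous \<Omega> (\<lambda>x. a * v x + b * w x)"
  unfolding quasi_continuous_def
proof (intro allI impI)
  fix e :: real assume e: "e > 0"
  \<comment> \<open>The union of two such sets has capacity at most \<open>4 * (e/8)\<close>,
    strictly below \<open>e\<close>.\<close>
  obtain G where G: "open G" "G \<subseteq> \<Omega>" "capacity \<Omega> G < ennreal (e/8)" "continuous_on (\<Omega> - G) v"
    using assms(1) e unfolding quasi_continuous_def by (meson divide_pos_pos zero_less_numeral)
  obtain H where H: "open H" "H \<subseteq> \<Omega>" "capacity \<Omega> H < ennreal (e/8)" "continuous_on (\<Omega> - H) w"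
    using assms(2) e unfolding quasi_continuous_def by (meson divide_pos_pos zero_less_numeral)
  have "capacity \<Omega> (G \<union> H) \<le> ennreal (4 * (e/8))" by (rule capacity_Un[OF G(3) H(3)])
  also have "\<dots> < ennreal e" using e by (simp add: ennreal_less_iff)
  finally have "capacity \<Omega> (G \<union> H) < ennreal e" .
  moreover have "continuous_on (\<Omega> - (G \<union> H)) (\<lambda>x. a * v x + b * w x)"
    by (intro continuous_intros continuous_on_subset[OF G(4)] continuous_on_subset[OF H(4)]) auto
  ultimately show "\<exists>G. open G \<and> G \<subseteq> \<Omega> \<and> capacity \<Omega> G < ennreal e \<and>
      continuous_on (\<Omega> - G) (\<lambda>x. a * v x + b * w x)"
    using G H by (intro exI[of _ "G \<union> H"]) auto
qed

text \<open>A rapidly converging sequence of test functions converges uniformly off open sets of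
  arbitrarily small capacity, because the places where consecutive members differ too much are
  controlled by their H1 distance.\<close>

lemma ex_quasi_continuous:
  assumes v: "v \<in> H1_0 \<Omega>"
  shows "\<exists>w. quasi_continuous \<Omega> w \<and> (AE x in lebesgue_on \<Omega>. w x = v x)"
proof -
  let ?M = "lebesgue_on \<Omega>"
  obtain \<sigma> where \<sigma>: "\<And>n. \<sigma> n \<in> test_functions \<Omega>" "(\<lambda>n. H1_norm \<Omega> (\<lambda>x. \<sigma> n x - v x)) \<longlonglongrightarrow> 0"
    using v by (auto simp: H1_0_def)
  \<comment> \<open>The rate \<open>(1/4)^n\<close> leaves \<open>(1/2)^n\<close> after the
    increments are magnified by \<open>2^n\<close>; the half lets two errors add up to at most
    \<open>(1/4)^n\<close>.\<close>
  have "\<exists>\<phi>\<in>test_functions \<Omega>. H1_norm \<Omega> (\<lambda>x. \<phi> x - v x) < (1/4)^n / 2" for n :: nat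
  proof -
    have "eventually (\<lambda>m. H1_norm \<Omega> (\<lambda>x. \<sigma> m x - v x) < (1/4)^n / 2) sequentially"
      by (rule order_tendstoD(2)[OF \<sigma>(2)]) simp
    then show ?thesis using \<sigma>(1) by (auto simp: eventually_sequentially)
  qed
  then obtain \<theta> where \<theta>: "\<And>n. \<theta> n \<in> test_functions \<Omega>" "\<And>n. H1_norm \<Omega> (\<lambda>x. \<theta> n x - v x) < (1/4)^n / 2"
    by metis
  have "(\<lambda>n. L2_norm \<Omega> (\<lambda>x. \<theta> n x - v x)) \<longlonglongrightarrow> 0"
  proof (rule tendsto_sandwich[OF _ _ tendsto_const])
    show "(\<lambda>n. (1/4::real)^n / 2) \<longlonglongrightarrow> 0"
      using tendsto_divide[OF LIMSEQ_power_zero[of "1/4::real"] tendsto_const[of 2]] by simp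
    show "eventually (\<lambda>n. L2_norm \<Omega> (\<lambda>x. \<theta> n x - v x) \<le> (1/4)^n / 2) sequentially"
      using \<theta>(2) L2_norm_le_H1_norm(1)
      by (intro always_eventually allI) (meson less_imp_le order_trans)
  qed simp
  then obtain r :: "nat \<Rightarrow> nat" where r: "strict_mono r" "AE x in ?M. (\<lambda>n. \<theta> (r n) x) \<longlonglongrightarrow> v x"
    using L2_AE_subseq[of \<theta> \<Omega> v, OF L2_test[OF \<theta>(1)] H1_0_L2[OF v]] by blast
  define \<phi> where "\<phi> n = \<theta> (r n)" for n
  have \<phi>: "\<phi> n \<in> test_functions \<Omega>" for n using \<theta> by (simp add: \<phi>_def)
  have \<phi>v: "H1_norm \<Omega> (\<lambda>x. \<phi> n x - v x) \<le> (1/4)^n / 2" for n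
  proof -
    have "H1_norm \<Omega> (\<lambda>x. \<phi> n x - v x) \<le> (1/4)^(r n) / 2"
      unfolding \<phi>_def by (rule less_imp_le[OF \<theta>(2)])
    also have "(1/4::real)^(r n) \<le> (1/4)^n"
      by (intro power_decreasing seq_suble[OF r(1)]) auto
    finally show ?thesis by simp
  qed
  define d where "d n x = \<phi> (Suc n) x - \<phi> n x" for n x
  have d: "d n \<in> test_functions \<Omega>" for n unfolding d_def by (intro test_diff \<phi>)
  have dn: "H1_norm \<Omega> (d n) \<le> (1/4)^n" for n
  proof -
    have "H1_norm \<Omega> (d n) \<le> H1_norm \<Omega> (\<lambda>x. \<phi> (Suc n) x - v x) + H1_norm \<Omega> (\<lambda>x. v x - \<phi> n x)"
      unfolding d_def by (intro H1_norm_triangle_diff H1_0_test \<phi> v)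
    also have "\<dots> \<le> (1/4)^Suc n / 2 + (1/4)^n / 2"
      using \<phi>v[of "Suc n"] \<phi>v[of n] H1_norm_commute[OF v H1_0_test[OF \<phi>], of n] by simp
    also have "\<dots> \<le> (1/4)^n" by simp
    finally show ?thesis .
  qed
  \<comment> \<open>Off \<open>U n\<close> the increment is at most \<open>(1/2)^n\<close>, which is
    summable; on \<open>U n\<close> the magnified increment \<open>2^n * \<bar>d n x\<bar>\<close>
    exceeds 1 and serves as competitor for the capacity.\<close>
  define U where "U n = {x. 2^n * \<bar>d n x\<bar> > 1}" for n
  have U: "open (U n)" for n
    unfolding U_def by (intro open_Collect_less continuous_intros test_continuous[OF d])
  have U\<Omega>: "U n \<subseteq> \<Omega>" for n
  proof
    fix x assume "x \<in> U n"
    then have "d n x \<noteq> 0" by (auto simp: U_def)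
    then show "x \<in> \<Omega>" using test_functionsE[OF d] by (metis subsetD)
  qed
  have cap: "capacity \<Omega> (\<Union>n. U (m + n)) \<le> ennreal ((4 * (1/2)^m)\<^sup>2)" for m
  proof -
    have 2: "H1_norm \<Omega> (\<lambda>x. 2^n * \<bar>d n x\<bar>) \<le> (1/2)^n" for n
    proof -
      have "H1_norm \<Omega> (\<lambda>x. 2^n * \<bar>d n x\<bar>) = 2^n * H1_norm \<Omega> (\<lambda>x. \<bar>d n x\<bar>)"
        using H1_norm_cmult[OF H1_0_abs[OF H1_0_test[OF d]], of "2^n" n] by simp
      also have "\<dots> \<le> 2^n * (1/4)^n"
        using H1_norm_abs[OF H1_0_test[OF d], of n] dn[of n] by (intro mult_left_mono) auto
      also have "\<dots> = (1/2::real)^n" by (simp add: power_mult_distrib[symmetric])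
      finally show ?thesis .
    qed
    obtain V where V: "V \<in> H1_0 \<Omega>" "H1_norm \<Omega> V \<le> 4 * (1/2)^m"
      "\<And>n. AE x in ?M. 2^(m+n) * \<bar>d (m+n) x\<bar> \<le> V x"
    proof (rule H1_0_series_majorant[of "\<lambda>n x. 2^(m+n) * \<bar>d (m+n) x\<bar>" "(1/2)^m"])
      show "(\<lambda>x. 2^(m+n) * \<bar>d (m+n) x\<bar>) \<in> H1_0 \<Omega>" for n
        by (intro H1_0_cmult H1_0_abs H1_0_test d)
      show "H1_norm \<Omega> (\<lambda>x. 2^(m+n) * \<bar>d (m+n) x\<bar>) \<le> (1/2)^m * (1/2)^n" for n
        using 2[of "m+n"] by (simp only: power_add)
    qed auto
    have "capacity \<Omega> (\<Union>n. U (m + n)) \<le> ennreal ((H1_norm \<Omega> V)\<^sup>2)"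
    proof (rule capacity_le[OF V(1) _ subset_refl])
      show "open (\<Union>n. U (m + n))" using U by blast
      have "AE x in ?M. \<forall>n. 2^(m+n) * \<bar>d (m+n) x\<bar> \<le> V x"
        using V(3) by (simp add: AE_all_countable)
      then show "AE x in ?M. x \<in> (\<Union>n. U (m + n)) \<longrightarrow> 1 \<le> V x"

      proof eventually_elim
        case (elim x)
        show ?case
        proof
          assume "x \<in> (\<Union>n. U (m + n))"
          then obtain n where "1 < 2^(m+n) * \<bar>d (m+n) x\<bar>" by (auto simp: U_def)
          then show "1 \<le> V x" using elim[rule_format, of n] by linarith
        qed
      qed
    qed
    also have "(H1_norm \<Omega> V)\<^sup>2 \<le> (4 * (1/2)^m)\<^sup>2"
      using V(2) by (intro power_mono) auto
    finally show ?thesis by (simp add: ennreal_leI)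
  qed
  \<comment> \<open>Where the series diverges the value is meaningless. This does not affect
    continuity, since the series converges uniformly off each exceptional set below.\<close>
  define w where "w x = \<phi> 0 x + (\<Sum>i. d i x)" for x
  have sumd: "(\<Sum>i<n. d i x) = \<phi> n x - \<phi> 0 x" for n x
    unfolding d_def using sum_lessThan_telescope[of "\<lambda>n. \<phi> n x"] by simp
  have "AE x in ?M. w x = v x"
    using r(2)
  proof eventually_elim
    case (elim x)
    then have "(\<lambda>n. \<Sum>i<n. d i x) \<longlonglongrightarrow> v x - \<phi> 0 x"
      unfolding sumd \<phi>_def by (intro tendsto_diff tendsto_const)
    then have "(\<Sum>i. d i x) = v x - \<phi> 0 x"
      using sums_unique[of "\<lambda>i. d i x"] by (simp add: sums_def)
    then show ?case by (simp add: w_def)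
  qed
  moreover have "quasi_continuous \<Omega> w"
    unfolding quasi_continuous_def
  proof (intro allI impI)
    fix e :: real assume e: "e > 0"
    have "(\<lambda>m. (4 * (1/2::real)^m)\<^sup>2) \<longlonglongrightarrow> (4 * 0)\<^sup>2"
      by (intro tendsto_intros LIMSEQ_power_zero) simp
    then have "eventually (\<lambda>m. (4 * (1/2::real)^m)\<^sup>2 < e) sequentially"
      using e by (intro order_tendstoD(2)) auto
    then obtain m where m: "(4 * (1/2::real)^m)\<^sup>2 < e" by (auto simp: eventually_sequentially)
    let ?G = "\<Union>n. U (m + n)"
    have "capacity \<Omega> ?G < ennreal e"
      using order_le_less_trans[OF cap] m by (simp add: ennreal_less_iff)
    moreover have "continuous_on (\<Omega> - ?G) w"
    proof -
      have "uniform_limit (\<Omega> - ?G) (\<lambda>n x. \<Sum>i<n. d i x) (\<lambda>x. \<Sum>i. d i x) sequentially"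
      proof (rule Weierstrass_m_test_ev)
        show "summable (\<lambda>n. (1/2::real)^n)" by (intro summable_geometric) simp
        show "eventually (\<lambda>n. \<forall>x\<in>\<Omega> - ?G. norm (d n x) \<le> (1/2)^n) sequentially"
          using eventually_ge_at_top[of m]
        proof eventually_elim
          case (elim n)
          have "norm (d n x) \<le> (1/2)^n" if "x \<in> \<Omega> - ?G" for x
          proof -
            have "x \<notin> U (m + (n - m))" using that by blast
            then have "2^n * \<bar>d n x\<bar> \<le> 1" using elim by (simp add: U_def)
            then show ?thesis by (simp add: power_one_over field_simps)
          qed
          then show ?case by blast
        qed
      qed
      then have "continuous_on (\<Omega> - ?G) (\<lambda>x. \<Sum>i. d i x)"
        by (rule uniform_limit_theorem[rotated])
           (auto intro!: always_eventually continuous_on_sum test_continuous[OF d])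
      then show ?thesis
        unfolding w_def by (intro continuous_on_add test_continuous[OF \<phi>])
    qed
    ultimately show "\<exists>G. open G \<and> G \<subseteq> \<Omega> \<and> capacity \<Omega> G < ennreal e \<and> continuous_on (\<Omega> - G) w"
      using U U\<Omega> by (intro exI[of _ ?G]) auto
  qed
  ultimately show ?thesis by blast
qed

lemma qc_rep:
  assumes "v \<in> H1_0 \<Omega>"
  shows "quasi_continuous \<Omega> (qc_rep \<Omega> v)" "AE x in lebesgue_on \<Omega>. qc_rep \<Omega> v x = v x"
  using someI_ex[OF ex_quasi_continuous[OF assms]] by (simp_all add: qc_rep_def)

text \<open>Off a small open set \<open>G\<close>, the set where \<open>w\<close> is negative is
  relatively open, and it is a null set. Adding the corresponding open set to a neighbourhood of
  \<open>G\<close> therefore changes it only by a null set, and the competitor for \<open>G\<close>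
  works for the enlarged set too.\<close>

lemma quasi_continuous_nonneg:
  assumes "quasi_continuous \<Omega> w" "AE x in lebesgue_on \<Omega>. w x \<ge> 0"
  shows "capacity \<Omega> {x\<in>\<Omega>. w x < 0} = 0"
proof -
  have "capacity \<Omega> {x\<in>\<Omega>. w x < 0} \<le> 0 + ennreal e" if e: "e > 0" for e
  proof -
    obtain G where G: "open G" "G \<subseteq> \<Omega>" "capacity \<Omega> G < ennreal e" "continuous_on (\<Omega> - G) w"
      using assms(1) e unfolding quasi_continuous_def by blast
    obtain v U where v: "v \<in> H1_0 \<Omega>" "open U" "G \<subseteq> U" "AE x in lebesgue_on \<Omega>. x \<in> U \<longrightarrow> v x \<ge> 1"
      "(H1_norm \<Omega> v)\<^sup>2 < e"
      using G(3) by (rule capacity_lessE)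
    obtain V where V: "open V" "V \<inter> (\<Omega> - G) = w -` {..<0} \<inter> (\<Omega> - G)"
      using G(4) unfolding continuous_on_open_invariant by (metis open_lessThan)
    have "capacity \<Omega> {x\<in>\<Omega>. w x < 0} \<le> ennreal ((H1_norm \<Omega> v)\<^sup>2)"
    proof (rule capacity_le[OF v(1) open_Un[OF v(2) open_Int[OF V(1) open_\<Omega>]]])
      show "{x \<in> \<Omega>. w x < 0} \<subseteq> U \<union> V \<inter> \<Omega>" using v(3) V(2) by blast
      show "AE x in lebesgue_on \<Omega>. x \<in> U \<union> V \<inter> \<Omega> \<longrightarrow> 1 \<le> v x"
        using v(4) assms(2)
      proof eventually_elim
        case (elim x)
        show ?case
        proof
          assume x: "x \<in> U \<union> V \<inter> \<Omega>"
          have "x \<notin> V \<inter> (\<Omega> - G)" unfolding V(2) using elim(2) by auto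
          then have "x \<in> U" using x v(3) by blast
          then show "1 \<le> v x" using elim(1) by blast
        qed
      qed
    qed
    also have "\<dots> \<le> ennreal e" using v(5) by (intro ennreal_leI) simp
    finally show ?thesis by simp
  qed
  then have "capacity \<Omega> {x\<in>\<Omega>. w x < 0} \<le> 0"
    by (rule ennreal_le_epsilon)
  then show ?thesis by simp
qed

subsection \<open>Nonnegative functionals\<close>

lemma H_minus1_add:
  "\<nu> \<in> H_minus1 \<Omega> \<Longrightarrow> v \<in> H1_0 \<Omega> \<Longrightarrow> w \<in> H1_0 \<Omega> \<Longrightarrow> \<nu> (\<lambda>x. v x + w x) = \<nu> v + \<nu> w"
  by (simp add: H_minus1_def)

lemma H_minus1_cmult:
  "\<nu> \<in> H_minus1 \<Omega> \<Longrightarrow> v \<in> H1_0 \<Omega> \<Longrightarrow> \<nu> (\<lambda>x. c * v x) = c * \<nu> v"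
  by (simp add: H_minus1_def)

lemma H_minus1_diff:
  assumes "\<nu> \<in> H_minus1 \<Omega>" "v \<in> H1_0 \<Omega>" "w \<in> H1_0 \<Omega>"
  shows "\<nu> (\<lambda>x. v x - w x) = \<nu> v - \<nu> w"
  using H_minus1_add[OF assms(1,2) H1_0_cmult[OF assms(3), of "-1"]] H_minus1_cmult[OF assms(1,3), of "-1"]
  by simp

lemma nonneg_functional_mono:
  assumes "\<nu> \<in> H_minus1 \<Omega>" "nonneg_functional \<Omega> \<nu>" "v \<in> H1_0 \<Omega>" "w \<in> H1_0 \<Omega>"
    "AE x in lebesgue_on \<Omega>. v x \<le> w x"
  shows "\<nu> v \<le> \<nu> w"
proof -
  have "AE x in lebesgue_on \<Omega>. 0 \<le> w x - v x" using assms(5) by eventually_elim simp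
  then have "0 \<le> \<nu> (\<lambda>x. w x - v x)"
    using assms(2) H1_0_diff[OF assms(4,3)] by (auto simp: nonneg_functional_def)
  then show ?thesis using H_minus1_diff[OF assms(1,4,3)] by simp
qed

lemma H_minus1_combination:
  assumes "\<mu> \<in> H_minus1 \<Omega>" "\<xi> \<in> H_minus1 \<Omega>"
  shows "(\<lambda>\<phi>. \<mu> \<phi> - \<eta> * \<xi> \<phi>) \<in> H_minus1 \<Omega>"
proof -
  obtain B where B: "\<And>\<phi>. \<phi> \<in> H1_0 \<Omega> \<Longrightarrow> \<bar>\<mu> \<phi>\<bar> \<le> B * H1_norm \<Omega> \<phi>"
    using assms(1) unfolding H_minus1_def by blast
  obtain C where C: "\<And>\<phi>. \<phi> \<in> H1_0 \<Omega> \<Longrightarrow> \<bar>\<xi> \<phi>\<bar> \<le> C * H1_norm \<Omega> \<phi>"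
    using assms(2) unfolding H_minus1_def by blast
  have "\<bar>\<mu> \<phi> - \<eta> * \<xi> \<phi>\<bar> \<le> (B + \<bar>\<eta>\<bar> * C) * H1_norm \<Omega> \<phi>" if "\<phi> \<in> H1_0 \<Omega>" for \<phi>
  proof -
    have "\<bar>\<mu> \<phi> - \<eta> * \<xi> \<phi>\<bar> \<le> \<bar>\<mu> \<phi>\<bar> + \<bar>\<eta>\<bar> * \<bar>\<xi> \<phi>\<bar>"
      using abs_triangle_ineq4[of "\<mu> \<phi>" "\<eta> * \<xi> \<phi>"] by (simp add: abs_mult)
    also have "\<dots> \<le> B * H1_norm \<Omega> \<phi> + \<bar>\<eta>\<bar> * (C * H1_norm \<Omega> \<phi>)"
      by (intro add_mono mult_left_mono B C that) simp
    finally show ?thesis by (simp add: algebra_simps)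
  qed
  then have "\<exists>C. \<forall>\<phi>\<in>H1_0 \<Omega>. \<bar>\<mu> \<phi> - \<eta> * \<xi> \<phi>\<bar> \<le> C * H1_norm \<Omega> \<phi>" by blast
  then show ?thesis
    using assms unfolding H_minus1_def by (simp add: right_diff_distrib distrib_left)
qed

text \<open>
  Elementary substitute for the fact that a nonnegative functional is a measure which, when it
  annihilates \<open>w \<ge> 0\<close>, is carried by \<open>{w = 0}\<close>: up to an \<open>\<epsilon>\<close>-cutoff and a function of small norm which
  exceeds 1 on the exceptional set, the negative part of \<open>\<phi>\<close> is bounded by a multiple of \<open>w\<close>.
\<close>

lemma nonneg_functional_on_contact_set:
  assumes \<nu>: "\<nu> \<in> H_minus1 \<Omega>" "nonneg_functional \<Omega> \<nu>"
    and w: "w \<in> H1_0 \<Omega>" "AE x in lebesgue_on \<Omega>. w x \<ge> 0" "\<nu> w = 0"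
    and \<phi>: "\<phi> \<in> H1_0 \<Omega>"
    and w': "quasi_continuous \<Omega> w'" "AE x in lebesgue_on \<Omega>. w' x = w x"
    and \<phi>': "quasi_continuous \<Omega> \<phi>'" "AE x in lebesgue_on \<Omega>. \<phi>' x = \<phi> x"
    and cap: "capacity \<Omega> {x\<in>\<Omega>. w' x = 0 \<and> \<phi>' x < 0} = 0"
  shows "\<nu> \<phi> \<ge> 0"
proof -
  let ?M = "lebesgue_on \<Omega>"
  obtain C where C: "\<And>\<theta>. \<theta> \<in> H1_0 \<Omega> \<Longrightarrow> \<bar>\<nu> \<theta>\<bar> \<le> C * H1_norm \<Omega> \<theta>"
    using \<nu>(1) unfolding H_minus1_def by blast
  define D where "D = \<bar>C\<bar> + 1"
  have D: "D > 0" "\<nu> \<theta> \<le> D * H1_norm \<Omega> \<theta>" if "\<theta> \<in> H1_0 \<Omega>" for \<theta>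
  proof -
    show "D > 0" by (simp add: D_def add_nonneg_pos)
    have "C * H1_norm \<Omega> \<theta> \<le> D * H1_norm \<Omega> \<theta>" by (intro mult_right_mono) (auto simp: D_def)
    then show "\<nu> \<theta> \<le> D * H1_norm \<Omega> \<theta>" using C[OF that] by linarith
  qed
  have D0: "D > 0" by (simp add: D_def add_nonneg_pos)
  note mono = nonneg_functional_mono[OF \<nu>]
  have cap_w: "capacity \<Omega> {x\<in>\<Omega>. w' x < 0} = 0"
  proof (rule quasi_continuous_nonneg[OF w'(1)])
    show "AE x in ?M. w' x \<ge> 0" using w(2) w'(2) by eventually_elim simp
  qed
  \<comment> \<open>Since \<nu> is nonnegative on the positive part of \<phi>, it suffices that
    \<nu> is not positive on this negative part.\<close>
  define N where "N x = max (- \<phi> x) 0" for x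
  have N: "N \<in> H1_0 \<Omega>" unfolding N_def by (intro H1_0_max H1_0_minus H1_0_zero \<phi>)
  \<comment> \<open>Cutting off at the modulus of a test function makes the negative part bounded
    and supported in a compact set, which supplies the constant \<open>B\<close> and the compactness
    used below.\<close>
  have trunc: "\<nu> (\<lambda>x. min (N x) \<bar>\<theta> x\<bar>) \<le> 0" if \<theta>: "\<theta> \<in> test_functions \<Omega>" for \<theta>
  proof -
    define m where "m x = min (N x) \<bar>\<theta> x\<bar>" for x
    have m: "m \<in> H1_0 \<Omega>" unfolding m_def by (intro H1_0_min N H1_0_abs H1_0_test \<theta>)
    obtain K where K: "compact K" "K \<subseteq> \<Omega>" "\<And>x. x \<notin> K \<Longrightarrow> \<theta> x = 0"
      using \<theta> by (rule test_functionsE) blast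
    obtain B where B: "B \<ge> 0" "\<And>x. norm (\<theta> x) \<le> B"
      using compact_support_bounded[OF test_continuous[OF \<theta>] K(1,3)] by blast
    obtain \<kappa> where \<kappa>: "\<kappa> \<in> test_functions \<Omega>" "\<And>x. \<kappa> x \<ge> 0" "\<And>x. x \<in> K \<Longrightarrow> \<kappa> x \<ge> 1"
      using test_cutoff[OF open_\<Omega> K(1,2)] by blast
    have main: "\<nu> m \<le> \<epsilon> * (\<nu> \<kappa> + B * D)" if \<epsilon>: "\<epsilon> > 0" for \<epsilon>
    proof -
      \<comment> \<open>Two unions cost \<open>4 * (5 * e) = 20 * e\<close>, below
        \<open>64 * e = \<epsilon>^2\<close>; the 5 instead of 4 restores strict inequality between
        the unions.\<close>
      define e where "e = \<epsilon>\<^sup>2 / 64"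
      have e: "e > 0" using \<epsilon> by (simp add: e_def)
      obtain G1 where G1: "open G1" "G1 \<subseteq> \<Omega>" "capacity \<Omega> G1 < ennreal e" "continuous_on (\<Omega> - G1) w'"
        using w'(1) e unfolding quasi_continuous_def by blast
      obtain G2 where G2: "open G2" "G2 \<subseteq> \<Omega>" "capacity \<Omega> G2 < ennreal e" "continuous_on (\<Omega> - G2) \<phi>'"
        using \<phi>'(1) e unfolding quasi_continuous_def by blast
      let ?E1 = "{x\<in>\<Omega>. w' x < 0}" and ?E2 = "{x\<in>\<Omega>. w' x = 0 \<and> \<phi>' x < 0}"
      have "capacity \<Omega> (G1 \<union> G2) \<le> ennreal (4 * e)" by (rule capacity_Un[OF G1(3) G2(3)])
      then have 1: "capacity \<Omega> (G1 \<union> G2) < ennreal (5 * e)"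
        by (rule order_le_less_trans) (use e in \<open>simp add: ennreal_less_iff\<close>)
      have "capacity \<Omega> (?E1 \<union> ?E2) \<le> ennreal (4 * e)"
        by (rule capacity_Un) (use cap_w cap e in auto)
      then have 2: "capacity \<Omega> (?E1 \<union> ?E2) < ennreal (5 * e)"
        by (rule order_le_less_trans) (use e in \<open>simp add: ennreal_less_iff\<close>)
      have "capacity \<Omega> ((G1 \<union> G2) \<union> (?E1 \<union> ?E2)) \<le> ennreal (4 * (5 * e))"
        by (rule capacity_Un[OF 1 2])
      then have "capacity \<Omega> ((G1 \<union> G2) \<union> (?E1 \<union> ?E2)) < ennreal (\<epsilon>\<^sup>2)"
        using \<epsilon> by (elim order_le_less_trans) (simp add: ennreal_less_iff e_def)
      then obtain V U where V: "V \<in> H1_0 \<Omega>" "open U" "(G1 \<union> G2) \<union> (?E1 \<union> ?E2) \<subseteq> U"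
        "AE x in ?M. x \<in> U \<longrightarrow> V x \<ge> 1" "\<And>x. V x \<ge> 0" "(H1_norm \<Omega> V)\<^sup>2 < \<epsilon>\<^sup>2"
        using capacity_lessE[of "(G1 \<union> G2) \<union> (?E1 \<union> ?E2)" "\<epsilon>\<^sup>2"] by blast
      have HV: "H1_norm \<Omega> V \<le> \<epsilon>"
        using V(6) \<epsilon> power2_less_imp_less[of "H1_norm \<Omega> V" \<epsilon>] by simp
      have sub: "K - U \<subseteq> \<Omega> - G1" "K - U \<subseteq> \<Omega> - G2" using K(2) V(3) by auto
      have cont: "continuous_on (K - U) w'" "continuous_on (K - U) \<phi>'"
        using continuous_on_subset[OF G1(4) sub(1)] continuous_on_subset[OF G2(4) sub(2)] by auto
      have compKU: "compact (K - U)" using K(1) V(2) by (rule compact_diff)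
      \<comment> \<open>Points of \<open>Q\<close> lie off \<open>U\<close>, which contains the
        points where \<open>w'\<close> is negative and the contact points where \<phi>' is negative.
        So \<open>w'\<close> is positive on \<open>Q\<close>, and by continuity on this compact set
        it has a positive minimum \<delta>.\<close>
      define Q where "Q = (K - U) \<inter> \<phi>' -` {..-\<epsilon>}"
      have "closed Q"
        unfolding Q_def by (rule continuous_closed_preimage[OF cont(2) compact_imp_closed[OF compKU] closed_atMost])
      then have "compact Q" using compKU unfolding Q_def by (metis compact_Int_closed inf.left_idem)
      have "\<exists>\<delta>>0. \<forall>x\<in>Q. \<delta> \<le> w' x"
      proof (cases "Q = {}")
        case False
        have "continuous_on Q w'" by (rule continuous_on_subset[OF cont(1)]) (auto simp: Q_def)
        then obtain x0 where x0: "x0 \<in> Q" "\<forall>x\<in>Q. w' x0 \<le> w' x"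
          using continuous_attains_inf[OF \<open>compact Q\<close> False] by blast
        have "x0 \<in> \<Omega>" "x0 \<notin> U" "\<phi>' x0 < 0" using x0(1) K(2) \<epsilon> by (auto simp: Q_def)
        then have "\<not> w' x0 < 0" "w' x0 \<noteq> 0" using V(3) by auto
        then have "w' x0 > 0" by linarith
        then show ?thesis using x0(2) by blast
      qed (auto intro: exI[of _ 1])
      then obtain \<delta> where \<delta>: "\<delta> > 0" "\<And>x. x \<in> Q \<Longrightarrow> \<delta> \<le> w' x" by blast
      \<comment> \<open>Each term covers one region: \<open>\<epsilon> * \<kappa>\<close> the points
        of \<open>K\<close> where \<phi> exceeds \<open>-\<epsilon>\<close>, \<open>B * V\<close>
        the exceptional set \<open>U\<close>, and \<open>(B / \<delta>) * w\<close> the set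
        \<open>Q\<close>.\<close>
      have le: "AE x in ?M. m x \<le> \<epsilon> * \<kappa> x + (B * V x + (B / \<delta>) * w x)"
        using w(2) w'(2) \<phi>'(2) V(4)
      proof eventually_elim
        case (elim x)
        have mB: "m x \<le> B" using B(2)[of x] by (simp add: m_def)
        have n1: "0 \<le> \<epsilon> * \<kappa> x" "0 \<le> B * V x" "0 \<le> (B / \<delta>) * w x"
          using \<epsilon> \<kappa>(2)[of x] B(1) V(5)[of x] elim(1) \<delta>(1) by simp_all
        consider "x \<notin> K" | "x \<in> U" | "x \<in> K" "x \<notin> U" "\<phi>' x > -\<epsilon>" | "x \<in> Q"
          unfolding Q_def by force
        then show ?case
        proof cases
          case 1
          then have "m x \<le> 0" using K(3)[of x] by (simp add: m_def)
          then show ?thesis using n1 by linarith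
        next
          case 2
          then have "B \<le> B * V x" using elim(4) B(1) mult_left_mono[of 1 "V x" B] by simp
          then show ?thesis using mB n1 by linarith
        next
          case 3
          then have "m x \<le> \<epsilon>" using elim(3) \<epsilon> by (simp add: m_def N_def)
          also have "\<epsilon> \<le> \<epsilon> * \<kappa> x" using \<kappa>(3)[OF 3(1)] \<epsilon> by simp
          finally show ?thesis using n1 by linarith
        next
          case 4
          have "B = (B / \<delta>) * \<delta>" using \<delta>(1) by simp
          also have "\<dots> \<le> (B / \<delta>) * w x"
            using \<delta>(2)[OF 4] elim(2) B(1) \<delta>(1) by (intro mult_left_mono) auto
          finally show ?thesis using mB n1 by linarith
        qed
      qed
      have H: "(\<lambda>x. \<epsilon> * \<kappa> x) \<in> H1_0 \<Omega>" "(\<lambda>x. B * V x) \<in> H1_0 \<Omega>" "(\<lambda>x. (B / \<delta>) * w x) \<in> H1_0 \<Omega>"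
        using H1_0_cmult[OF H1_0_test[OF \<kappa>(1)]] H1_0_cmult[OF V(1)] H1_0_cmult[OF w(1)] by blast+
      have "\<nu> m \<le> \<nu> (\<lambda>x. \<epsilon> * \<kappa> x + (B * V x + (B / \<delta>) * w x))"
        by (rule mono[OF m H1_0_add[OF H(1) H1_0_add[OF H(2,3)]] le])
      also have "\<dots> = \<epsilon> * \<nu> \<kappa> + (B * \<nu> V + (B / \<delta>) * \<nu> w)"
        using H_minus1_add[OF \<nu>(1) H(1) H1_0_add[OF H(2,3)]] H_minus1_add[OF \<nu>(1) H(2,3)]
          H_minus1_cmult[OF \<nu>(1) H1_0_test[OF \<kappa>(1)]] H_minus1_cmult[OF \<nu>(1) V(1)] H_minus1_cmult[OF \<nu>(1) w(1)]
        by (simp only:)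
      \<comment> \<open>The factor \<open>B / \<delta>\<close> is not controlled as \<epsilon> tends
        to 0, but it multiplies \<open>\<nu> w = 0\<close>.\<close>
      also have "\<dots> \<le> \<epsilon> * \<nu> \<kappa> + B * (D * \<epsilon>)"
      proof -
        have "\<nu> V \<le> D * \<epsilon>"
          using D(2)[OF V(1)] mult_left_mono[OF HV, of D] D0 by linarith
        then show ?thesis using w(3) B(1) by (simp add: mult_left_mono)
      qed
      finally show ?thesis by (simp add: algebra_simps)
    qed
    have "\<nu> m \<le> 0"
    proof (rule tendsto_lowerbound)
      show "((\<lambda>\<epsilon>. \<epsilon> * (\<nu> \<kappa> + B * D)) \<longlongrightarrow> 0) (at_right 0)"
        by (auto intro!: tendsto_eq_intros)
      show "\<forall>\<^sub>F \<epsilon> in at_right 0. \<nu> m \<le> \<epsilon> * (\<nu> \<kappa> + B * D)"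
        using main by (auto simp: eventually_at_filter)
    qed simp
    then show ?thesis by (simp add: m_def[abs_def])
  qed
  have "\<nu> N \<le> 0"
  proof (rule field_le_epsilon)
    fix e :: real assume e: "e > 0"
    obtain \<sigma> where \<sigma>: "\<And>n::nat. \<sigma> n \<in> test_functions \<Omega>" "(\<lambda>n. H1_norm \<Omega> (\<lambda>x. \<sigma> n x - N x)) \<longlonglongrightarrow> 0"
      using N by (auto simp: H1_0_def)
    have "eventually (\<lambda>n. H1_norm \<Omega> (\<lambda>x. \<sigma> n x - N x) < e / D) sequentially"
      by (rule order_tendstoD(2)[OF \<sigma>(2)]) (use e D0 in simp)
    then obtain \<theta> where \<theta>: "\<theta> \<in> test_functions \<Omega>" "H1_norm \<Omega> (\<lambda>x. \<theta> x - N x) < e / D"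
      using \<sigma>(1) by (auto simp: eventually_sequentially)
    note d = H1_0_diff[OF H1_0_test[OF \<theta>(1)] N]
    note a = H1_0_abs[OF d]
    have mm: "(\<lambda>x. min (N x) \<bar>\<theta> x\<bar>) \<in> H1_0 \<Omega>" by (intro H1_0_min N H1_0_abs H1_0_test \<theta>)
    \<comment> \<open>The truncation loses at most the distance to \<theta>, and boundedness of
      \<nu> makes this remainder small.\<close>
    have "\<nu> N \<le> \<nu> (\<lambda>x. min (N x) \<bar>\<theta> x\<bar> + \<bar>\<theta> x - N x\<bar>)"
      by (rule mono[OF N H1_0_add[OF mm a]]) (auto intro!: AE_I2)
    also have "\<dots> = \<nu> (\<lambda>x. min (N x) \<bar>\<theta> x\<bar>) + \<nu> (\<lambda>x. \<bar>\<theta> x - N x\<bar>)"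
      by (rule H_minus1_add[OF \<nu>(1) mm a])
    also have "\<dots> \<le> 0 + D * H1_norm \<Omega> (\<lambda>x. \<bar>\<theta> x - N x\<bar>)"
      by (intro add_mono trunc \<theta> D a)
    also have "H1_norm \<Omega> (\<lambda>x. \<bar>\<theta> x - N x\<bar>) \<le> e / D"
      using H1_norm_abs[OF d] \<theta>(2) by linarith
    finally show "\<nu> N \<le> 0 + e" using D0 by (simp add: mult_left_mono)
  qed
  have P: "(\<lambda>x. max (\<phi> x) 0) \<in> H1_0 \<Omega>" by (intro H1_0_max H1_0_zero \<phi>)
  have "\<nu> (\<lambda>x. max (\<phi> x) 0) \<ge> 0"
    using \<nu>(2) P by (auto simp: nonneg_functional_def)
  moreover have "\<phi> = (\<lambda>x. max (\<phi> x) 0 - N x)" by (auto simp: N_def)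
  then have "\<nu> \<phi> = \<nu> (\<lambda>x. max (\<phi> x) 0) - \<nu> N"
    using H_minus1_diff[OF \<nu>(1) P N] by simp
  ultimately show ?thesis using \<open>\<nu> N \<le> 0\<close> by linarith
qed

subsection \<open>The obstacle problem\<close>

lemma L2_prod_add_right:
  fixes F v w :: "'a \<Rightarrow> real"
  assumes "F \<in> L2 \<Omega>" "v \<in> L2 \<Omega>" "w \<in> L2 \<Omega>"
  shows "(\<integral>x. F x * (v x + w x) \<partial>lebesgue_on \<Omega>) = (\<integral>x. F x * v x \<partial>lebesgue_on \<Omega>) + (\<integral>x. F x * w x \<partial>lebesgue_on \<Omega>)"
  using L2_mult_integrable[OF assms(1,2)] L2_mult_integrable[OF assms(1,3)] by (simp add: distrib_left)

lemma L2_prod_diff_right: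
  fixes F v w :: "'a \<Rightarrow> real"
  assumes "F \<in> L2 \<Omega>" "v \<in> L2 \<Omega>" "w \<in> L2 \<Omega>"
  shows "(\<integral>x. F x * (v x - w x) \<partial>lebesgue_on \<Omega>) = (\<integral>x. F x * v x \<partial>lebesgue_on \<Omega>) - (\<integral>x. F x * w x \<partial>lebesgue_on \<Omega>)"
  using L2_mult_integrable[OF assms(1,2)] L2_mult_integrable[OF assms(1,3)] by (simp add: right_diff_distrib)

lemma L2_prod_cmult_right:
  fixes F v :: "'a \<Rightarrow> real"
  shows "(\<integral>x. F x * (c * v x) \<partial>lebesgue_on \<Omega>) = c * (\<integral>x. F x * v x \<partial>lebesgue_on \<Omega>)"
proof -
  have "(\<integral>x. F x * (c * v x) \<partial>lebesgue_on \<Omega>) = (\<integral>x. c * (F x * v x) \<partial>lebesgue_on \<Omega>)"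
    by (simp add: mult.left_commute)
  then show ?thesis by simp
qed

text \<open>The quadratic functional whose minimality over the admissible set has the obstacle
  problem as its variational inequality.\<close>

definition energy :: "('a \<Rightarrow> real) \<Rightarrow> ('a \<Rightarrow> real) \<Rightarrow> real" where
  "energy F z = dirichlet_form \<Omega> z z / 2 - (\<integral>x. F x * z x \<partial>lebesgue_on \<Omega>)"

lemma energy_expand:
  assumes F: "F \<in> L2 \<Omega>" and z: "z \<in> H1_0 \<Omega>" and h: "h \<in> H1_0 \<Omega>"
  shows "energy F (\<lambda>x. z x + t * h x) = energy F z +
    t * (dirichlet_form \<Omega> z h - (\<integral>x. F x * h x \<partial>lebesgue_on \<Omega>)) + t\<^sup>2 / 2 * dirichlet_form \<Omega> h h"
proof -
  note th = H1_0_cmult[OF h, of t]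
  have "dirichlet_form \<Omega> (\<lambda>x. z x + t * h x) (\<lambda>x. z x + t * h x) =
      dirichlet_form \<Omega> (\<lambda>x. z x + t * h x) z + t * dirichlet_form \<Omega> (\<lambda>x. z x + t * h x) h"
    using dirichlet_form_add[OF H1_0_add[OF z th] z th] dirichlet_form_cmult[OF H1_0_add[OF z th] h] by simp
  also have "dirichlet_form \<Omega> (\<lambda>x. z x + t * h x) z = dirichlet_form \<Omega> z z + t * dirichlet_form \<Omega> z h"
    using dirichlet_form_add[OF z z th] dirichlet_form_cmult[OF z h, of t] by (simp add: dirichlet_form_commute[of "\<lambda>x. z x + t * h x" z])
  also have "dirichlet_form \<Omega> (\<lambda>x. z x + t * h x) h = dirichlet_form \<Omega> z h + t * dirichlet_form \<Omega> h h"
    using dirichlet_form_add[OF h z th] dirichlet_form_cmult[OF h h, of t]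
    by (simp add: dirichlet_form_commute[of "\<lambda>x. z x + t * h x" h] dirichlet_form_commute[of h z])
  finally have 1: "dirichlet_form \<Omega> (\<lambda>x. z x + t * h x) (\<lambda>x. z x + t * h x) =
     dirichlet_form \<Omega> z z + t * dirichlet_form \<Omega> z h + t * (dirichlet_form \<Omega> z h + t * dirichlet_form \<Omega> h h)" .
  have 2: "(\<integral>x. F x * (z x + t * h x) \<partial>lebesgue_on \<Omega>) =
      (\<integral>x. F x * z x \<partial>lebesgue_on \<Omega>) + t * (\<integral>x. F x * h x \<partial>lebesgue_on \<Omega>)"
    using L2_prod_add_right[OF F H1_0_L2[OF z] H1_0_L2[OF th]] by (simp only: L2_prod_cmult_right)
  show ?thesis unfolding energy_def 1 2 by (simp add: field_simps power2_eq_square)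
qed

lemma admissible_convex:
  assumes "v \<in> admissible \<Omega> \<psi>" "w \<in> admissible \<Omega> \<psi>" "0 \<le> t" "t \<le> 1"
  shows "(\<lambda>x. v x + t * (w x - v x)) \<in> admissible \<Omega> \<psi>"
proof -
  have "AE x in lebesgue_on \<Omega>. v x \<ge> \<psi> x" "AE x in lebesgue_on \<Omega>. w x \<ge> \<psi> x"
    using assms by (auto simp: admissible_def)
  then have "AE x in lebesgue_on \<Omega>. v x + t * (w x - v x) \<ge> \<psi> x"
  proof eventually_elim
    case (elim x)
    have "(1 - t) * \<psi> x + t * \<psi> x \<le> (1 - t) * v x + t * w x"
      using elim assms(3,4) by (intro add_mono mult_left_mono) auto
    then show ?case by (simp add: algebra_simps)
  qed
  then show ?thesis
    using assms(1,2) by (auto simp: admissible_def intro!: H1_0_add H1_0_cmult H1_0_diff)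
qed

text \<open>The direct method with strong convergence: the energy at the midpoint of two almost
  minimal points cannot drop below the infimum, and uniform convexity then bounds their distance. So
  a fast minimising sequence is Cauchy in \<open>H1_0\<close>.\<close>

lemma ex_obstacle_solution:
  assumes \<psi>: "\<psi> \<in> H1_0 \<Omega>" and f: "f \<in> L2 \<Omega>" and u: "u \<in> L2 \<Omega>"
  shows "\<exists>y. obstacle_solution \<Omega> \<psi> f u y"
proof -
  define F where "F x = f x + u x" for x
  have F: "F \<in> L2 \<Omega>" unfolding F_def by (rule L2_add[OF f u])
  let ?E = "energy F" and ?K = "admissible \<Omega> \<psi>" and ?D = "dirichlet_form \<Omega>"
  let ?l = "\<lambda>h. \<integral>x. F x * h x \<partial>lebesgue_on \<Omega>"
  have K: "v \<in> H1_0 \<Omega>" "AE x in lebesgue_on \<Omega>. v x \<ge> \<psi> x" if "v \<in> ?K" for v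
    using that by (auto simp: admissible_def)
  have \<psi>K: "\<psi> \<in> ?K" using \<psi> by (simp add: admissible_def)
  obtain C where C: "C > 0" "\<And>v. v \<in> H1_0 \<Omega> \<Longrightarrow> (L2_norm \<Omega> v)\<^sup>2 \<le> C\<^sup>2 * ?D v v"
    using Poincare by blast
  have bdd: "bdd_below (?E ` ?K)"
  proof (rule bdd_belowI2)
    fix v assume "v \<in> ?K"
    then have v: "v \<in> H1_0 \<Omega>" by (rule K)
    let ?s = "L2_norm \<Omega> (wgrad \<Omega> v)" and ?c = "L2_norm \<Omega> F"
    have "(L2_norm \<Omega> v)\<^sup>2 \<le> (C * ?s)\<^sup>2"
      using C(2)[OF v] by (simp add: dirichlet_form_self power_mult_distrib)
    then have "L2_norm \<Omega> v \<le> C * ?s" by (rule power2_le_imp_le) (use C in simp)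
    then have "?c * L2_norm \<Omega> v \<le> ?c * (C * ?s)" by (intro mult_left_mono) auto
    then have "?l v \<le> ?c * C * ?s"
      using L2_Cauchy_Schwarz_real[OF F H1_0_L2[OF v]] by (simp add: mult.assoc)
    \<comment> \<open>Completing the square in the gradient norm absorbs the linear term and leaves
      an explicit lower bound of the energy.\<close>
    moreover have "0 \<le> (?s - ?c * C)\<^sup>2" by simp
    ultimately show "- ((?c * C)\<^sup>2 / 2) \<le> ?E v"
      unfolding energy_def dirichlet_form_self by (simp add: power2_diff algebra_simps)
  qed
  define I where "I = Inf (?E ` ?K)"
  have I: "I \<le> ?E v" if "v \<in> ?K" for v
    unfolding I_def using that by (intro cInf_lower[OF _ bdd]) simp
  \<comment> \<open>The midpoint comparison turns an energy excess of at most \<delta> into a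
    Dirichlet form of at most \<open>8 * \<delta>\<close>, and Poincare costs the factor
    \<open>C^2 + 1\<close>; with this choice the increments are at most
    \<open>(1/2)^n\<close>.\<close>
  define \<delta> where "\<delta> n = (1/4)^n / (8 * (C\<^sup>2 + 1))" for n
  have Cp: "C\<^sup>2 + 1 > 0" by (simp add: add_nonneg_pos)
  have \<delta>: "\<delta> n > 0" "\<delta> (Suc n) \<le> \<delta> n" for n
    unfolding \<delta>_def using Cp by (simp, intro divide_right_mono power_decreasing) auto
  have "\<exists>v\<in>?K. ?E v < I + \<delta> n" for n
  proof -
    have "Inf (?E ` ?K) < I + \<delta> n" using \<delta>(1)[of n] by (simp add: I_def)
    then show ?thesis using \<psi>K bdd by (subst (asm) cInf_less_iff) auto
  qed
  then obtain z where z: "\<And>n. z n \<in> ?K" "\<And>n. ?E (z n) < I + \<delta> n" by metis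
  note zH = K(1)[OF z(1)]
  have "H1_norm \<Omega> (\<lambda>x. z (Suc n) x - z n x) \<le> (1/2)^n" for n
  proof (rule power2_le_imp_le)
    define h where "h x = z (Suc n) x - z n x" for x
    have h: "h \<in> H1_0 \<Omega>" unfolding h_def by (intro H1_0_diff zH)
    have "?E (z (Suc n)) = ?E (\<lambda>x. z n x + 1 * h x)" by (simp add: h_def)
    then have e1: "?E (z (Suc n)) = ?E (z n) + 1 * (?D (z n) h - ?l h) + 1\<^sup>2 / 2 * ?D h h"
      unfolding energy_expand[OF F zH h] .
    \<comment> \<open>The midpoint of two consecutive members. Doubling its energy inequality and
      comparing with \<open>e1\<close> eliminates the first-order term.\<close>
    have "(\<lambda>x. z n x + (1/2) * h x) \<in> ?K"
      unfolding h_def by (rule admissible_convex[OF z(1) z(1)]) auto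
    then have e2: "I \<le> ?E (z n) + (1/2) * (?D (z n) h - ?l h) + (1/2)\<^sup>2 / 2 * ?D h h"
      using I energy_expand[OF F zH h, of n "1/2"] by metis
    have "?D h h \<le> 8 * \<delta> n"
      using e1 e2 z(2)[of n] z(2)[of "Suc n"] \<delta>(2)[of n] unfolding power2_eq_square by linarith
    moreover have "8 * (a / (8 * k)) = a / k" for a k :: real by simp
    ultimately have Dh: "?D h h \<le> (1/4)^n / (C\<^sup>2 + 1)" by (simp only: \<delta>_def)
    have "(H1_norm \<Omega> h)\<^sup>2 = (L2_norm \<Omega> h)\<^sup>2 + ?D h h"
      by (simp add: H1_norm_def dirichlet_form_self)
    also have "\<dots> \<le> (C\<^sup>2 + 1) * ?D h h"
      using C(2)[OF h] by (simp add: algebra_simps)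
    also have "\<dots> \<le> (C\<^sup>2 + 1) * ((1/4)^n / (C\<^sup>2 + 1))"
      by (rule mult_left_mono[OF Dh]) (use Cp in simp)
    also have "\<dots> = ((1/2)^n)\<^sup>2"
      using Cp by (simp add: power2_eq_square power_mult_distrib[symmetric])
    finally show "(H1_norm \<Omega> (\<lambda>x. z (Suc n) x - z n x))\<^sup>2 \<le> ((1/2)^n)\<^sup>2"
      by (simp add: h_def[abs_def])
  qed simp
  then obtain y where y: "y \<in> H1_0 \<Omega>" "\<And>n. H1_norm \<Omega> (\<lambda>x. z n x - y x) \<le> 4 * (1/2)^n"
    using H1_0_complete[of z, OF zH] by blast
  have p0: "(\<lambda>n. c * (4 * (1/2::real)^n)) \<longlonglongrightarrow> 0" for c
    using tendsto_mult_left[OF LIMSEQ_power_zero[of "1/2::real"], of "c * 4"] by (simp add: mult.assoc)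
  have "AE x in lebesgue_on \<Omega>. True \<longrightarrow> \<psi> x \<le> y x"
  proof (rule L2_limit_ge[OF H1_0_L2[OF zH] H1_0_L2[OF y(1)], of _ 0])
    show "(\<lambda>n. L2_norm \<Omega> (\<lambda>x. z n x - y x)) \<longlonglongrightarrow> 0"
    proof (rule tendsto_sandwich[OF _ _ tendsto_const p0[of 1]])
      show "eventually (\<lambda>n. L2_norm \<Omega> (\<lambda>x. z n x - y x) \<le> 1 * (4 * (1/2)^n)) sequentially"
        using order_trans[OF L2_norm_le_H1_norm(1) y(2)] by (intro always_eventually allI) simp
    qed simp
    show "AE x in lebesgue_on \<Omega>. True \<longrightarrow> \<psi> x \<le> z n x" for n using K(2)[OF z(1)] by simp
  qed
  then have yK: "y \<in> ?K" using y(1) by (simp add: admissible_def)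
  have yI: "?E y \<le> I"
  proof -
    define c where "c = L2_norm \<Omega> (wgrad \<Omega> y) + L2_norm \<Omega> F"
    \<comment> \<open>Expanding around the limit \<open>y\<close>, the quadratic term is dropped for
      its sign and the linear terms are bounded by the H1 distance.\<close>
    have le: "?E y \<le> I + (1/4)^n / (8 * (C\<^sup>2 + 1)) + c * (4 * (1/2)^n)" for n
    proof -
      define h where "h x = z n x - y x" for x
      have h: "h \<in> H1_0 \<Omega>" unfolding h_def by (intro H1_0_diff zH y)
      have "?E (z n) = ?E (\<lambda>x. y x + 1 * h x)" by (simp add: h_def)
      then have e: "?E (z n) = ?E y + (?D y h - ?l h) + ?D h h / 2"
        using energy_expand[OF F y(1) h, of 1] by simp
      have "\<bar>?D y h\<bar> \<le> L2_norm \<Omega> (wgrad \<Omega> y) * L2_norm \<Omega> (wgrad \<Omega> h)"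
        unfolding dirichlet_form_def by (intro L2_Cauchy_Schwarz H1_0_wgrad_L2 y h)
      also have "\<dots> \<le> L2_norm \<Omega> (wgrad \<Omega> y) * H1_norm \<Omega> h"
        by (intro mult_left_mono L2_norm_le_H1_norm) simp
      finally have d: "\<bar>?D y h\<bar> \<le> L2_norm \<Omega> (wgrad \<Omega> y) * H1_norm \<Omega> h" .
      have "\<bar>?l h\<bar> \<le> L2_norm \<Omega> F * L2_norm \<Omega> h" by (rule L2_Cauchy_Schwarz_real[OF F H1_0_L2[OF h]])
      also have "\<dots> \<le> L2_norm \<Omega> F * H1_norm \<Omega> h"
        by (intro mult_left_mono L2_norm_le_H1_norm) simp
      finally have "?E y \<le> ?E (z n) + c * H1_norm \<Omega> h"
        using e d dirichlet_form_nonneg[of h] unfolding c_def distrib_right by linarith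
      also have "c * H1_norm \<Omega> h \<le> c * (4 * (1/2)^n)"
        using y(2)[of n] unfolding h_def[abs_def] by (intro mult_left_mono) (auto simp: c_def)
      finally show ?thesis using z(2)[of n] unfolding \<delta>_def by linarith
    qed
    have "(\<lambda>n. I + (1/4)^n / (8 * (C\<^sup>2 + 1)) + c * (4 * (1/2)^n)) \<longlonglongrightarrow> I + 0 / (8 * (C\<^sup>2 + 1)) + 0"
      by (intro tendsto_intros p0 LIMSEQ_power_zero) (use Cp in auto)
    then show ?thesis using le by (intro LIMSEQ_le_const[of _ I]) auto
  qed
  have "?D y (\<lambda>x. \<phi> x - y x) \<ge> ?l (\<lambda>x. \<phi> x - y x)" if \<phi>: "\<phi> \<in> ?K" for \<phi>
  proof -
    define h where "h x = \<phi> x - y x" for x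
    have h: "h \<in> H1_0 \<Omega>" unfolding h_def by (intro H1_0_diff y K(1)[OF \<phi>])
    \<comment> \<open>Minimality along the segment from \<open>y\<close> to the competitor; division
      by \<open>t\<close> leaves the first variation plus a term that vanishes as \<open>t\<close>
      tends to 0.\<close>
    have pos: "0 \<le> (?D y h - ?l h) + t / 2 * ?D h h" if t: "t > 0" "t \<le> 1" for t
    proof -
      have "(\<lambda>x. y x + t * h x) \<in> ?K"
        unfolding h_def by (rule admissible_convex[OF yK \<phi>]) (use t in auto)
      then have "?E y \<le> ?E (\<lambda>x. y x + t * h x)" using yI I by fastforce
      then have "0 \<le> t * ((?D y h - ?l h) + t / 2 * ?D h h)"
        unfolding energy_expand[OF F y(1) h] by (simp add: algebra_simps power2_eq_square)
      then show ?thesis using t(1) by (simp add: zero_le_mult_iff)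
    qed
    have "0 \<le> ?D y h - ?l h"
    proof (rule tendsto_lowerbound)
      show "((\<lambda>t. (?D y h - ?l h) + t / 2 * ?D h h) \<longlongrightarrow> ?D y h - ?l h) (at_right 0)"
        by (auto intro!: tendsto_eq_intros)
      have "eventually (\<lambda>t::real. t \<in> {0<..<1}) (at_right 0)"
        by (rule eventually_at_rightI[of 0 1]) auto
      then show "\<forall>\<^sub>F t in at_right 0. 0 \<le> (?D y h - ?l h) + t / 2 * ?D h h"
        by eventually_elim (use pos in simp)
    qed simp
    then show ?thesis by (simp add: h_def[abs_def])
  qed
  then have "obstacle_solution \<Omega> \<psi> f u y"
    using yK by (simp add: obstacle_solution_def F_def)
  then show ?thesis by blast
qed

text \<open>Existence is what makes the chosen state an actual solution for every control, so that
  the cost of an arbitrary competitor is meaningful.\<close>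

lemma obstacle_state:
  assumes "\<psi> \<in> H1_0 \<Omega>" "f \<in> L2 \<Omega>" "u \<in> L2 \<Omega>"
  shows "obstacle_solution \<Omega> \<psi> f u (obstacle_state \<Omega> \<psi> f u)"
  unfolding obstacle_state_def by (rule someI_ex[OF ex_obstacle_solution[OF assms]])

lemma dirichlet_form_eq_0:
  assumes "v \<in> H1_0 \<Omega>" "dirichlet_form \<Omega> v v \<le> 0"
  shows "AE x in lebesgue_on \<Omega>. v x = 0"
proof -
  obtain C where C: "C > 0" "\<And>v. v \<in> H1_0 \<Omega> \<Longrightarrow> (L2_norm \<Omega> v)\<^sup>2 \<le> C\<^sup>2 * dirichlet_form \<Omega> v v"
    using Poincare by blast
  note C(2)[OF assms(1)]
  moreover have "dirichlet_form \<Omega> v v = 0" using assms(2) dirichlet_form_nonneg[of v] by linarith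
  ultimately have "L2_norm \<Omega> v = 0" by simp
  then show ?thesis using L2_norm_eq_0_iff[OF H1_0_L2[OF assms(1)]] by simp
qed

text \<open>Each inequality is tested with the other solution; their sum makes the Dirichlet form of
  the difference nonpositive. This identifies the chosen state of \<open>u\<close> with the given
  \<open>y\<close>.\<close>

lemma obstacle_solution_unique:
  assumes F: "f \<in> L2 \<Omega>" "u \<in> L2 \<Omega>"
    and y: "obstacle_solution \<Omega> \<psi> f u y" and z: "obstacle_solution \<Omega> \<psi> f u z"
  shows "AE x in lebesgue_on \<Omega>. y x = z x"
proof -
  note FL = L2_add[OF F]
  have H: "y \<in> H1_0 \<Omega>" "z \<in> H1_0 \<Omega>" using y z by (auto simp: obstacle_solution_def admissible_def)
  note L = H[THEN H1_0_L2]
  have 1: "dirichlet_form \<Omega> y (\<lambda>x. z x - y x) \<ge> (\<integral>x. (f x + u x) * (z x - y x) \<partial>lebesgue_on \<Omega>)"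
    and 2: "dirichlet_form \<Omega> z (\<lambda>x. y x - z x) \<ge> (\<integral>x. (f x + u x) * (y x - z x) \<partial>lebesgue_on \<Omega>)"
    using y z by (auto simp: obstacle_solution_def)
  let ?e = "\<lambda>x. y x - z x"
  have e: "?e \<in> H1_0 \<Omega>" by (rule H1_0_diff[OF H])
  have "dirichlet_form \<Omega> ?e ?e = dirichlet_form \<Omega> y y - 2 * dirichlet_form \<Omega> y z + dirichlet_form \<Omega> z z"
    using dirichlet_form_diff[OF e H] dirichlet_form_diff[OF H(1) H] dirichlet_form_diff[OF H(2) H]
    by (simp add: dirichlet_form_commute[of ?e y] dirichlet_form_commute[of ?e z] dirichlet_form_commute[of z y])
  also have "\<dots> = - dirichlet_form \<Omega> y (\<lambda>x. z x - y x) - dirichlet_form \<Omega> z (\<lambda>x. y x - z x)"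
    using dirichlet_form_diff[OF H(1) H(2,1)] dirichlet_form_diff[OF H(2) H]
    by (simp add: dirichlet_form_commute[of z y])
  also have "\<dots> \<le> 0"
    using 1 2 unfolding L2_prod_diff_right[OF FL L(2,1)] L2_prod_diff_right[OF FL L] by linarith
  finally have "AE x in lebesgue_on \<Omega>. ?e x = 0" by (rule dirichlet_form_eq_0[OF e])
  then show ?thesis by eventually_elim simp
qed

subsection \<open>Strong stationarity and global minimality\<close>

lemma strongly_stationaryI:
  assumes \<psi>: "\<psi> \<in> H1_0 \<Omega>"
    and u: "u \<in> L2 \<Omega>" and y: "y \<in> H1_0 \<Omega>" and p: "p \<in> H1_0 \<Omega>"
    and \<xi>: "\<xi> \<in> H_minus1 \<Omega>" and \<mu>: "\<mu> \<in> H_minus1 \<Omega>"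
    and state: "state_equation \<Omega> f u y \<xi>" and compl: "complementarity \<Omega> \<psi> y \<xi>"
    and adj: "\<forall>\<phi>\<in>H1_0 \<Omega>. dirichlet_form \<Omega> p \<phi> =
           (\<integral>x. (y x - y\<^sub>0 x) * \<phi> x \<partial>lebesgue_on \<Omega>) - \<mu> \<phi>"
    and \<xi>p: "\<xi> p = 0" and \<mu>y: "\<mu> (\<lambda>x. y x - \<psi> x) = 0"
    and up: "AE x in lebesgue_on \<Omega>. \<alpha> * u x + p x = 0"
    and p_ge: "AE x in lebesgue_on \<Omega>. p x \<ge> \<eta> * (y x - \<psi> x)"
    and \<mu>_ge: "nonneg_functional \<Omega> (\<lambda>\<phi>. \<mu> \<phi> - \<eta> * \<xi> \<phi>)"
  shows "strongly_stationary \<Omega> \<psi> y\<^sub>0 f \<alpha> u y \<xi>"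
proof -
  let ?M = "lebesgue_on \<Omega>"
  have y\<psi>: "AE x in ?M. y x \<ge> \<psi> x" and \<xi>y: "\<xi> (\<lambda>x. y x - \<psi> x) = 0"
    using compl by (auto simp: complementarity_def)
  define w where "w x = y x - \<psi> x" for x
  have w: "w \<in> H1_0 \<Omega>" unfolding w_def by (rule H1_0_diff[OF y \<psi>])
  \<comment> \<open>The contact set compares the chosen representatives of \<open>y\<close> and
    \<psi>. Their difference, rather than the chosen representative of \<open>y - \<psi>\<close>,
    describes the contact set exactly.\<close>
  define w' where "w' x = 1 * qc_rep \<Omega> y x + (-1) * qc_rep \<Omega> \<psi> x" for x
  have w'_qc: "quasi_continuous \<Omega> w'"
    unfolding w'_def by (rule quasi_continuous_linear[OF qc_rep(1)[OF y] qc_rep(1)[OF \<psi>]])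
  have w'_AE: "AE x in ?M. w' x = w x"
    using qc_rep(2)[OF y] qc_rep(2)[OF \<psi>] by eventually_elim (simp add: w'_def w_def)
  have contact: "x \<in> contact_set \<Omega> \<psi> y \<longleftrightarrow> x \<in> \<Omega> \<and> w' x = 0" for x
    by (auto simp: contact_set_def w'_def)
  have p_cone: "p \<in> critical_cone \<Omega> \<psi> y \<xi>"
  proof -
    \<comment> \<open>A quasi-continuous version of \<open>p - \<eta> (y - \<psi>)\<close>: the sign
      condition on \<open>p\<close> improves from almost everywhere to quasi-everywhere, and on the
      contact set \<open>q\<close> reduces to the representative of \<open>p\<close>.\<close>
    define q where "q x = 1 * qc_rep \<Omega> p x + (- \<eta>) * w' x" for x
    have "quasi_continuous \<Omega> q"
      unfolding q_def by (rule quasi_continuous_linear[OF qc_rep(1)[OF p] w'_qc])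
    moreover have "AE x in ?M. q x \<ge> 0"
      using qc_rep(2)[OF p] w'_AE p_ge by eventually_elim (simp add: q_def w_def)
    ultimately have "capacity \<Omega> {x\<in>\<Omega>. q x < 0} = 0" by (rule quasi_continuous_nonneg)
    moreover have "capacity \<Omega> {x\<in>\<Omega>. \<not> (x \<in> contact_set \<Omega> \<psi> y \<longrightarrow> qc_rep \<Omega> p x \<ge> 0)} \<le>
        capacity \<Omega> {x\<in>\<Omega>. q x < 0}"
      by (rule capacity_mono) (auto simp: contact q_def)
    ultimately show ?thesis
      using p \<xi>p by (simp add: critical_cone_def quasi_everywhere_def)
  qed
  have adj_le: "dirichlet_form \<Omega> p \<phi> \<le> (\<integral>x. (y x - y\<^sub>0 x) * \<phi> x \<partial>?M)"
    if "\<phi> \<in> critical_cone \<Omega> \<psi> y \<xi>" for \<phi>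
  proof -
    have \<phi>: "\<phi> \<in> H1_0 \<Omega>" "\<xi> \<phi> = 0"
      "capacity \<Omega> {x\<in>\<Omega>. \<not> (x \<in> contact_set \<Omega> \<psi> y \<longrightarrow> qc_rep \<Omega> \<phi> x \<ge> 0)} = 0"
      using that by (auto simp: critical_cone_def quasi_everywhere_def)
    have "capacity \<Omega> {x\<in>\<Omega>. w' x = 0 \<and> qc_rep \<Omega> \<phi> x < 0} \<le>
        capacity \<Omega> {x\<in>\<Omega>. \<not> (x \<in> contact_set \<Omega> \<psi> y \<longrightarrow> qc_rep \<Omega> \<phi> x \<ge> 0)}"
      by (rule capacity_mono) (auto simp: contact)
    then have cap: "capacity \<Omega> {x\<in>\<Omega>. w' x = 0 \<and> qc_rep \<Omega> \<phi> x < 0} = 0" using \<phi>(3) by simp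
    have "AE x in ?M. w x \<ge> 0" using y\<psi> by eventually_elim (simp add: w_def)
    moreover have "\<mu> w - \<eta> * \<xi> w = 0"
      using \<mu>y \<xi>y by (simp add: w_def[abs_def])
    \<comment> \<open>Elements of the critical cone are annihilated by \<xi>, so this is the sign of
      \<open>\<mu> \<phi>\<close>, and the adjoint equation turns it into the desired
      inequality.\<close>
    ultimately have "\<mu> \<phi> - \<eta> * \<xi> \<phi> \<ge> 0"
      by (rule nonneg_functional_on_contact_set[OF H_minus1_combination[OF \<mu> \<xi>] \<mu>_ge w _ _ \<phi>(1)
            w'_qc w'_AE qc_rep[OF \<phi>(1)] cap])
    then show ?thesis using adj \<phi>(1,2) by simp
  qed
  show ?thesis
    unfolding strongly_stationary_def using u y \<xi> p state compl p_cone adj_le up by blast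
qed

text \<open>Complementarity allows \<open>\<phi> - y\<close> to be replaced by
  \<open>\<phi> - \<psi>\<close> inside \<xi>, where nonnegativity applies.\<close>

lemma obstacle_solutionI:
  assumes \<psi>: "\<psi> \<in> H1_0 \<Omega>" and y: "y \<in> H1_0 \<Omega>" and \<xi>: "\<xi> \<in> H_minus1 \<Omega>"
    and state: "state_equation \<Omega> f u y \<xi>" and compl: "complementarity \<Omega> \<psi> y \<xi>"
  shows "obstacle_solution \<Omega> \<psi> f u y"
  unfolding obstacle_solution_def
proof (intro conjI ballI)
  show "y \<in> admissible \<Omega> \<psi>" using y compl by (simp add: admissible_def complementarity_def)
  fix \<phi> assume "\<phi> \<in> admissible \<Omega> \<psi>"
  then have \<phi>: "\<phi> \<in> H1_0 \<Omega>" "AE x in lebesgue_on \<Omega>. \<phi> x \<ge> \<psi> x" by (auto simp: admissible_def)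
  have "AE x in lebesgue_on \<Omega>. 0 \<le> \<phi> x - \<psi> x" using \<phi>(2) by eventually_elim simp
  then have "0 \<le> \<xi> (\<lambda>x. \<phi> x - \<psi> x)"
    using compl H1_0_diff[OF \<phi>(1) \<psi>] by (auto simp: complementarity_def nonneg_functional_def)
  moreover have "\<xi> (\<lambda>x. y x - \<psi> x) = 0" using compl by (simp add: complementarity_def)
  ultimately have "0 \<le> \<xi> (\<lambda>x. \<phi> x - y x)"
    using H_minus1_diff[OF \<xi> \<phi>(1) \<psi>] H_minus1_diff[OF \<xi> y \<psi>] H_minus1_diff[OF \<xi> \<phi>(1) y] by linarith
  then show "(\<integral>x. (f x + u x) * (\<phi> x - y x) \<partial>lebesgue_on \<Omega>) \<le> dirichlet_form \<Omega> y (\<lambda>x. \<phi> x - y x)"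
    using state H1_0_diff[OF \<phi>(1) y] by (simp add: state_equation_def)
qed

text \<open>Testing with \<open>z + \<phi>\<close> gives the sign of the residual of the state
  equation, and testing with \<psi> gives the opposite sign on \<open>z - \<psi>\<close>, hence
  complementarity.\<close>

lemma obstacle_multiplier:
  assumes \<psi>: "\<psi> \<in> H1_0 \<Omega>" and F: "f \<in> L2 \<Omega>" "v \<in> L2 \<Omega>" and z: "obstacle_solution \<Omega> \<psi> f v z"
  shows "\<And>\<phi>. \<phi> \<in> H1_0 \<Omega> \<Longrightarrow> AE x in lebesgue_on \<Omega>. \<phi> x \<ge> 0 \<Longrightarrow>
      (\<integral>x. (f x + v x) * \<phi> x \<partial>lebesgue_on \<Omega>) \<le> dirichlet_form \<Omega> z \<phi>"
    and "dirichlet_form \<Omega> z (\<lambda>x. z x - \<psi> x) = (\<integral>x. (f x + v x) * (z x - \<psi> x) \<partial>lebesgue_on \<Omega>)"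
proof -
  let ?M = "lebesgue_on \<Omega>"
  have zH: "z \<in> H1_0 \<Omega>" and z\<psi>: "AE x in ?M. z x \<ge> \<psi> x"
    and VI: "\<And>\<phi>. \<phi> \<in> H1_0 \<Omega> \<Longrightarrow> AE x in ?M. \<phi> x \<ge> \<psi> x \<Longrightarrow>
      (\<integral>x. (f x + v x) * (\<phi> x - z x) \<partial>?M) \<le> dirichlet_form \<Omega> z (\<lambda>x. \<phi> x - z x)"
    using z by (auto simp: obstacle_solution_def admissible_def)
  show nn: "(\<integral>x. (f x + v x) * \<phi> x \<partial>?M) \<le> dirichlet_form \<Omega> z \<phi>"
    if "\<phi> \<in> H1_0 \<Omega>" "AE x in ?M. \<phi> x \<ge> 0" for \<phi>
  proof -
    have "AE x in ?M. z x + \<phi> x \<ge> \<psi> x" using that(2) z\<psi> by eventually_elim simp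
    from VI[OF H1_0_add[OF zH that(1)] this] show ?thesis by simp
  qed
  have "AE x in ?M. z x - \<psi> x \<ge> 0" using z\<psi> by eventually_elim simp
  from nn[OF H1_0_diff[OF zH \<psi>] this]
  have "(\<integral>x. (f x + v x) * (z x - \<psi> x) \<partial>?M) \<le> dirichlet_form \<Omega> z (\<lambda>x. z x - \<psi> x)" .
  moreover have "(\<integral>x. (f x + v x) * (\<psi> x - z x) \<partial>?M) \<le> dirichlet_form \<Omega> z (\<lambda>x. \<psi> x - z x)"
    by (rule VI[OF \<psi>]) simp
  ultimately show "dirichlet_form \<Omega> z (\<lambda>x. z x - \<psi> x) = (\<integral>x. (f x + v x) * (z x - \<psi> x) \<partial>?M)"
    unfolding L2_prod_diff_right[OF L2_add[OF F] H1_0_L2[OF zH] H1_0_L2[OF \<psi>]]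
      L2_prod_diff_right[OF L2_add[OF F] H1_0_L2[OF \<psi>] H1_0_L2[OF zH]]
      dirichlet_form_diff[OF zH zH \<psi>] dirichlet_form_diff[OF zH \<psi> zH] by linarith
qed

section \<open>Comparison of the cost of a competitor with the cost of \<open>u\<close>\<close>

lemma L2_norm_sq_expand:
  fixes v w :: "'a \<Rightarrow> real"
  assumes v: "v \<in> L2 \<Omega>" and w: "w \<in> L2 \<Omega>"
  shows "(L2_norm \<Omega> (\<lambda>x. v x + w x))\<^sup>2 =
    (L2_norm \<Omega> v)\<^sup>2 + 2 * (\<integral>x. v x * w x \<partial>lebesgue_on \<Omega>) + (L2_norm \<Omega> w)\<^sup>2"
proof -
  have sq: "(L2_norm \<Omega> g)\<^sup>2 = (\<integral>x. g x * g x \<partial>lebesgue_on \<Omega>)" for g :: "'a \<Rightarrow> real"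
    unfolding L2_norm_sq_real by (simp add: power2_eq_square)
  have "(\<lambda>x. (v x + w x) * (v x + w x)) = (\<lambda>x. v x * v x + 2 * (v x * w x) + w x * w x)"
    by (simp add: algebra_simps)
  then show ?thesis
    unfolding sq using L2_mult_integrable[OF v v] L2_mult_integrable[OF v w] L2_mult_integrable[OF w w] by simp
qed

lemma cost_difference:
  assumes \<psi>: "\<psi> \<in> H1_0 \<Omega>" and y0: "y\<^sub>0 \<in> L2 \<Omega>" and f: "f \<in> L2 \<Omega>"
    and u: "u \<in> L2 \<Omega>" and y: "y \<in> H1_0 \<Omega>" and p: "p \<in> H1_0 \<Omega>"
    and \<xi>: "\<xi> \<in> H_minus1 \<Omega>" and \<mu>: "\<mu> \<in> H_minus1 \<Omega>" and \<eta>: "\<eta> \<le> 0"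
    and state: "state_equation \<Omega> f u y \<xi>" and compl: "complementarity \<Omega> \<psi> y \<xi>"
    and adj: "\<forall>\<phi>\<in>H1_0 \<Omega>. dirichlet_form \<Omega> p \<phi> =
           (\<integral>x. (y x - y\<^sub>0 x) * \<phi> x \<partial>lebesgue_on \<Omega>) - \<mu> \<phi>"
    and \<xi>p: "\<xi> p = 0" and \<mu>y: "\<mu> (\<lambda>x. y x - \<psi> x) = 0"
    and up: "AE x in lebesgue_on \<Omega>. \<alpha> * u x + p x = 0"
    and p_ge: "AE x in lebesgue_on \<Omega>. p x \<ge> \<eta> * (y x - \<psi> x)"
    and \<mu>_ge: "nonneg_functional \<Omega> (\<lambda>\<phi>. \<mu> \<phi> - \<eta> * \<xi> \<phi>)"
    and v: "v \<in> L2 \<Omega>"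
  obtains e where "e \<in> H1_0 \<Omega>"
    "cost \<Omega> \<psi> y\<^sub>0 f \<alpha> v - cost \<Omega> \<psi> y\<^sub>0 f \<alpha> u \<ge> 1/2 * (L2_norm \<Omega> e)\<^sup>2 + \<alpha>/2 * (L2_norm \<Omega> (\<lambda>x. v x - u x))\<^sup>2
      + \<bar>\<eta>\<bar> * dirichlet_form \<Omega> e e - \<bar>\<eta>\<bar> * (\<integral>x. (v x - u x) * e x \<partial>lebesgue_on \<Omega>)"
proof -
  let ?M = "lebesgue_on \<Omega>" and ?D = "dirichlet_form \<Omega>"
  have \<xi>y: "\<xi> (\<lambda>x. y x - \<psi> x) = 0" using compl by (simp add: complementarity_def)
  have st: "?D y \<phi> = (\<integral>x. (f x + u x) * \<phi> x \<partial>?M) + \<xi> \<phi>" if "\<phi> \<in> H1_0 \<Omega>" for \<phi>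
    using state that by (simp add: state_equation_def)
  define z where "z = obstacle_state \<Omega> \<psi> f v"
  have zs: "obstacle_solution \<Omega> \<psi> f v z" unfolding z_def by (rule obstacle_state[OF \<psi> f v])
  then have z: "z \<in> H1_0 \<Omega>" and z\<psi>: "AE x in ?M. z x \<ge> \<psi> x"
    by (auto simp: obstacle_solution_def admissible_def)
  note mult = obstacle_multiplier[OF \<psi> f v zs]
  define \<zeta> where "\<zeta> \<phi> = ?D z \<phi> - (\<integral>x. (f x + v x) * \<phi> x \<partial>?M)" for \<phi>
  define e where "e x = z x - y x" for x
  define w where "w x = v x - u x" for x
  have e: "e \<in> H1_0 \<Omega>" unfolding e_def by (rule H1_0_diff[OF z y])
  have w: "w \<in> L2 \<Omega>" unfolding w_def by (rule L2_diff[OF v u])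
  note L = H1_0_L2[OF y] H1_0_L2[OF z] H1_0_L2[OF p] H1_0_L2[OF e] H1_0_L2[OF \<psi>]
  note fv = L2_add[OF f v] and fu = L2_add[OF f u]
  have \<zeta>_diff: "\<zeta> (\<lambda>x. a x - b x) = \<zeta> a - \<zeta> b" if "a \<in> H1_0 \<Omega>" "b \<in> H1_0 \<Omega>" for a b
    unfolding \<zeta>_def dirichlet_form_diff[OF z that] L2_prod_diff_right[OF fv that[THEN H1_0_L2]] by simp
  have \<zeta>_cmult: "\<zeta> (\<lambda>x. c * a x) = c * \<zeta> a" if "a \<in> H1_0 \<Omega>" for a c
    unfolding \<zeta>_def dirichlet_form_cmult[OF z that] L2_prod_cmult_right by (simp add: right_diff_distrib)
  have y\<psi>: "(\<lambda>x. y x - \<psi> x) \<in> H1_0 \<Omega>" by (rule H1_0_diff[OF y \<psi>])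
  have De: "?D e \<phi> = ?D z \<phi> - ?D y \<phi>" if "\<phi> \<in> H1_0 \<Omega>" for \<phi>
    unfolding e_def[abs_def]
      dirichlet_form_commute[of z \<phi>] dirichlet_form_commute[of y \<phi>] dirichlet_form_commute[of "\<lambda>x. z x - y x" \<phi>]
    by (rule dirichlet_form_diff[OF that z y])
  have Fw: "(\<integral>x. (f x + v x) * \<phi> x \<partial>?M) - (\<integral>x. (f x + u x) * \<phi> x \<partial>?M) = (\<integral>x. w x * \<phi> x \<partial>?M)"
    if "\<phi> \<in> L2 \<Omega>" for \<phi>
    using L2_mult_integrable[OF fv that] L2_mult_integrable[OF fu that]
    by (simp add: w_def Bochner_Integration.integral_diff[symmetric] left_diff_distrib[symmetric])
  \<comment> \<open>The functional \<zeta> is nonnegative, so it can be applied to the sign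
    condition on \<open>p\<close>.\<close>
  have zeta_p: "\<zeta> p \<ge> \<eta> * \<zeta> (\<lambda>x. y x - \<psi> x)"
  proof -
    have "AE x in ?M. p x - \<eta> * (y x - \<psi> x) \<ge> 0" using p_ge by eventually_elim simp
    then have "\<zeta> (\<lambda>x. p x - \<eta> * (y x - \<psi> x)) \<ge> 0"
      unfolding \<zeta>_def using mult(1)[OF H1_0_diff[OF p H1_0_cmult[OF y\<psi>]]] by simp
    then show ?thesis using \<zeta>_diff[OF p H1_0_cmult[OF y\<psi>]] \<zeta>_cmult[OF y\<psi>] by simp
  qed
  \<comment> \<open>Complementarity of the competitor, \<open>\<zeta> (z - \<psi>) = 0\<close>,
    moves the obstacle out of the expression.\<close>
  have zeta_y: "\<zeta> (\<lambda>x. y x - \<psi> x) = - \<zeta> e"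
    using mult(2) \<zeta>_diff[OF z \<psi>] \<zeta>_diff[OF y \<psi>] \<zeta>_diff[OF z y]
    unfolding e_def[abs_def] by (simp add: \<zeta>_def)
  \<comment> \<open>The sign condition on \<mu> is applied to \<open>z - \<psi>\<close>; as \<mu>
    and \<xi> annihilate \<open>y - \<psi>\<close>, the obstacle drops out.\<close>
  have mu_e: "\<mu> e \<ge> \<eta> * \<xi> e"
  proof -
    have "AE x in ?M. z x - \<psi> x \<ge> 0" using z\<psi> by eventually_elim simp
    then have "\<mu> (\<lambda>x. z x - \<psi> x) - \<eta> * \<xi> (\<lambda>x. z x - \<psi> x) \<ge> 0"
      using \<mu>_ge H1_0_diff[OF z \<psi>] by (auto simp: nonneg_functional_def)
    moreover have "\<mu> (\<lambda>x. z x - \<psi> x) = \<mu> e" "\<xi> (\<lambda>x. z x - \<psi> x) = \<xi> e"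
      using \<mu>y \<xi>y H_minus1_diff[OF \<mu> z \<psi>] H_minus1_diff[OF \<mu> y \<psi>] H_minus1_diff[OF \<mu> z y]
        H_minus1_diff[OF \<xi> z \<psi>] H_minus1_diff[OF \<xi> y \<psi>] H_minus1_diff[OF \<xi> z y]
      unfolding e_def[abs_def] by simp_all
    ultimately show ?thesis by simp
  qed
  \<comment> \<open>The difference of the two state equations, tested with the difference of the
    states.\<close>
  have xi_zeta: "\<xi> e - \<zeta> e = (\<integral>x. w x * e x \<partial>?M) - ?D e e"
    unfolding \<zeta>_def De[OF e] Fw[OF L(4), symmetric] using st[OF e] by simp
  have De_p: "?D e p = \<zeta> p + (\<integral>x. w x * p x \<partial>?M)"
    unfolding \<zeta>_def De[OF p] Fw[OF L(3), symmetric] using st[OF p] \<xi>p by simp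
  have adj_e: "(\<integral>x. (y x - y\<^sub>0 x) * e x \<partial>?M) = ?D e p + \<mu> e"
    using adj e by (simp add: dirichlet_form_commute[of e p])
  \<comment> \<open>The relation between control and adjoint state cancels the mixed term of the
    control cost against the \<open>w p\<close> term in \<open>De_p\<close>.\<close>
  have uw: "\<alpha> * (\<integral>x. u x * w x \<partial>?M) = - (\<integral>x. w x * p x \<partial>?M)"
  proof -
    have "(\<integral>x. \<alpha> * (u x * w x) \<partial>?M) = (\<integral>x. - (w x * p x) \<partial>?M)"
    proof (rule integral_cong_AE)
      show "(\<lambda>x. \<alpha> * (u x * w x)) \<in> borel_measurable ?M" "(\<lambda>x. - (w x * p x)) \<in> borel_measurable ?M"
        using L2_measurable[OF u] L2_measurable[OF w] L2_measurable[OF L(3)] by measurable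
      show "AE x in ?M. \<alpha> * (u x * w x) = - (w x * p x)"
        using up
      proof eventually_elim
        case (elim x)
        then have "p x = - (\<alpha> * u x)" by linarith
        then show ?case by simp
      qed
    qed
    then show ?thesis by simp
  qed
  have cost_v: "cost \<Omega> \<psi> y\<^sub>0 f \<alpha> v = 1/2 * (L2_norm \<Omega> (\<lambda>x. y x - y\<^sub>0 x))\<^sup>2 + (\<integral>x. (y x - y\<^sub>0 x) * e x \<partial>?M)
      + 1/2 * (L2_norm \<Omega> e)\<^sup>2 + \<alpha>/2 * (L2_norm \<Omega> u)\<^sup>2 + \<alpha> * (\<integral>x. u x * w x \<partial>?M) + \<alpha>/2 * (L2_norm \<Omega> w)\<^sup>2"
  proof -
    have "(\<lambda>x. z x - y\<^sub>0 x) = (\<lambda>x. (y x - y\<^sub>0 x) + e x)" "v = (\<lambda>x. u x + w x)"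
      by (auto simp: e_def w_def)
    then have "(L2_norm \<Omega> (\<lambda>x. z x - y\<^sub>0 x))\<^sup>2 = (L2_norm \<Omega> (\<lambda>x. y x - y\<^sub>0 x))\<^sup>2 +
        2 * (\<integral>x. (y x - y\<^sub>0 x) * e x \<partial>?M) + (L2_norm \<Omega> e)\<^sup>2"
      "(L2_norm \<Omega> v)\<^sup>2 = (L2_norm \<Omega> u)\<^sup>2 + 2 * (\<integral>x. u x * w x \<partial>?M) + (L2_norm \<Omega> w)\<^sup>2"
      using L2_norm_sq_expand[OF L2_diff[OF L(1) y0] L(4)] L2_norm_sq_expand[OF u w] by simp_all
    then show ?thesis unfolding cost_def z_def[symmetric] by (simp add: algebra_simps)
  qed
  \<comment> \<open>The cost is computed from a chosen state, which agrees with \<open>y\<close>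
    only almost everywhere.\<close>
  have cost_u: "cost \<Omega> \<psi> y\<^sub>0 f \<alpha> u = 1/2 * (L2_norm \<Omega> (\<lambda>x. y x - y\<^sub>0 x))\<^sup>2 + \<alpha>/2 * (L2_norm \<Omega> u)\<^sup>2"
  proof -
    let ?s = "obstacle_state \<Omega> \<psi> f u"
    have s: "obstacle_solution \<Omega> \<psi> f u ?s" by (rule obstacle_state[OF \<psi> f u])
    then have sL: "?s \<in> L2 \<Omega>" using H1_0_L2 by (auto simp: obstacle_solution_def admissible_def)
    have "AE x in ?M. ?s x = y x"
      by (rule obstacle_solution_unique[OF f u s obstacle_solutionI[OF \<psi> y \<xi> state compl]])
    then have "AE x in ?M. ?s x - y\<^sub>0 x = y x - y\<^sub>0 x" by eventually_elim simp
    then have "L2_norm \<Omega> (\<lambda>x. ?s x - y\<^sub>0 x) = L2_norm \<Omega> (\<lambda>x. y x - y\<^sub>0 x)"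
      by (rule L2_norm_cong[OF _ L2_diff[OF sL y0] L2_diff[OF L(1) y0]])
    then show ?thesis by (simp add: cost_def)
  qed
  have "cost \<Omega> \<psi> y\<^sub>0 f \<alpha> v - cost \<Omega> \<psi> y\<^sub>0 f \<alpha> u =
      1/2 * (L2_norm \<Omega> e)\<^sup>2 + \<alpha>/2 * (L2_norm \<Omega> w)\<^sup>2 + \<zeta> p + \<mu> e"
    unfolding cost_v cost_u using De_p adj_e uw by linarith
  moreover have "\<zeta> p + \<mu> e \<ge> \<bar>\<eta>\<bar> * ?D e e - \<bar>\<eta>\<bar> * (\<integral>x. w x * e x \<partial>?M)"
  proof -
    have "\<zeta> p + \<mu> e \<ge> \<eta> * (\<xi> e - \<zeta> e)"
      using zeta_p mu_e unfolding zeta_y by (simp add: right_diff_distrib)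
    then show ?thesis using \<eta> unfolding xi_zeta by (simp add: algebra_simps)
  qed
  ultimately show ?thesis using that[OF e] by (simp add: w_def[abs_def])
qed

end

text \<open>The bound is the larger root of \<open>t^2 - 2 a l t - a\<close>. The smaller root is
  negative since \<open>a > 0\<close>, so a nonnegative \<open>t\<close> below the larger root lies
  between the two, whatever the sign of \<open>l\<close>.\<close>

lemma quadratic_root_bound:
  fixes t a l :: real
  assumes "t \<ge> 0" "a > 0"
  shows "t \<le> a * l + sqrt (a\<^sup>2 * l\<^sup>2 + a) \<Longrightarrow> t\<^sup>2 \<le> a + 2 * a * l * t"
    and "t < a * l + sqrt (a\<^sup>2 * l\<^sup>2 + a) \<Longrightarrow> t\<^sup>2 < a + 2 * a * l * t"
proof -
  let ?s = "sqrt (a\<^sup>2 * l\<^sup>2 + a)"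
  have s2: "?s\<^sup>2 = (a * l)\<^sup>2 + a" using assms by (simp add: power_mult_distrib add_nonneg_pos less_imp_le)
  have al: "a * l < ?s"
    by (rule real_less_rsqrt) (use assms in \<open>simp add: power_mult_distrib\<close>)
  show "t\<^sup>2 \<le> a + 2 * a * l * t" if "t \<le> a * l + ?s"
  proof -
    have "\<bar>t - a * l\<bar> \<le> \<bar>?s\<bar>" using that al assms by linarith
    then have "(t - a * l)\<^sup>2 \<le> ?s\<^sup>2" by (simp only: abs_le_square_iff)
    then show ?thesis unfolding s2 by (simp add: power2_diff algebra_simps)
  qed
  show "t\<^sup>2 < a + 2 * a * l * t" if "t < a * l + ?s"
  proof -
    have "\<bar>t - a * l\<bar> < \<bar>?s\<bar>" using that al assms by linarith
    then have "\<bar>t - a * l\<bar>\<^sup>2 < \<bar>?s\<bar>\<^sup>2" by (rule power_strict_mono) auto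
    then have "(t - a * l)\<^sup>2 < ?s\<^sup>2" by (simp only: power2_abs)
    then show ?thesis unfolding s2 by (simp add: power2_diff algebra_simps)
  qed
qed

text \<open>Multiplication by \<open>2 a\<close> completes the square in \<open>W\<close>. What is
  left is a multiple of \<open>E^2\<close> whose coefficient has the sign provided by the hypothesis
  on \<open>t\<close>; if it is positive, equality forces first \<open>E\<close> and then
  \<open>W\<close> to vanish.\<close>

lemma quadratic_form_nonneg:
  fixes a t l E W Q :: real
  assumes a: "a > 0" and t: "t\<^sup>2 \<le> a + 2 * a * l * t"
    and Q: "Q \<ge> 1/2 * E\<^sup>2 + a/2 * W\<^sup>2 + t * (l * E\<^sup>2) - t * (W * E)"
  shows "Q \<ge> 0" and "t\<^sup>2 < a + 2 * a * l * t \<Longrightarrow> Q \<le> 0 \<Longrightarrow> W = 0"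
proof -
  let ?R = "1/2 * E\<^sup>2 + a/2 * W\<^sup>2 + t * (l * E\<^sup>2) - t * (W * E)"
  have eq: "2 * a * ?R = (a + 2 * a * l * t - t\<^sup>2) * E\<^sup>2 + (t * E - a * W)\<^sup>2"
    by (simp add: power2_eq_square algebra_simps)
  have "2 * a * ?R \<ge> 0" unfolding eq using t by simp
  then show "Q \<ge> 0" using a Q by (simp add: zero_le_mult_iff)
  assume s: "t\<^sup>2 < a + 2 * a * l * t" and "Q \<le> 0"
  then have "2 * a * ?R \<le> 0" using a Q by (simp add: mult_le_0_iff)
  then have z: "(a + 2 * a * l * t - t\<^sup>2) * E\<^sup>2 + (t * E - a * W)\<^sup>2 \<le> 0" unfolding eq .
  have "(a + 2 * a * l * t - t\<^sup>2) * E\<^sup>2 \<ge> 0" "(t * E - a * W)\<^sup>2 \<ge> 0" using t by simp_all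
  with z have "(a + 2 * a * l * t - t\<^sup>2) * E\<^sup>2 = 0" "(t * E - a * W)\<^sup>2 = 0" by linarith+
  then show "W = 0" using s a by simp
qed

theorem theorem3p2:
  fixes \<Omega> :: "'a::euclidean_space set"
    and \<psi> y\<^sub>0 f u y p :: "'a \<Rightarrow> real"
    and \<xi> \<mu> :: "('a \<Rightarrow> real) \<Rightarrow> real"
    and \<alpha> \<eta> :: real
  assumes "DIM('a) = 2 \<or> DIM('a) = 3"
    and "polyhedral_domain \<Omega>"
    and "\<psi> \<in> H1_0 \<Omega> \<inter> H2 \<Omega>"
    and "y\<^sub>0 \<in> L2 \<Omega>" and "f \<in> L2 \<Omega>"
    and "\<alpha> > 0"
    and "u \<in> L2 \<Omega>" and "y \<in> H1_0 \<Omega>" and "p \<in> H1_0 \<Omega>"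
    and "\<xi> \<in> H_minus1 \<Omega>" and "\<mu> \<in> H_minus1 \<Omega>"
    and "\<eta> \<le> 0"
    and "\<forall>\<phi>\<in>H1_0 \<Omega>. dirichlet_form \<Omega> y \<phi> =
           (\<integral>x. (f x + u x) * \<phi> x \<partial>lebesgue_on \<Omega>) + \<xi> \<phi>"
    and "AE x in lebesgue_on \<Omega>. y x \<ge> \<psi> x"
    and "nonneg_functional \<Omega> \<xi>"
    and "\<xi> (\<lambda>x. y x - \<psi> x) = 0"
    and "\<forall>\<phi>\<in>H1_0 \<Omega>. dirichlet_form \<Omega> p \<phi> =
           (\<integral>x. (y x - y\<^sub>0 x) * \<phi> x \<partial>lebesgue_on \<Omega>) - \<mu> \<phi>"
    and "\<xi> p = 0"
    and "\<mu> (\<lambda>x. y x - \<psi> x) = 0"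
    and "AE x in lebesgue_on \<Omega>. \<alpha> * u x + p x = 0"
    and "AE x in lebesgue_on \<Omega>. p x \<ge> \<eta> * (y x - \<psi> x)"
    and "nonneg_functional \<Omega> (\<lambda>\<phi>. \<mu> \<phi> - \<eta> * \<xi> \<phi>)"
  shows "strongly_stationary \<Omega> \<psi> y\<^sub>0 f \<alpha> u y \<xi> \<and>
    (\<bar>\<eta>\<bar> \<le> \<alpha> * lambda1 \<Omega> + sqrt (\<alpha>\<^sup>2 * (lambda1 \<Omega>)\<^sup>2 + \<alpha>) \<longrightarrow>
       global_minimum \<Omega> \<psi> y\<^sub>0 f \<alpha> u) \<and>
    (\<bar>\<eta>\<bar> < \<alpha> * lambda1 \<Omega> + sqrt (\<alpha>\<^sup>2 * (lambda1 \<Omega>)\<^sup>2 + \<alpha>) \<longrightarrow>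
       unique_global_minimum \<Omega> \<psi> y\<^sub>0 f \<alpha> u)"
proof -
  interpret bounded_open \<Omega>
    using assms(2) by unfold_locales (auto simp: polyhedral_domain_def)
  let ?l = "lambda1 \<Omega>" and ?t = "\<bar>\<eta>\<bar>"
  have \<psi>: "\<psi> \<in> H1_0 \<Omega>" using assms(3) by simp
  have state: "state_equation \<Omega> f u y \<xi>" using assms(13) by (simp add: state_equation_def)
  have compl: "complementarity \<Omega> \<psi> y \<xi>" using assms(14-16) by (simp add: complementarity_def)
  have stat: "strongly_stationary \<Omega> \<psi> y\<^sub>0 f \<alpha> u y \<xi>"
    by (rule strongly_stationaryI[OF \<psi> assms(7-11) state compl assms(17-22)])
  \<comment> \<open>The first eigenvalue and Cauchy-Schwarz reduce the comparison to two numbers,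
    \<open>E\<close> for the states and the norm of \<open>v - u\<close>. Both estimates are
    multiplied by \<bar>\<eta>\<bar>, which keeps their direction.\<close>
  have diff: "\<exists>E. cost \<Omega> \<psi> y\<^sub>0 f \<alpha> v - cost \<Omega> \<psi> y\<^sub>0 f \<alpha> u \<ge> 1/2 * E\<^sup>2 +
      \<alpha>/2 * (L2_norm \<Omega> (\<lambda>x. v x - u x))\<^sup>2 + ?t * (?l * E\<^sup>2) - ?t * (L2_norm \<Omega> (\<lambda>x. v x - u x) * E)"
    if v: "v \<in> L2 \<Omega>" for v
  proof -
    obtain e where e: "e \<in> H1_0 \<Omega>"
      "cost \<Omega> \<psi> y\<^sub>0 f \<alpha> v - cost \<Omega> \<psi> y\<^sub>0 f \<alpha> u \<ge> 1/2 * (L2_norm \<Omega> e)\<^sup>2 + \<alpha>/2 * (L2_norm \<Omega> (\<lambda>x. v x - u x))\<^sup>2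
      + ?t * dirichlet_form \<Omega> e e - ?t * (\<integral>x. (v x - u x) * e x \<partial>lebesgue_on \<Omega>)"
      using cost_difference[OF \<psi> assms(4,5,7-12) state compl assms(17-22) v] by blast
    have "?t * (?l * (L2_norm \<Omega> e)\<^sup>2) \<le> ?t * dirichlet_form \<Omega> e e"
      by (intro mult_left_mono lambda1_le e) simp
    moreover have "?t * (\<integral>x. (v x - u x) * e x \<partial>lebesgue_on \<Omega>) \<le> ?t * (L2_norm \<Omega> (\<lambda>x. v x - u x) * L2_norm \<Omega> e)"
      using L2_Cauchy_Schwarz_real[OF L2_diff[OF v assms(7)] H1_0_L2[OF e(1)]]
      by (intro mult_left_mono) auto
    ultimately show ?thesis using e(2) by (intro exI[of _ "L2_norm \<Omega> e"]) linarith
  qed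
  have glob: "global_minimum \<Omega> \<psi> y\<^sub>0 f \<alpha> u" if "?t \<le> \<alpha> * ?l + sqrt (\<alpha>\<^sup>2 * ?l\<^sup>2 + \<alpha>)"
    unfolding global_minimum_def
  proof (intro conjI ballI assms(7))
    fix v :: "'a \<Rightarrow> real" assume "v \<in> L2 \<Omega>"
    then obtain E where "cost \<Omega> \<psi> y\<^sub>0 f \<alpha> v - cost \<Omega> \<psi> y\<^sub>0 f \<alpha> u \<ge> 1/2 * E\<^sup>2 +
      \<alpha>/2 * (L2_norm \<Omega> (\<lambda>x. v x - u x))\<^sup>2 + ?t * (?l * E\<^sup>2) - ?t * (L2_norm \<Omega> (\<lambda>x. v x - u x) * E)"
      using diff by blast
    from quadratic_form_nonneg(1)[OF assms(6) quadratic_root_bound(1)[OF abs_ge_zero assms(6) that] this]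
    show "cost \<Omega> \<psi> y\<^sub>0 f \<alpha> u \<le> cost \<Omega> \<psi> y\<^sub>0 f \<alpha> v" by simp
  qed
  have "unique_global_minimum \<Omega> \<psi> y\<^sub>0 f \<alpha> u" if strict: "?t < \<alpha> * ?l + sqrt (\<alpha>\<^sup>2 * ?l\<^sup>2 + \<alpha>)"
    unfolding unique_global_minimum_def
  proof (intro conjI allI impI glob less_imp_le[OF strict])
    fix v assume "global_minimum \<Omega> \<psi> y\<^sub>0 f \<alpha> v"
    then have v: "v \<in> L2 \<Omega>" and le: "cost \<Omega> \<psi> y\<^sub>0 f \<alpha> v - cost \<Omega> \<psi> y\<^sub>0 f \<alpha> u \<le> 0"
      using assms(7) by (auto simp: global_minimum_def)
    note lt = quadratic_root_bound(2)[OF abs_ge_zero assms(6) strict]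
    obtain E where "cost \<Omega> \<psi> y\<^sub>0 f \<alpha> v - cost \<Omega> \<psi> y\<^sub>0 f \<alpha> u \<ge> 1/2 * E\<^sup>2 +
      \<alpha>/2 * (L2_norm \<Omega> (\<lambda>x. v x - u x))\<^sup>2 + ?t * (?l * E\<^sup>2) - ?t * (L2_norm \<Omega> (\<lambda>x. v x - u x) * E)"
      using diff[OF v] by blast
    \<comment> \<open>A second minimiser has no larger cost than \<open>u\<close>, so the definite
      quadratic form forces the norm of \<open>v - u\<close> to vanish.\<close>
    from quadratic_form_nonneg(2)[OF assms(6) less_imp_le[OF lt] this lt le]
    have "AE x in lebesgue_on \<Omega>. v x - u x = 0"
      using L2_norm_eq_0_iff[OF L2_diff[OF v assms(7)]] by simp
    then show "AE x in lebesgue_on \<Omega>. v x = u x" by eventually_elim simp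
  qed
  with stat glob show ?thesis by blast
qed

end
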